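(* Let $0<\delta<1$ and $s:=2(1+\delta)$. Let $\psi\in L^1(\mathbb{R})$, not almost everywhere zero, be such that (i) $\int_{\mathbb{R}}\psi(x)\,dx=0$; (ii) there are constants $C>0$ and $\beta>1+s$ with $|\psi(x)|\le C|x|^{-\beta}$ for all $x\neq 0$. Let $\eta_{H_\delta}(p)$, $p\in(0,\infty)$, be the scaling exponent of the function $H_\delta$ computed with the wavelet $\psi$. Then $$\eta_{H_\delta}(p)=\begin{cases} sp/2, & \text{if } 0<p\le 2/s,\\ 1, & \text{if } p\ge 2/s.\end{cases}$$ In particular, the Frisch--Parisi formalism holds for $H_\delta$ in the range $[0,s/2]$, that is, $$D_{H_\delta}(h)=\inf_{p>0}\bigl(ph-\eta_{H_\delta}(p)+1\bigr)\qquad\text{for all } h\in[0,s/2],$$ where $D_{H_\delta}$ is the spectrum of singularities of $H_\delta$.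
   Context: Fix $0<\delta<1$, $s=2(1+\delta)$. The measure $h_{\mathrm{p},\delta}$. Let $$h_{\mathrm{p},\delta}=\sum_{(p,q)=1}\frac{a_{q,\delta}}{q^s}\,\delta_{p/q},$$ the sum running over all pairs of coprime integers $p\in\mathbb{Z}$, $q\ge 1$, where $\delta_{p/q}$ is the Dirac mass at $p/q$ and $$a_{q,\delta}=-2b_{1,\delta}\,\zeta(2(1+\delta))\cdot\begin{cases}1,& q\text{ odd},\\ -2(2^{1+2\delta}-1),& q\equiv 2 \pmod 4,\\ 2^{2(1+\delta)},& q\equiv 0\pmod 4,\end{cases}\qquad b_{1,\delta}=\frac{1}{(2\pi)^{2\delta}}\frac{\Gamma(2\delta)}{|\Gamma(-\delta)|\,\Gamma(\delta)},$$ with $\zeta$ the Riemann zeta function. It is a locally finite, $1$-periodic signed measure on $\mathbb{R}$. (It is the renormalized functional $\int|x|^{2\delta}|u(x,t)|^2dx$ for the Schrödinger equation with Dirac comb initial datum.) The function $H_\delta$. $H_\delta(t)=\int_{[0,t]}h_{\mathrm{p},\delta}(ds)=h_{\mathrm{p},\delta}([0,t])$ for $t\ge0$, and $H_\delta(t)=-h_{\mathrm{p},\delta}((t,0))$ for $t<0$; so the distributional derivative of $H_\delta$ on $\mathbb{R}$ is $h_{\mathrm{p},\delta}$. Scaling exponent. Put $\psi_N(x)=N\psi(Nx)$ for $N>0$. For a function $f$ on $\mathbb{R}$, $$\eta_f(p):=-\liminf_{N\to\infty}\frac{\log\|\psi_N*f\|_{L^p}^p}{\log N},$$ where $\|g\|_{L^p}^p=\int_0^1|g(x)|^p\,dx$,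 i.e. $L^p$ norms are taken over $[0,1]$ (for $f=H_\delta$ the function $\psi_N*H_\delta$ is $1$-periodic since $\int\psi=0$). Hölder exponent. For real $l\ge0$, $f\in C^l(t)$ if there is a polynomial $P_t$ of degree at most $\lfloor l\rfloor$ and a constant $C$ such that $|f(r)-P_t(r)|\le C|t-r|^l$ for all $r$ in a neighborhood of $t$. The Hölder exponent of $f$ at $t$ is $h_f(t)=\sup\{l\ge 0: f\in C^l(t)\}$. Spectrum of singularities. $D_f(h)=\dim_{\mathcal{H}}\{t\in\mathbb{R}: h_f(t)=h\}$ (Hausdorff dimension), with $D_f(h)=-\infty$ if this set is empty. *)

theory Defs
  imports "HOL-Analysis.Analysis"
begin

definition zeta_real :: "real \<Rightarrow> real" where \<comment> \<open>meaningful for s > 1 only\<close>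
  "zeta_real s = (\<Sum>n. 1 / real (Suc n) powr s)"

definition b1 :: "real \<Rightarrow> real" where
  "b1 \<delta> = 1 / (2 * pi) powr (2 * \<delta>) * (Gamma (2 * \<delta>) / (\<bar>Gamma (- \<delta>)\<bar> * Gamma \<delta>))"

definition a_coeff :: "real \<Rightarrow> nat \<Rightarrow> real" where
  "a_coeff \<delta> q = - 2 * b1 \<delta> * zeta_real (2 * (1 + \<delta>)) *
     (if odd q then 1
      else if q mod 4 = 2 then - 2 * (2 powr (1 + 2 * \<delta>) - 1)
      else 2 powr (2 * (1 + \<delta>)))"

text \<open>The signed measure is only locally finite, so it is rendered as a real-valued set function,
  meaningful on bounded sets: there the sum of Dirac masses (the indicators) converges
  absolutely.\<close>

definition hp :: "real \<Rightarrow> real set \<Rightarrow> real" where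
  "hp \<delta> A = (\<Sum>\<^sub>\<infinity>(p, q)\<in>{(p :: int, q :: nat). 1 \<le> q \<and> coprime p (int q)}.
     a_coeff \<delta> q / real q powr (2 * (1 + \<delta>)) * indicator A (real_of_int p / real q))"

definition H_fun :: "real \<Rightarrow> real \<Rightarrow> real" where
  "H_fun \<delta> t = (if 0 \<le> t then hp \<delta> {0..t} else - hp \<delta> {t<..<0})"

definition dilate :: "real \<Rightarrow> (real \<Rightarrow> complex) \<Rightarrow> real \<Rightarrow> complex" where
  "dilate N \<psi> x = of_real N * \<psi> (N * x)"

definition convol :: "(real \<Rightarrow> complex) \<Rightarrow> (real \<Rightarrow> real) \<Rightarrow> real \<Rightarrow> complex" where
  "convol g f x = (LINT y|lebesgue. g y * of_real (f (x - y)))"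

definition Lp_power :: "real \<Rightarrow> (real \<Rightarrow> complex) \<Rightarrow> ennreal" where
  "Lp_power p g = (\<integral>\<^sup>+x\<in>{0..1}. ennreal (norm (g x) powr p) \<partial>lebesgue)"

text \<open>Extended logarithm; a zero norm must give \<open>-\<infinity>\<close>, whereas \<open>ln 0 = 0\<close> in the library.\<close>

definition ln_ennreal :: "ennreal \<Rightarrow> ereal" where
  "ln_ennreal x = (if x = 0 then - \<infinity> else if x = top then \<infinity> else ereal (ln (enn2real x)))"

definition scaling_exponent :: "(real \<Rightarrow> complex) \<Rightarrow> (real \<Rightarrow> real) \<Rightarrow> real \<Rightarrow> ereal" where
  "scaling_exponent \<psi> f p =
     - Liminf at_top (\<lambda>N :: real. ln_ennreal (Lp_power p (convol (dilate N \<psi>) f)) / ereal (ln N))"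

text \<open>The case distinction makes \<open>\<bar>t - r\<bar>\<^sup>0 = 1\<close> at \<open>r = t\<close> too (\<open>0 powr 0 = 0\<close> in the library).\<close>

definition holder_at :: "real \<Rightarrow> (real \<Rightarrow> real) \<Rightarrow> real \<Rightarrow> bool" where
  "holder_at l f t \<longleftrightarrow> (\<exists>(P :: real poly) C. degree P \<le> nat \<lfloor>l\<rfloor> \<and>
     (\<forall>\<^sub>F r in nhds t. \<bar>f r - poly P r\<bar> \<le> C * (if l = 0 then 1 else \<bar>t - r\<bar> powr l)))"

definition holder_exponent :: "(real \<Rightarrow> real) \<Rightarrow> real \<Rightarrow> ereal" where
  "holder_exponent f t = Sup {ereal l | l. 0 \<le> l \<and> holder_at l f t}"

text \<open>Covering sets are required to be bounded because \<open>diameter\<close> is unspecified otherwise. For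
  exponent 0 a nonempty set counts 1, an empty one 0.\<close>

definition diam_power :: "real \<Rightarrow> 'a::metric_space set \<Rightarrow> ennreal" where
  "diam_power d U = (if U = {} then 0 else if d = 0 then 1 else ennreal (diameter U powr d))"

definition hausdorff_premeasure :: "real \<Rightarrow> real \<Rightarrow> 'a::metric_space set \<Rightarrow> ennreal" where
  "hausdorff_premeasure d \<epsilon> A =
     Inf {\<Sum>n. diam_power d (U n) | U :: nat \<Rightarrow> 'a set.
            A \<subseteq> (\<Union>n. U n) \<and> (\<forall>n. bounded (U n) \<and> diameter (U n) \<le> \<epsilon>)}"

definition hausdorff_measure :: "real \<Rightarrow> 'a::metric_space set \<Rightarrow> ennreal" where
  "hausdorff_measure d A = (SUP \<epsilon>\<in>{0<..}. hausdorff_premeasure d \<epsilon> A)"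

definition hausdorff_dim :: "'a::metric_space set \<Rightarrow> ereal" where
  "hausdorff_dim A = Inf {ereal d | d. 0 \<le> d \<and> hausdorff_measure d A = 0}"

definition singularity_spectrum :: "(real \<Rightarrow> real) \<Rightarrow> real \<Rightarrow> ereal" where
  "singularity_spectrum f h =
     (let S = {t. holder_exponent f t = ereal h} in if S = {} then - \<infinity> else hausdorff_dim S)"

end

theory Submission
  imports Defs "HOL-Real_Asymp.Real_Asymp"
begin

text \<open>
  \<open>H_fun \<delta>\<close> is a pure jump function with a jump of size comparable to \<open>q powr (-s)\<close> at each
  reduced fraction \<open>p / q\<close>. Since \<open>s > 2\<close> and an interval of length \<open>u\<close> holds at
  most \<open>1 + u * X\<^sup>2\<close> fractions of denominator at most \<open>X\<close>, the increments of \<open>H_fun \<delta>\<close> are controlled,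
  without any cancellation, by the smallest denominator met. Hence the Hoelder exponent at a point
  approximable by rationals to the exact order \<open>\<nu>\<close> is \<open>s / \<nu>\<close>, and the spectrum \<open>2 * h / s\<close> is the
  Jarnik--Besicovitch theorem. The lower bound for the dimension comes from a nested sequence of
  balls around fractions, each chosen by averaging so that it avoids a given cover of small cost; the
  cover is also made to contain all points of approximation order larger than \<open>\<nu>\<close>.

  For the scaling exponent, the transform at scale \<open>N\<close> near \<open>p / q\<close> with \<open>q\<^sup>2\<close> small compared to \<open>N\<close>
  is dominated by the jump at \<open>p / q\<close>; the decay \<open>\<beta> > 1 + s\<close> is exactly integrability of
  \<open>\<bar>z\<bar> powr s\<close> against the wavelet, which bounds the contribution of the other jumps. The fraction
  \<open>1 / 2\<close> alone yields \<open>\<eta> \<le> 1\<close>, and the fractions with \<open>q\<close> close to \<open>sqrt N\<close> yield \<open>\<eta> \<le> s * p / 2\<close>.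
  Conversely, for \<open>2 / s < p < 1\<close> the \<open>p\<close>-th power is subadditive over the jumps and the sum of
  \<open>q powr (- s * p)\<close> over the fractions in a bounded interval converges, so \<open>\<eta> \<ge> 1\<close>; other \<open>p\<close> follow
  by interpolation.
\<close>

section \<open>Counting reduced fractions\<close>

text \<open>Exponents reach s / 2, which lies between 1 and 2, so polynomials of degree 1 compete in
  the definition of the Hoelder exponent. The upper bounds defeat all of them at once by comparing
  the two sides of a single jump, across which a polynomial is continuous. The lower bounds hold
  with the constant \<open>H t\<close>, since a pure jump function has no smooth part.

  The dimension is bounded below without a measure on the exceptional set. If the measure vanished
  in some dimension below D = 2 * h / s, the set would have covers of arbitrarily small D-cost. The
  points of order above 2 / D = s / h form a countable union of D-null sets and can join the cover;
  a point that escapes it and is approximable to all orders below 2 / D has exponent h, a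
  contradiction.

  The critical exponent p = 2 / s is where the sum of q^(-s p) over the fractions of an interval
  begins to diverge. As s > 2, it lies below 1, so there is room for p1 in (2 / s, 1), where p1-th
  powers are subadditive; letting p1 tend to 2 / s recovers the whole range p <= 2 / s. All norm
  bounds hold for every large N, so no subsequence has to be chosen for the liminf.\<close>

lemma card_separated_le:
  fixes S :: "real set"
  assumes "0 < d" "S \<subseteq> {a..b}" "a \<le> b"
    and sep: "\<And>x y. x \<in> S \<Longrightarrow> y \<in> S \<Longrightarrow> x \<noteq> y \<Longrightarrow> d \<le> \<bar>x - y\<bar>"
  shows "finite S" "real (card S) \<le> 1 + (b - a) / d"
proof -
  let ?f = "\<lambda>x. \<lfloor>(x - a) / d\<rfloor>"
  have inj: "inj_on ?f S"
  proof (rule inj_onI, rule ccontr)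
    fix x y assume xy: "x \<in> S" "y \<in> S" "?f x = ?f y" "x \<noteq> y"
    have "d \<le> \<bar>x - y\<bar>" using sep xy by blast
    hence "1 \<le> \<bar>x - y\<bar> / d" using assms(1) by simp
    also have "\<bar>x - y\<bar> / d = \<bar>(x - a) / d - (y - a) / d\<bar>"
      using assms(1) by (simp add: diff_divide_distrib[symmetric] abs_divide)
    finally show False using xy(3) by linarith
  qed
  have sub: "?f ` S \<subseteq> {0..\<lfloor>(b - a) / d\<rfloor>}"
  proof (clarsimp, intro conjI)
    fix x assume "x \<in> S"
    hence x: "a \<le> x" "x \<le> b" using assms(2) by auto
    show "0 \<le> (x - a) / d" using x assms(1) by simp
    show "\<lfloor>(x - a) / d\<rfloor> \<le> \<lfloor>(b - a) / d\<rfloor>" using x assms(1)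
      by (intro floor_mono divide_right_mono) auto
  qed
  show "finite S" using finite_subset[OF sub] finite_imageD[OF _ inj] by simp
  have "card S = card (?f ` S)" using card_image[OF inj] by simp
  also have "\<dots> \<le> card {0..\<lfloor>(b - a) / d\<rfloor>}" using sub by (intro card_mono) auto
  also have "\<dots> = nat (\<lfloor>(b - a) / d\<rfloor> + 1)" by simp
  finally have "real (card S) \<le> real (nat (\<lfloor>(b - a) / d\<rfloor> + 1))" by simp
  also have "\<dots> \<le> 1 + (b - a) / d"
  proof -
    have "0 \<le> (b - a) / d" using assms by simp
    thus ?thesis by linarith
  qed
  finally show "real (card S) \<le> 1 + (b - a) / d" .
qed

definition reduced_pairs :: "(int \<times> nat) set" where
  "reduced_pairs = {(p, q). 1 \<le> q \<and> coprime p (int q)}"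

definition frac_val :: "int \<times> nat \<Rightarrow> real" where
  "frac_val i = real_of_int (fst i) / real (snd i)"

text \<open>Over the common denominator q q' the difference has a nonzero integer numerator.\<close>

lemma frac_diff_ge:
  fixes p p' :: int and q q' :: nat
  assumes "1 \<le> q" "1 \<le> q'" "real_of_int p / q \<noteq> real_of_int p' / q'"
  shows "1 / (real q * real q') \<le> \<bar>real_of_int p / q - real_of_int p' / q'\<bar>"
proof -
  have eq: "real_of_int p / q - real_of_int p' / q' = of_int (p * int q' - p' * int q) / (real q * real q')"
    using assms by (simp add: field_simps)
  have "p * int q' - p' * int q \<noteq> 0"
  proof
    assume "p * int q' - p' * int q = 0"
    hence "real_of_int p / q - real_of_int p' / q' = 0" unfolding eq by simp
    thus False using assms(3) by simp
  qed
  hence "1 \<le> \<bar>p * int q' - p' * int q\<bar>" by linarith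
  hence "1 \<le> \<bar>real_of_int (p * int q' - p' * int q)\<bar>" by linarith
  thus ?thesis unfolding eq abs_divide using assms by (simp add: divide_right_mono)
qed

abbreviation den :: "int \<times> nat \<Rightarrow> real" where
  "den i \<equiv> real (snd i)"

lemma inj_on_frac_val: "inj_on frac_val reduced_pairs"
proof (rule inj_onI)
  fix i j assume ij: "i \<in> reduced_pairs" "j \<in> reduced_pairs" "frac_val i = frac_val j"
  obtain p q p' q' where pq: "i = (p, q)" "j = (p', q')" by (cases i, cases j) auto
  have c: "coprime p (int q)" "coprime p' (int q')" "q \<ge> 1" "q' \<ge> 1"
    using ij pq by (auto simp: reduced_pairs_def)
  have "real_of_int p * real q' = real_of_int p' * real q"
    using ij(3) c pq by (simp add: frac_val_def field_simps)
  hence e: "p * int q' = p' * int q" by (metis of_int_eq_iff of_int_mult of_int_of_nat_eq)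
  hence "int q dvd int q'" using c
    by (metis coprime_commute coprime_dvd_mult_right_iff dvd_triv_right)
  moreover have "int q' dvd int q" using c e
    by (metis coprime_commute coprime_dvd_mult_right_iff dvd_triv_right)
  ultimately have "q = q'" by (simp add: dvd_antisym)
  thus "i = j" using e c pq by auto
qed

lemma frac_val_diff_ge:
  assumes "i \<in> reduced_pairs" "j \<in> reduced_pairs" "i \<noteq> j"
  shows "1 / (den i * den j) \<le> \<bar>frac_val i - frac_val j\<bar>"
proof -
  have "frac_val i \<noteq> frac_val j" using inj_on_frac_val assms by (auto dest: inj_onD)
  thus ?thesis using frac_diff_ge[of "snd i" "snd j" "fst i" "fst j"] assms
    by (auto simp: reduced_pairs_def frac_val_def split: prod.splits)
qed

text \<open>By \<open>frac_val_diff_ge\<close> such fractions are at least 1 / X^2 apart;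
  injectivity of \<open>frac_val\<close> turns the count of values into a count of pairs.\<close>

lemma card_reduced_le:
  assumes "F \<subseteq> reduced_pairs" "0 < X" "a \<le> b"
    and F: "\<And>i. i \<in> F \<Longrightarrow> den i \<le> X \<and> a \<le> frac_val i \<and> frac_val i \<le> b"
  shows "finite F" "real (card F) \<le> 1 + (b - a) * X\<^sup>2"
proof -
  have inj: "inj_on frac_val F" using inj_on_frac_val assms(1) inj_on_subset by blast
  have sep: "1 / X\<^sup>2 \<le> \<bar>x - y\<bar>" if xy: "x \<in> frac_val ` F" "y \<in> frac_val ` F" "x \<noteq> y" for x y
  proof -
    obtain i j where ij: "i \<in> F" "j \<in> F" "x = frac_val i" "y = frac_val j" "i \<noteq> j" using xy by auto
    have pos: "den i > 0" "den j > 0" using ij assms(1) by (auto simp: reduced_pairs_def)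
    have "den i * den j \<le> X * X" using F ij pos assms(2) by (intro mult_mono) auto
    hence "1 / X\<^sup>2 \<le> 1 / (den i * den j)"
      using pos assms(2) by (intro divide_left_mono) (auto simp: power2_eq_square)
    also have "\<dots> \<le> \<bar>x - y\<bar>" using frac_val_diff_ge ij assms(1) by blast
    finally show ?thesis .
  qed
  have sub: "frac_val ` F \<subseteq> {a..b}" using F by auto
  have "0 < 1 / X\<^sup>2" using assms(2) by simp
  note card = card_separated_le[OF this sub assms(3) sep]
  show "finite F" using card(1) finite_imageD inj by blast
  show "real (card F) \<le> 1 + (b - a) * X\<^sup>2" using card(2) card_image[OF inj] by simp
qed

text \<open>Two geometric series over dyadic blocks of denominators; the second converges because 2
  < \<sigma>. The 8 is 2 (an interval of radius u has length 2 u) times 4 (denominators in a block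
  reach twice its lower end, and enter squared).\<close>

definition frac_sum_const :: "real \<Rightarrow> real" where
  "frac_sum_const \<sigma> = 1 / (1 - 2 powr (-\<sigma>)) + 8 / (1 - 2 powr (2-\<sigma>))"

lemma frac_sum_const_pos: "2 < \<sigma> \<Longrightarrow> 0 < frac_sum_const \<sigma>"
  unfolding frac_sum_const_def by (intro add_pos_pos divide_pos_pos) (auto simp: powr_less_one)

text \<open>The block R 2^n <= q < R 2^(n+1) holds at most 1 + 2 u (R 2^(n+1))^2 fractions, each
  contributing at most (R 2^n)^(-\<sigma>). Both terms are geometric in n.\<close>

lemma reduced_power_sum_bound:
  assumes \<sigma>: "2 < \<sigma>" and R: "1 \<le> R" and u: "0 \<le> u" and fin: "finite F" and Fr: "F \<subseteq> reduced_pairs"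
    and F: "\<And>i. i \<in> F \<Longrightarrow> R \<le> den i \<and> \<bar>frac_val i - t\<bar> \<le> u"
  shows "(\<Sum>i\<in>F. den i powr (-\<sigma>)) \<le> frac_sum_const \<sigma> * (R powr (-\<sigma>) + u * R powr (2 - \<sigma>))"
proof -
  define x where "x = (2::real) powr (-\<sigma>)"
  define y where "y = (2::real) powr (2-\<sigma>)"
  have x: "0 < x" "x < 1" using \<sigma> by (auto simp: x_def powr_less_one)
  have y: "0 < y" "y < 1" using \<sigma> by (auto simp: y_def powr_less_one)
  define K where "K = 1 / (1 - x) + 8 / (1 - y)"
  have geo: "(\<Sum>k<n. z ^ k) \<le> 1 / (1 - z)" if "0 < z" "z < 1" for z :: real and n
  proof -
    have "(\<Sum>k<n. z ^ k) = (1 - z ^ n) / (1 - z)" using that by (simp add: sum_gp_strict)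
    also have "\<dots> \<le> 1 / (1 - z)" using that by (intro divide_right_mono) auto
    finally show ?thesis .
  qed
  define lev where "lev n = {i\<in>F. den i < R * 2 ^ n}" for n :: nat
  define B where "B k = R powr (-\<sigma>) * x ^ k + 8 * u * R powr (2-\<sigma>) * y ^ k" for k :: nat
  have step: "(\<Sum>i\<in>lev (Suc n) - lev n. den i powr (-\<sigma>)) \<le> B n" for n
  proof -
    have "(\<Sum>i\<in>lev (Suc n) - lev n. den i powr (-\<sigma>)) \<le>
          real (card (lev (Suc n) - lev n)) * (R * 2 ^ n) powr (-\<sigma>)"
    proof (rule sum_bounded_above)
      fix i assume "i \<in> lev (Suc n) - lev n"
      hence "R * 2 ^ n \<le> real (snd i)" by (auto simp: lev_def)
      thus "den i powr (-\<sigma>) \<le> (R * 2 ^ n) powr (-\<sigma>)" using R \<sigma>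
        by (intro powr_mono2') auto
    qed
    also have "\<dots> \<le> (1 + (t + u - (t - u)) * (R * 2 ^ Suc n)\<^sup>2) * (R * 2 ^ n) powr (-\<sigma>)"
    proof (intro mult_right_mono card_reduced_le(2))
      fix i assume i: "i \<in> lev (Suc n) - lev n"
      hence "\<bar>frac_val i - t\<bar> \<le> u" using F by (auto simp: lev_def)
      thus "den i \<le> R * 2 ^ Suc n \<and> t - u \<le> frac_val i \<and> frac_val i \<le> t + u"
        using i by (auto simp: lev_def)
    qed (use Fr R u in \<open>auto simp: lev_def\<close>)
    also have "\<dots> = (1 + 8 * u * (R * 2 ^ n) powr 2) * (R * 2 ^ n) powr (-\<sigma>)"
      using R by (simp add: power2_eq_square powr_realpow[symmetric] algebra_simps)
    also have "\<dots> = (R * 2 ^ n) powr (-\<sigma>) + 8 * u * (R * 2 ^ n) powr (2-\<sigma>)"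
      by (simp add: algebra_simps powr_add[symmetric])
    also have "\<dots> = B n"
    proof -
      have "(R * 2 ^ n) powr e = R powr e * (2 powr e) ^ n" for e
        using R by (simp add: powr_mult powr_realpow[symmetric] powr_powr mult.commute)
      thus ?thesis by (simp add: B_def x_def y_def)
    qed
    finally show ?thesis .
  qed
  have lev_sum: "(\<Sum>i\<in>lev n. den i powr (-\<sigma>)) \<le> (\<Sum>k<n. B k)" for n
  proof (induction n)
    case 0
    have "lev 0 = {}" using F by (force simp: lev_def)
    thus ?case by simp
  next
    case (Suc n)
    have "lev n \<subseteq> lev (Suc n)" using R by (force simp: lev_def)
    hence "(\<Sum>i\<in>lev (Suc n). den i powr (-\<sigma>)) =
       (\<Sum>i\<in>lev (Suc n) - lev n. den i powr (-\<sigma>)) + (\<Sum>i\<in>lev n. den i powr (-\<sigma>))"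
      using fin by (intro sum.subset_diff) (auto simp: lev_def)
    thus ?case using step[of n] Suc by simp
  qed
  \<comment> \<open>The sum of the denominators bounds each of them, so finitely many blocks exhaust
    \<open>F\<close>.\<close>
  obtain n where n: "(\<Sum>i\<in>F. den i) < 2 ^ n" using real_arch_pow[of 2] by auto
  have "lev n = F"
  proof -
    have "den i < R * 2 ^ n" if "i \<in> F" for i
    proof -
      have "den i \<le> (\<Sum>i\<in>F. den i)" using that fin by (intro member_le_sum) auto
      also have "\<dots> < 2 ^ n" by fact
      also have "\<dots> \<le> R * 2 ^ n" using R by simp
      finally show ?thesis .
    qed
    thus ?thesis by (auto simp: lev_def)
  qed
  hence "(\<Sum>i\<in>F. den i powr (-\<sigma>)) \<le> (\<Sum>k<n. B k)" using lev_sum[of n] by simp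
  also have "\<dots> = R powr (-\<sigma>) * (\<Sum>k<n. x ^ k) + 8 * u * R powr (2-\<sigma>) * (\<Sum>k<n. y ^ k)"
    by (simp add: B_def sum.distrib sum_distrib_left)
  also have "\<dots> \<le> R powr (-\<sigma>) * (1 / (1-x)) + 8 * u * R powr (2-\<sigma>) * (1 / (1-y))"
    using u geo x y by (intro add_mono mult_left_mono) auto
  also have "\<dots> = R powr (-\<sigma>) * (1 / (1-x)) + (u * R powr (2-\<sigma>)) * (8 / (1-y))" by simp
  also have "\<dots> \<le> R powr (-\<sigma>) * K + (u * R powr (2-\<sigma>)) * K"
    using u x y by (intro add_mono mult_left_mono) (auto simp: K_def)
  also have "\<dots> = K * (R powr (-\<sigma>) + u * R powr (2 - \<sigma>))" by (simp add: algebra_simps)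
  also have "K = frac_sum_const \<sigma>" by (simp add: K_def x_def y_def frac_sum_const_def)
  finally show ?thesis .
qed

section \<open>The jump function\<close>

lemma finite_reduced_bounded:
  "finite {i\<in>reduced_pairs. den i \<le> X \<and> \<bar>frac_val i - t\<bar> \<le> u}" (is "finite ?F")
proof (cases "0 < X \<and> 0 \<le> u")
  case True
  thus ?thesis by (intro card_reduced_le(1)[of _ X "t - u" "t + u"]) auto
next
  case False
  hence "?F = {}" by (auto simp: reduced_pairs_def)
  thus ?thesis by (metis finite.emptyI)
qed

lemma zeta_real_pos:
  assumes "1 < s"
  shows "0 < zeta_real s"
proof -
  have "summable (\<lambda>n. 1 / real (Suc n) powr s)"
    using summable_real_powr_iff[of "-s"] assms summable_ignore_initial_segment[of "\<lambda>n. real n powr (-s)" 1]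
    by (simp add: powr_minus_divide add.commute)
  thus ?thesis unfolding zeta_real_def by (rule suminf_pos) auto
qed

text \<open>The factor in doubt is \<open>Gamma (- \<delta>)\<close>: since -1 < -\<delta> < 0 it is
  not taken at a pole, where \<open>Gamma\<close> has the default value 0.\<close>

lemma b1_pos:
  assumes "0 < \<delta>" "\<delta> < 1"
  shows "0 < b1 \<delta>"
proof -
  have "- \<delta> \<notin> \<int>\<^sub>\<le>\<^sub>0"
  proof
    assume "- \<delta> \<in> \<int>\<^sub>\<le>\<^sub>0"
    then obtain n where "- \<delta> = of_int n" by (auto elim!: nonpos_Ints_cases)
    hence "of_int (-1) < real_of_int n" "real_of_int n < of_int 0" using assms by auto
    hence "-1 < n" "n < 0" by (simp_all only: of_int_less_iff)
    thus False by linarith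
  qed
  hence "Gamma (- \<delta>) \<noteq> 0" by (simp add: Gamma_eq_zero_iff)
  thus ?thesis using assms unfolding b1_def
    by (auto intro!: mult_pos_pos divide_pos_pos simp: Gamma_real_pos)
qed

locale jump_function =
  fixes \<delta> s :: real
  assumes delta: "0 < \<delta>" "\<delta> < 1" and s_eq: "s = 2 * (1 + \<delta>)"
begin

abbreviation H :: "real \<Rightarrow> real" where
  "H \<equiv> H_fun \<delta>"

lemma s_bounds: "2 < s" "s < 4" using delta s_eq by auto

definition mass :: "int \<times> nat \<Rightarrow> real" where
  "mass i = a_coeff \<delta> (snd i) / den i powr s"

definition mass_const :: real where
  "mass_const = 2 * b1 \<delta> * zeta_real s"

lemma mass_const_pos: "0 < mass_const"
  unfolding mass_const_def using b1_pos[OF delta] zeta_real_pos[of s] s_bounds by simp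

text \<open>The case factor is 1, -(2^s - 2) or 2^s, and 2^s > 4. Hence every mass is comparable to
  q^(-s).\<close>

lemma abs_a_coeff: "mass_const \<le> \<bar>a_coeff \<delta> q\<bar>" "\<bar>a_coeff \<delta> q\<bar> \<le> mass_const * 2 powr s"
proof -
  define f :: real where "f = (if odd q then 1
      else if q mod 4 = 2 then - 2 * (2 powr (1 + 2 * \<delta>) - 1)
      else 2 powr (2 * (1 + \<delta>)))"
  have "a_coeff \<delta> q = - (mass_const * f)"
    unfolding a_coeff_def f_def mass_const_def s_eq[symmetric] by simp
  hence a: "\<bar>a_coeff \<delta> q\<bar> = mass_const * \<bar>f\<bar>"
    using mass_const_pos by (simp add: abs_mult)
  have t: "(2::real) powr (1 + 2 * \<delta>) \<ge> 2 powr 1" using delta by (intro powr_mono) auto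
  have t2: "(2::real) powr s = 2 * 2 powr (1 + 2 * \<delta>)"
    using powr_add[of "2::real" 1 "1 + 2*\<delta>"] by (simp add: s_eq algebra_simps)
  have "f = (if odd q then 1 else if q mod 4 = 2 then - 2 * (2 powr (1 + 2 * \<delta>) - 1) else 2 powr s)"
    unfolding f_def s_eq[symmetric] ..
  hence "1 \<le> \<bar>f\<bar>" "\<bar>f\<bar> \<le> 2 powr s" using t t2 by auto
  thus "mass_const \<le> \<bar>a_coeff \<delta> q\<bar>" "\<bar>a_coeff \<delta> q\<bar> \<le> mass_const * 2 powr s"
    using mass_const_pos unfolding a by auto
qed

lemma abs_mass: "mass_const * den i powr (-s) \<le> \<bar>mass i\<bar>"
  "\<bar>mass i\<bar> \<le> mass_const * 2 powr s * den i powr (-s)"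
proof -
  have "\<bar>mass i\<bar> = \<bar>a_coeff \<delta> (snd i)\<bar> * den i powr (-s)"
    by (simp add: mass_def abs_mult powr_minus field_class.field_divide_inverse)
  thus "mass_const * den i powr (-s) \<le> \<bar>mass i\<bar>"
    "\<bar>mass i\<bar> \<le> mass_const * 2 powr s * den i powr (-s)"
    using abs_a_coeff by (simp_all add: mult_right_mono)
qed

lemma hp_eq: "hp \<delta> A = (\<Sum>\<^sub>\<infinity>i\<in>reduced_pairs. mass i * indicator A (frac_val i))"
  unfolding hp_def reduced_pairs_def mass_def frac_val_def s_eq[symmetric]
  by (intro infsum_cong) auto

definition hp_const :: real where
  "hp_const = mass_const * 2 powr s * frac_sum_const s"

lemma hp_const_pos: "0 < hp_const"
  unfolding hp_const_def using mass_const_pos frac_sum_const_pos[OF s_bounds(1)] by simp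

text \<open>One finite estimate serves twice: with R = 1 for absolute summability on bounded sets,
  with general R for the tail left when finitely many jumps are removed.\<close>

lemma sum_mass_bound:
  assumes G: "finite G" "G \<subseteq> reduced_pairs" "0 \<le> u" "1 \<le> R" "A \<subseteq> cball t u"
    "\<And>i. i \<in> G \<Longrightarrow> frac_val i \<in> A \<Longrightarrow> R \<le> real (snd i)"
  shows "(\<Sum>i\<in>G. \<bar>mass i * indicator A (frac_val i)\<bar>) \<le> hp_const * (R powr (-s) + u * R powr (2 - s))"
proof -
  let ?G = "{i\<in>G. frac_val i \<in> A}"
  have "(\<Sum>i\<in>G. \<bar>mass i * indicator A (frac_val i)\<bar>) = (\<Sum>i\<in>?G. \<bar>mass i\<bar>)"
    using G(1) by (intro sum.mono_neutral_cong_right) (auto simp: indicator_def)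
  also have "\<dots> \<le> (\<Sum>i\<in>?G. mass_const * 2 powr s * den i powr (-s))"
    by (intro sum_mono abs_mass)
  also have "\<dots> = mass_const * 2 powr s * (\<Sum>i\<in>?G. den i powr (-s))"
    by (simp add: sum_distrib_left)
  also have "\<dots> \<le> mass_const * 2 powr s * (frac_sum_const s * (R powr (-s) + u * R powr (2 - s)))"
  proof (intro mult_left_mono reduced_power_sum_bound[OF s_bounds(1)])
    fix i assume i: "i \<in> ?G"
    hence "frac_val i \<in> cball t u" using G(5) by auto
    thus "R \<le> den i \<and> \<bar>frac_val i - t\<bar> \<le> u"
      using G(6) i by (auto simp: dist_real_def)
  qed (use G mass_const_pos in auto)
  finally show ?thesis by (simp add: hp_const_def)
qed

lemma mass_abs_summable:
  assumes "bounded A"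
  shows "(\<lambda>i. norm (mass i * indicator A (frac_val i))) summable_on reduced_pairs"
proof -
  obtain b where b: "\<forall>x\<in>A. norm x \<le> b" using assms unfolding bounded_iff by blast
  have A: "A \<subseteq> cball 0 \<bar>b\<bar>" using b by (auto simp: dist_real_def)
  show ?thesis
  proof (rule nonneg_bdd_above_summable_on)
    show "bdd_above (sum (\<lambda>i. norm (mass i * indicator A (frac_val i))) ` {F. F \<subseteq> reduced_pairs \<and> finite F})"
    proof (rule bdd_aboveI2)
      fix G assume "G \<in> {F. F \<subseteq> reduced_pairs \<and> finite F}"
      thus "(\<Sum>i\<in>G. norm (mass i * indicator A (frac_val i))) \<le> hp_const * (1 powr (-s) + \<bar>b\<bar> * 1 powr (2 - s))"
        unfolding real_norm_def using A by (intro sum_mass_bound) (auto simp: reduced_pairs_def)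
    qed
  qed auto
qed

lemma mass_summable:
  "bounded A \<Longrightarrow> (\<lambda>i. mass i * indicator A (frac_val i)) summable_on reduced_pairs"
  by (rule abs_summable_summable) (rule mass_abs_summable)

text \<open>The source of all increment estimates for \<open>H\<close>. It is applied with
  \<open>F\<close> empty (increments), with \<open>F\<close> a single fraction (behaviour next to a
  jump) and with \<open>F\<close> all fractions of small denominator (upper bound of the
  transform).\<close>

lemma hp_approx:
  assumes F: "finite F" "F \<subseteq> reduced_pairs" and u: "0 \<le> u" and R: "1 \<le> R" and A: "A \<subseteq> cball t u"
    and big: "\<And>i. i \<in> reduced_pairs - F \<Longrightarrow> frac_val i \<in> A \<Longrightarrow> R \<le> real (snd i)"
  shows "\<bar>hp \<delta> A - (\<Sum>i\<in>F. mass i * indicator A (frac_val i))\<bar>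
    \<le> hp_const * (R powr (-s) + u * R powr (2 - s))"
proof -
  let ?g = "\<lambda>i. mass i * indicator A (frac_val i)"
  have "bounded A" using A bounded_subset bounded_cball by blast
  from mass_abs_summable[OF this] have s1: "(\<lambda>i. norm (?g i)) summable_on (reduced_pairs - F)"
    by (rule summable_on_subset_banach) auto
  have eq: "hp \<delta> A = (\<Sum>i\<in>F. ?g i) + (\<Sum>\<^sub>\<infinity>i\<in>reduced_pairs - F. ?g i)"
  proof -
    have "(\<Sum>\<^sub>\<infinity>i\<in>F \<union> (reduced_pairs - F). ?g i) = infsum ?g F + infsum ?g (reduced_pairs - F)"
      using F(1) abs_summable_summable[OF s1] by (intro infsum_Un_disjoint) auto
    moreover have "F \<union> (reduced_pairs - F) = reduced_pairs" using F by auto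
    ultimately show ?thesis using F(1) by (simp add: hp_eq)
  qed
  have "\<bar>\<Sum>\<^sub>\<infinity>i\<in>reduced_pairs - F. ?g i\<bar> \<le> (\<Sum>\<^sub>\<infinity>i\<in>reduced_pairs - F. norm (?g i))"
    using norm_infsum_bound[OF s1] by simp
  also have "\<dots> \<le> hp_const * (R powr (-s) + u * R powr (2 - s))"
    using s1
  proof (rule infsum_le_finite_sums)
    fix G assume "finite G" "G \<subseteq> reduced_pairs - F"
    thus "(\<Sum>i\<in>G. norm (?g i)) \<le> hp_const * (R powr (-s) + u * R powr (2 - s))"
      unfolding real_norm_def using u R A big by (intro sum_mass_bound) auto
  qed
  finally show ?thesis using eq by simp
qed

lemma hp_Un:
  assumes "bounded A" "bounded B" "A \<inter> B = {}"
  shows "hp \<delta> (A \<union> B) = hp \<delta> A + hp \<delta> B"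
proof -
  have "hp \<delta> (A \<union> B) = (\<Sum>\<^sub>\<infinity>i\<in>reduced_pairs. mass i * indicator A (frac_val i) + mass i * indicator B (frac_val i))"
    unfolding hp_eq using assms(3) by (intro infsum_cong) (auto simp: indicator_def)
  also have "\<dots> = hp \<delta> A + hp \<delta> B"
    unfolding hp_eq by (rule infsum_add[OF mass_summable[OF assms(1)] mass_summable[OF assms(2)]])
  finally show ?thesis .
qed

text \<open>The two clauses of \<open>H_fun\<close> are matched so that the jump at 0 belongs to
  \<open>H 0\<close>; hence \<open>H\<close> is right-continuous everywhere and one formula holds
  across the origin.\<close>

lemma H_diff:
  assumes "a \<le> b"
  shows "H b - H a = hp \<delta> {a<..b}"
proof -
  have "0 \<le> a \<or> a < 0 \<and> 0 \<le> b \<or> b < 0" by linarith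
  then consider "0 \<le> a" | "a < 0" "0 \<le> b" | "b < 0" by blast
  thus ?thesis
  proof cases
    case 1
    have "hp \<delta> ({0..a} \<union> {a<..b}) = hp \<delta> {0..a} + hp \<delta> {a<..b}" by (rule hp_Un) auto
    moreover have "{0..a} \<union> {a<..b} = {0..b}" using assms 1 by auto
    ultimately show ?thesis using 1 assms by (simp add: H_fun_def)
  next
    case 2
    have "hp \<delta> ({a<..<0} \<union> {0..b}) = hp \<delta> {a<..<0} + hp \<delta> {0..b}" by (rule hp_Un) auto
    moreover have "{a<..<0} \<union> {0..b} = {a<..b}" using assms 2 by auto
    ultimately show ?thesis using 2 assms by (simp add: H_fun_def)
  next
    case 3
    have "hp \<delta> ({a<..b} \<union> {b<..<0}) = hp \<delta> {a<..b} + hp \<delta> {b<..<0}" by (rule hp_Un) auto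
    moreover have "{a<..b} \<union> {b<..<0} = {a<..<0}" using assms 3 by auto
    ultimately show ?thesis using 3 assms by (simp add: H_fun_def)
  qed
qed

text \<open>Any other fraction within u of p / q has denominator at least 1 / (q u), so
  \<open>hp_approx\<close> applies with R = 1 / (q u). If q u > 1 this is below 1; then R = 1 is
  used and the claimed bound is larger still.\<close>

lemma hp_near_frac:
  assumes i: "i \<in> reduced_pairs" and u: "0 < u" and A: "A \<subseteq> cball (frac_val i) u"
  shows "\<bar>hp \<delta> A - mass i * indicator A (frac_val i)\<bar>
    \<le> hp_const * ((den i * u) powr s + u * (den i * u) powr (s - 2))"
proof -
  have q: "1 \<le> real (snd i)" using i by (auto simp: reduced_pairs_def)
  define v where "v = den i * u"
  have v: "0 < v" using q u by (simp add: v_def)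
  have single: "(\<Sum>j\<in>{i}. mass j * indicator A (frac_val j)) = mass i * indicator A (frac_val i)"
    by (subst sum.insert) simp_all
  show ?thesis
  proof (cases "v \<le> 1")
    case True
    have "\<bar>hp \<delta> A - (\<Sum>j\<in>{i}. mass j * indicator A (frac_val j))\<bar>
      \<le> hp_const * ((1 / v) powr (-s) + u * (1 / v) powr (2 - s))"
    proof (rule hp_approx)
      fix j assume j: "j \<in> reduced_pairs - {i}" "frac_val j \<in> A"
      have qj: "1 \<le> real (snd j)" using j by (auto simp: reduced_pairs_def)
      have "1 / (den i * den j) \<le> \<bar>frac_val i - frac_val j\<bar>"
        using frac_val_diff_ge i j by blast
      also have "\<dots> \<le> u" using j A by (auto simp: dist_real_def)
      finally show "1 / v \<le> real (snd j)" using q qj u by (simp add: v_def field_simps)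
    qed (use i u A v True in auto)
    moreover have "(1 / v) powr (-s) = v powr s" "(1 / v) powr (2 - s) = v powr (s - 2)"
      using v by (simp_all add: powr_def ln_div algebra_simps)
    ultimately show ?thesis unfolding v_def[symmetric] single by simp
  next
    case False
    have "\<bar>hp \<delta> A - (\<Sum>j\<in>{i}. mass j * indicator A (frac_val j))\<bar> \<le> hp_const * (1 powr (-s) + u * 1 powr (2 - s))"
      by (rule hp_approx) (use i u A in \<open>auto simp: reduced_pairs_def\<close>)
    also have "\<dots> \<le> hp_const * (v powr s + u * v powr (s - 2))"
      using False u s_bounds hp_const_pos by (intro mult_left_mono add_mono) (auto intro!: ge_one_powr_ge_zero)
    finally show ?thesis unfolding v_def[symmetric] single .
  qed
qed

lemma H_diff_bound:
  assumes R: "1 \<le> R" and big: "\<And>i. i \<in> reduced_pairs \<Longrightarrow> \<bar>frac_val i - y\<bar> \<le> \<bar>x - y\<bar> \<Longrightarrow> R \<le> real (snd i)"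
  shows "\<bar>H x - H y\<bar> \<le> hp_const * (R powr (-s) + \<bar>x - y\<bar> * R powr (2 - s))"
proof -
  have "\<bar>H x - H y\<bar> = \<bar>hp \<delta> {min x y<..max x y}\<bar>"
    using H_diff[of x y] H_diff[of y x] by (cases "x \<le> y") (auto simp: min_def max_def)
  also have "\<dots> = \<bar>hp \<delta> {min x y<..max x y} - (\<Sum>i\<in>{}. mass i * indicator {min x y<..max x y} (frac_val i))\<bar>"
    by simp
  also have "\<dots> \<le> hp_const * (R powr (-s) + \<bar>x - y\<bar> * R powr (2 - s))"
  proof (rule hp_approx[where t=y])
    show sub: "{min x y<..max x y} \<subseteq> cball y \<bar>x - y\<bar>" by (auto simp: dist_real_def)
    show "R \<le> real (snd i)" if "i \<in> reduced_pairs - {}" "frac_val i \<in> {min x y<..max x y}" for i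
      using that sub by (intro big) (auto simp: dist_real_def)
  qed (use R in auto)
  finally show ?thesis .
qed

lemma H_growth: "\<bar>H x - H y\<bar> \<le> hp_const * (1 + \<bar>x - y\<bar>)"
  using H_diff_bound[of 1 y x] by (auto simp: reduced_pairs_def)

lemma frac_val_in_Rats: "frac_val i \<in> \<rat>"
  by (simp add: frac_val_def)

text \<open>The finitely many nearby fractions with denominator at most R keep a positive distance
  from t, so small increments only meet large denominators. This makes \<open>H\<close> Borel
  measurable, as the rationals are countable.\<close>

lemma isCont_H_irrational:
  assumes "t \<notin> \<rat>"
  shows "isCont H t"
proof -
  show ?thesis unfolding isCont_def LIM_def
  proof (intro allI impI)
    fix e :: real assume e: "0 < e"
    have "((\<lambda>R. hp_const * (R powr (-s) + 1 * R powr (2 - s))) \<longlongrightarrow> hp_const * (0 + 1 * 0)) at_top"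
      using s_bounds by (intro tendsto_intros tendsto_neg_powr filterlim_ident) auto
    hence "\<forall>\<^sub>F R in at_top. hp_const * (R powr (-s) + 1 * R powr (2 - s)) < e"
      using e by (intro order_tendstoD(2)) auto
    hence "\<forall>\<^sub>F R in at_top. hp_const * (R powr (-s) + 1 * R powr (2 - s)) < e \<and> 1 \<le> R"
      using eventually_ge_at_top eventually_conj by blast
    then obtain R where R: "hp_const * (R powr (-s) + 1 * R powr (2 - s)) < e" "1 \<le> R"
      using eventually_happens'[OF trivial_limit_at_top_linorder] by blast
    have "finite (frac_val ` {i\<in>reduced_pairs. den i \<le> R \<and> \<bar>frac_val i - t\<bar> \<le> 1})"
      using finite_reduced_bounded by blast
    from finite_set_avoid[OF this, of t] obtain d where d: "0 < d"
      "\<And>i. i \<in> reduced_pairs \<Longrightarrow> den i \<le> R \<Longrightarrow> \<bar>frac_val i - t\<bar> \<le> 1 \<Longrightarrow> d \<le> dist t (frac_val i)"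
      using assms frac_val_in_Rats by fastforce
    show "\<exists>d>0. \<forall>x. x \<noteq> t \<and> dist x t < d \<longrightarrow> dist (H x) (H t) < e"
    proof (intro exI[of _ "min d 1"] conjI allI impI)
      fix x assume x: "x \<noteq> t \<and> dist x t < min d 1"
      have "\<bar>H x - H t\<bar> \<le> hp_const * (R powr (-s) + \<bar>x - t\<bar> * R powr (2 - s))"
      proof (rule H_diff_bound[OF R(2)])
        fix i assume i: "i \<in> reduced_pairs" "\<bar>frac_val i - t\<bar> \<le> \<bar>x - t\<bar>"
        show "R \<le> real (snd i)" using d(2)[OF i(1)] i x by (force simp: dist_real_def)
      qed
      also have "\<dots> \<le> hp_const * (R powr (-s) + 1 * R powr (2 - s))"
        using x hp_const_pos by (intro mult_left_mono add_mono mult_right_mono) (auto simp: dist_real_def)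
      finally show "dist (H x) (H t) < e" using R by (simp add: dist_real_def)
    qed (use d in auto)
  qed
qed

lemma borel_measurable_H [measurable]: "H \<in> borel_measurable borel"
proof (rule borel_measurable_continuous_countable_exceptions)
  show "countable (\<rat> :: real set)" by (rule countable_rat)
  show "continuous_on (- \<rat>) H"
    by (intro continuous_at_imp_continuous_on) (auto intro: isCont_H_irrational)
qed

end

section \<open>Hoelder exponents\<close>

text \<open>Fractions need not be reduced and error 0 is allowed, so a rational number belongs to
  this set for every \<nu>, through the multiples of its own denominator. This agrees with Hoelder
  exponent 0 at the jumps.\<close>

definition approximable :: "real \<Rightarrow> real set" where
  "approximable \<nu> = {t. \<forall>Q. \<exists>q\<ge>Q. \<exists>p::int. 1 \<le> q \<and> \<bar>t - of_int p / real q\<bar> \<le> real q powr (-\<nu>)}"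

lemma reduced_pair_of_fraction:
  assumes "1 \<le> q"
  obtains i where "i \<in> reduced_pairs" "frac_val i = of_int p / real q" "1 \<le> snd i" "snd i \<le> q"
proof -
  define g where "g = gcd p (int q)"
  have g: "g > 0" using assms by (simp add: g_def)
  then obtain p' b where pb: "p = p' * g" "int q = b * g" "coprime p' b"
    using gcd_coprime_exists[of p "int q"] unfolding g_def by fastforce
  have "0 < b * g" using pb(2) assms by linarith
  hence b: "0 < b" using g zero_less_mult_pos2 by blast
  have "b * 1 \<le> b * g" using b g by (intro mult_left_mono) auto
  hence bq: "b \<le> int q" using pb(2) by simp
  have "real q = of_int b * of_int g" using pb(2) by (metis of_int_mult of_int_of_nat_eq)
  hence "frac_val (p', nat b) = of_int p / real q" using pb(1) b g by (simp add: frac_val_def)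
  moreover have "(p', nat b) \<in> reduced_pairs" using pb(3) b by (auto simp: reduced_pairs_def)
  ultimately show ?thesis using b bq by (intro that[of "(p', nat b)"]) auto
qed

text \<open>Dirichlet's theorem for irrational t; for t = a / b the fractions (a k) / (b k) have
  error 0.\<close>

lemma approximable_two: "t \<in> approximable 2"
  unfolding approximable_def
proof (intro CollectI allI)
  fix Q
  show "\<exists>q\<ge>Q. \<exists>p::int. 1 \<le> q \<and> \<bar>t - of_int p / real q\<bar> \<le> real q powr (-2)"
  proof (cases "t \<in> \<rat>")
    case True
    then obtain a b where ab: "b > 0" "t = of_int a / of_int b" by (auto elim: Rats_cases')
    define q where "q = nat b * (Q + 1)"
    have "nat b \<ge> 1" using ab by linarith
    hence "1 * (Q + 1) \<le> q" unfolding q_def by (intro mult_right_mono) auto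
    moreover have "t = of_int (a * int (Q + 1)) / real q"
    proof -
      have "real q = of_int b * real (Q + 1)" using ab by (simp add: q_def algebra_simps)
      moreover have "real_of_int (a * int (Q + 1)) = of_int a * real (Q + 1)" by simp
      ultimately show ?thesis using ab by simp
    qed
    ultimately show ?thesis by (intro exI[of _ q] conjI exI[of _ "a * int (Q+1)"]) auto
  next
      case False
    hence "infinite (approx_set t)" using rational_iff_finite_approx_set by blast
    then obtain h k where hk: "(h, k) \<in> approx_set t" "int Q < k" using infinite_approx_set by blast
    define q where "q = nat k"
    have q: "Q < q" "k = int q" using hk(2) by (auto simp: q_def)
    have "\<bar>t - of_int h / real q\<bar> < 1 / (real q)\<^sup>2"
      using hk(1) unfolding approx_set_def q(2) by simp
    also have "1 / (real q)\<^sup>2 = real q powr (-2)" using q(1) by (simp add: powr_minus divide_inverse)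
    finally show ?thesis using q(1) by (intro exI[of _ q] conjI exI[of _ h]) auto
  qed
qed

context jump_function
begin

text \<open>The jump lies entirely on the left by right-continuity. Apply
  \<open>hp_near_frac\<close> to the half-open interval from y to the fraction and let its length
  tend to 0.\<close>

lemma H_left_limit:
  assumes i: "i \<in> reduced_pairs"
  shows "(H \<longlongrightarrow> H (frac_val i) - mass i) (at_left (frac_val i))"
proof -
  define x where "x = frac_val i"
  define q where "q = real (snd i)"
  have q: "q > 0" using i by (auto simp: q_def reduced_pairs_def)
  let ?B = "\<lambda>y. hp_const * ((q * (x - y)) powr s + (x - y) * (q * (x - y)) powr (s - 2))"
  have "((\<lambda>y. H y - (H x - mass i)) \<longlongrightarrow> 0) (at_left x)"
  proof (rule Lim_null_comparison)
    show "\<forall>\<^sub>F y in at_left x. norm (H y - (H x - mass i)) \<le> ?B y"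
      unfolding eventually_at_left_field
    proof (intro exI[of _ "x - 1"] conjI allI impI)
      fix y assume y: "x - 1 < y" "y < x"
      have "\<bar>hp \<delta> {y<..x} - mass i * indicator {y<..x} (frac_val i)\<bar>
         \<le> hp_const * ((den i * (x - y)) powr s + (x - y) * (den i * (x - y)) powr (s - 2))"
        by (rule hp_near_frac[OF i]) (use y in \<open>auto simp: x_def dist_real_def\<close>)
      moreover have "hp \<delta> {y<..x} = H x - H y" using H_diff[of y x] y by simp
      ultimately show "norm (H y - (H x - mass i)) \<le> ?B y"
        using y by (simp add: x_def q_def)
    qed simp
    have "(?B \<longlongrightarrow> hp_const * ((q * (x - x)) powr s + (x - x) * (q * (x - x)) powr (s - 2))) (at_left x)"
      using s_bounds q
      by (intro tendsto_intros tendsto_powr'; simp add: eventually_at_left_field)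
         (auto intro: exI[of _ "x - 1"])
    thus "(?B \<longlongrightarrow> 0) (at_left x)" using s_bounds by simp
  qed
  hence "((\<lambda>y. (H y - (H x - mass i)) + (H x - mass i)) \<longlongrightarrow> 0 + (H x - mass i)) (at_left x)"
    by (intro tendsto_intros)
  thus ?thesis by (simp add: x_def)
qed

lemma holder_at_H_zero: "holder_at 0 H t"
proof -
  have "\<forall>\<^sub>F r in nhds t. \<bar>H r - poly [:H t:] r\<bar> \<le> hp_const * 2"
    unfolding eventually_nhds_metric
  proof (intro exI[of _ 1] conjI allI impI)
    fix r assume "dist r t < 1"
    hence "hp_const * (1 + \<bar>r - t\<bar>) \<le> hp_const * 2" using hp_const_pos by (simp add: dist_real_def)
    thus "\<bar>H r - poly [:H t:] r\<bar> \<le> hp_const * 2" using H_growth[of r t] by simp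
  qed simp
  thus ?thesis unfolding holder_at_def
    by (intro exI[of _ "[:H t:]"] exI[of _ "2 * hp_const"]) (auto simp: mult.commute)
qed

lemma holder_exponent_H_nonneg: "0 \<le> holder_exponent H t"
  unfolding holder_exponent_def using holder_at_H_zero[of t]
  by (intro Sup_upper CollectI exI[of _ 0]) simp

text \<open>The Hoelder inequality holds at the fraction and, in the limit, to the left of it. The
  polynomial takes the same value in both, so subtraction leaves the jump; its degree is irrelevant,
  which also covers l > 1.\<close>

lemma jump_le_of_holder_at:
  assumes l: "0 < l" and h: "holder_at l H t"
  obtains C d where "0 < d" "\<And>i. i \<in> reduced_pairs \<Longrightarrow> \<bar>frac_val i - t\<bar> < d \<Longrightarrow>
    \<bar>mass i\<bar> \<le> C * \<bar>frac_val i - t\<bar> powr l"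
proof -
  obtain P :: "real poly" and C where
    "\<forall>\<^sub>F r in nhds t. \<bar>H r - poly P r\<bar> \<le> C * \<bar>t - r\<bar> powr l"
    using h l by (auto simp: holder_at_def)
  then obtain d where d: "d > 0" "\<And>r. \<bar>r - t\<bar> < d \<Longrightarrow> \<bar>H r - poly P r\<bar> \<le> C * \<bar>t - r\<bar> powr l"
    by (auto simp: eventually_nhds_metric dist_real_def)
  show ?thesis
  proof (rule that[of d "2 * C"])
    fix i assume i: "i \<in> reduced_pairs" and x: "\<bar>frac_val i - t\<bar> < d"
    define x where "x = frac_val i"
    have xd: "\<bar>x - t\<bar> < d" using x by (simp add: x_def)
    have lim1: "((\<lambda>y. \<bar>H y - poly P y\<bar>) \<longlongrightarrow> \<bar>(H x - mass i) - poly P x\<bar>) (at_left x)"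
      using H_left_limit[OF i]
      by (intro tendsto_intros) (auto simp: x_def intro!: tendsto_intros)
    have lim2: "((\<lambda>y. C * \<bar>t - y\<bar> powr l) \<longlongrightarrow> C * \<bar>t - x\<bar> powr l) (at_left x)"
      using l by (intro tendsto_intros tendsto_powr') auto
    have ev: "\<forall>\<^sub>F y in at_left x. \<bar>H y - poly P y\<bar> \<le> C * \<bar>t - y\<bar> powr l"
      unfolding eventually_at_left_field
    proof (intro exI[of _ "t - d"] conjI allI impI)
      fix y assume "t - d < y" "y < x"
      thus "\<bar>H y - poly P y\<bar> \<le> C * \<bar>t - y\<bar> powr l" using xd by (intro d(2)) auto
    qed (use xd in auto)
    have "\<bar>(H x - mass i) - poly P x\<bar> \<le> C * \<bar>t - x\<bar> powr l"
      by (rule tendsto_le[OF _ lim2 lim1 ev]) simp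
    thus "\<bar>mass i\<bar> \<le> 2 * C * \<bar>frac_val i - t\<bar> powr l"
      using d(2)[OF xd] unfolding x_def[symmetric] by (simp add: abs_minus_commute) 
  qed (use d in auto)
qed

text \<open>At distance at most q^(-\<nu>) from t there is a jump of size at least a constant times
  q^(-s). For l > s / \<nu> the Hoelder condition would bound it by a constant times q^(-\<nu> l),
  which is smaller for large q.\<close>

lemma holder_exponent_H_le:
  assumes t: "t \<in> approximable \<nu>" and \<nu>: "0 < \<nu>"
  shows "holder_exponent H t \<le> ereal (s / \<nu>)"
  unfolding holder_exponent_def
proof (rule Sup_least, clarsimp)
  fix l assume l: "0 \<le> l" and h: "holder_at l H t"
  show "l \<le> s / \<nu>"
  proof (rule ccontr)
    assume "\<not> l \<le> s / \<nu>"
    hence ls: "s / \<nu> < l" by simp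
    have "0 < s / \<nu>" using \<nu> s_bounds by simp
    hence l0: "0 < l" using ls by linarith
    obtain C d where Cd: "0 < d" "\<And>i. i \<in> reduced_pairs \<Longrightarrow> \<bar>frac_val i - t\<bar> < d \<Longrightarrow>
      \<bar>mass i\<bar> \<le> C * \<bar>frac_val i - t\<bar> powr l"
      using jump_le_of_holder_at[OF l0 h] by blast
    have e: "0 < \<nu> * l - s" using ls \<nu> by (simp add: field_simps)
    have "((\<lambda>q. \<bar>C\<bar> * real q powr (- (\<nu> * l - s))) \<longlongrightarrow> \<bar>C\<bar> * 0) sequentially"
      using e by (intro tendsto_intros tendsto_neg_powr filterlim_real_sequentially) auto
    hence "\<forall>\<^sub>F q in sequentially. \<bar>C\<bar> * real q powr (- (\<nu> * l - s)) < mass_const"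
      using mass_const_pos by (intro order_tendstoD(2)) auto
    moreover have "((\<lambda>q. real q powr (-\<nu>)) \<longlongrightarrow> 0) sequentially"
      using \<nu> by (intro tendsto_neg_powr filterlim_real_sequentially) auto
    hence "\<forall>\<^sub>F q in sequentially. real q powr (-\<nu>) < d" using Cd(1) by (intro order_tendstoD(2)) auto
    ultimately have "\<forall>\<^sub>F q in sequentially. \<bar>C\<bar> * real q powr (- (\<nu> * l - s)) < mass_const \<and> real q powr (-\<nu>) < d"
      by (rule eventually_conj)
    then obtain Q where Q: "\<And>q. q \<ge> Q \<Longrightarrow> \<bar>C\<bar> * real q powr (- (\<nu> * l - s)) < mass_const"
        "\<And>q. q \<ge> Q \<Longrightarrow> real q powr (-\<nu>) < d"
      unfolding eventually_sequentially by blast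
    obtain q p where qp: "q \<ge> Q" "1 \<le> q" "\<bar>t - of_int p / real q\<bar> \<le> real q powr (-\<nu>)"
      using t unfolding approximable_def by blast
    obtain i where i: "i \<in> reduced_pairs" "frac_val i = of_int p / real q" "1 \<le> snd i" "snd i \<le> q"
      using reduced_pair_of_fraction[OF qp(2)] by blast
    have close: "\<bar>frac_val i - t\<bar> \<le> real q powr (-\<nu>)" using qp(3) i(2) by (simp add: abs_minus_commute)
    \<comment> \<open>Reducing the fraction only lowers the denominator and so enlarges the lower
      bound for the jump; the comparison can be made with the original q.\<close>
    have "mass_const * real q powr (-s) \<le> mass_const * den i powr (-s)"
      using mass_const_pos i s_bounds by (intro mult_left_mono powr_mono2') auto
    also have "\<dots> \<le> \<bar>mass i\<bar>" by (rule abs_mass)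
    also have "\<dots> \<le> C * \<bar>frac_val i - t\<bar> powr l"
      using Cd(2)[OF i(1)] close Q(2)[OF qp(1)] by linarith
    also have "\<dots> \<le> \<bar>C\<bar> * \<bar>frac_val i - t\<bar> powr l" by (intro mult_right_mono) auto
    also have "\<dots> \<le> \<bar>C\<bar> * (real q powr (-\<nu>)) powr l"
      using close l0 by (intro mult_left_mono powr_mono2) auto
    also have "\<dots> = \<bar>C\<bar> * real q powr (- (\<nu> * l - s)) * real q powr (-s)"
      using qp(2) by (simp add: powr_powr powr_add[symmetric])
    also have "\<dots> < mass_const * real q powr (-s)"
      using Q(1)[OF qp(1)] qp(2) by (intro mult_strict_right_mono) auto
    finally show False by simp
  qed
qed

text \<open>Fractions stay at distance at least c q^(-\<nu>) from t, so an increment over length u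
  only meets denominators above R = (c / u)^(1/\<nu>). \<open>H_diff_bound\<close> then gives
  u^(s/\<nu>) and u^(1 + (s-2)/\<nu>); the second is no larger, for u <= 1, because \<nu> >=
  2.\<close>

lemma holder_exponent_H_ge:
  assumes t: "t \<notin> approximable \<nu>" and \<nu>: "2 \<le> \<nu>"
  shows "ereal (s / \<nu>) \<le> holder_exponent H t"
proof -
  obtain Q0 where "\<not> (\<exists>q\<ge>Q0. \<exists>p::int. 1 \<le> q \<and> \<bar>t - of_int p / real q\<bar> \<le> real q powr (-\<nu>))"
    using t unfolding approximable_def by blast
  hence Q0: "real q powr (-\<nu>) < \<bar>t - of_int p / real q\<bar>" if "q \<ge> Q0" "1 \<le> q" for q and p :: int
    using that not_le by blast
  \<comment> \<open>The bound \<open>Q0\<close> holds from denominator Q0 on. Expanding a fraction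
    by Q0 + 1 brings every denominator into that range, at the price of this factor.\<close>
  define c where "c = real (Suc Q0) powr (-\<nu>)"
  have c: "0 < c" "c \<le> 1" using \<nu> by (auto simp: c_def powr_minus_divide intro!: ge_one_powr_ge_zero)
  have low: "c * den i powr (-\<nu>) \<le> \<bar>frac_val i - t\<bar>" if i: "i \<in> reduced_pairs" for i
  proof -
    have q: "1 \<le> snd i" using i by (auto simp: reduced_pairs_def)
    have "Q0 \<le> Suc Q0 * snd i" using q by (metis Suc_leD le_trans mult.right_neutral mult_le_mono2 order_refl)
    hence "real (Suc Q0 * snd i) powr (-\<nu>) < \<bar>t - of_int (int (Suc Q0) * fst i) / real (Suc Q0 * snd i)\<bar>"
      using q by (intro Q0) auto
    moreover have "of_int (int (Suc Q0) * fst i) / real (Suc Q0 * snd i) = frac_val i"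
      unfolding frac_val_def of_nat_mult of_int_mult of_int_of_nat_eq by (simp del: of_nat_Suc)
    moreover have "real (Suc Q0 * snd i) powr (-\<nu>) = c * den i powr (-\<nu>)"
      unfolding c_def of_nat_mult by (rule powr_mult)
    ultimately show ?thesis using abs_minus_commute[of t "frac_val i"] by linarith
  qed
  define C where "C = hp_const * (c powr (-s/\<nu>) + c powr (-(s-2)/\<nu>))"
  have "holder_at (s / \<nu>) H t" unfolding holder_at_def
  proof (intro exI conjI)
    show "degree [:H t:] \<le> nat \<lfloor>s / \<nu>\<rfloor>" by simp
    show "\<forall>\<^sub>F r in nhds t. \<bar>H r - poly [:H t:] r\<bar> \<le> C * (if s / \<nu> = 0 then 1 else \<bar>t - r\<bar> powr (s / \<nu>))"
      unfolding eventually_nhds_metric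
    proof (intro exI[of _ c] conjI allI impI)
      fix r assume r: "dist r t < c"
      define u where "u = \<bar>r - t\<bar>"
      have u: "0 \<le> u" "u < c" using r by (auto simp: u_def dist_real_def)
      have "\<bar>H r - H t\<bar> \<le> C * u powr (s / \<nu>)"
      proof (cases "u = 0")
        case True
        thus ?thesis by (simp add: u_def)
      next
        case False
        hence u0: "0 < u" using u by simp
        define R where "R = (c / u) powr (1/\<nu>)"
        have "\<bar>H r - H t\<bar> \<le> hp_const * (R powr (-s) + \<bar>r - t\<bar> * R powr (2 - s))"
        proof (rule H_diff_bound)
          show "1 \<le> R" using u0 u \<nu> by (auto simp: R_def intro!: ge_one_powr_ge_zero)
          fix i assume i: "i \<in> reduced_pairs" "\<bar>frac_val i - t\<bar> \<le> \<bar>r - t\<bar>"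
          have q: "1 \<le> real (snd i)" using i by (auto simp: reduced_pairs_def)
          have "c * den i powr (-\<nu>) \<le> u" using low[OF i(1)] i(2) by (simp add: u_def)
          hence "c / u \<le> den i powr \<nu>" using u0 q by (simp add: powr_minus field_simps)
          hence "R \<le> (den i powr \<nu>) powr (1/\<nu>)"
            unfolding R_def using u0 c \<nu> by (intro powr_mono2) auto
          thus "R \<le> real (snd i)" using \<nu> q by (simp add: powr_powr)
        qed
        also have "\<dots> = hp_const * (c powr (-s/\<nu>) * u powr (s/\<nu>) + c powr (-(s-2)/\<nu>) * (u * u powr ((s-2)/\<nu>)))"
        proof -
          have *: "R powr a = c powr (a/\<nu>) * u powr (-a/\<nu>)" for a
            using u0 c by (simp add: R_def powr_powr powr_divide powr_minus_divide)
          have "(2 - s) / \<nu> = - (s-2)/\<nu>" "- (2 - s) / \<nu> = (s-2)/\<nu>" by (auto simp: field_simps)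
          thus ?thesis unfolding * u_def[symmetric] by (simp add: algebra_simps)
        qed
        also have "u * u powr ((s-2)/\<nu>) = u powr (1 + (s-2)/\<nu>)" using u0 by (simp add: powr_add)
        also have "hp_const * (c powr (-s/\<nu>) * u powr (s/\<nu>) + c powr (-(s-2)/\<nu>) * u powr (1 + (s-2)/\<nu>))
          \<le> hp_const * (c powr (-s/\<nu>) * u powr (s/\<nu>) + c powr (-(s-2)/\<nu>) * u powr (s/\<nu>))"
        proof (intro mult_left_mono add_left_mono powr_mono')
          show "s / \<nu> \<le> 1 + (s-2)/\<nu>" using \<nu> by (simp add: field_simps)
        qed (use hp_const_pos u u0 c in auto)
        finally show ?thesis by (simp add: C_def algebra_simps)
      qed
      thus "\<bar>H r - poly [:H t:] r\<bar> \<le> C * (if s / \<nu> = 0 then 1 else \<bar>t - r\<bar> powr (s / \<nu>))"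
        using s_bounds \<nu> by (simp add: u_def abs_minus_commute)
    qed (use c in auto)
  qed
  thus ?thesis unfolding holder_exponent_def using s_bounds \<nu> by (intro Sup_upper) auto
qed

end

section \<open>Sets of vanishing Hausdorff measure\<close>

lemma approximable_antimono:
  assumes "\<nu> \<le> \<nu>'"
  shows "approximable \<nu>' \<subseteq> approximable \<nu>"
proof
  fix t assume t: "t \<in> approximable \<nu>'"
  show "t \<in> approximable \<nu>" unfolding approximable_def
  proof (intro CollectI allI)
    fix Q
    obtain q p where "q \<ge> Q" "1 \<le> q" "\<bar>t - of_int p / real q\<bar> \<le> real q powr (-\<nu>')"
      using t unfolding approximable_def by blast
    moreover have "real q powr (-\<nu>') \<le> real q powr (-\<nu>)" using calculation assms by (intro powr_mono) auto
    ultimately show "\<exists>q\<ge>Q. \<exists>p::int. 1 \<le> q \<and> \<bar>t - of_int p / real q\<bar> \<le> real q powr (-\<nu>)"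
      by (intro exI[of _ q] conjI exI[of _ p]) auto
  qed
qed

text \<open>The cost is bounded through finite partial sums, so the index set can be arbitrary and
  no series has to be shown convergent.\<close>

definition power_cover :: "real \<Rightarrow> real \<Rightarrow> 'i set \<Rightarrow> ('i \<Rightarrow> real) \<Rightarrow> ('i \<Rightarrow> real) \<Rightarrow> real set \<Rightarrow> bool" where
  "power_cover D \<eta> I c w E \<longleftrightarrow> (\<forall>i\<in>I. 0 < w i) \<and>
     (\<forall>F. finite F \<longrightarrow> F \<subseteq> I \<longrightarrow> (\<Sum>i\<in>F. w i powr D) \<le> \<eta>) \<and> E \<subseteq> (\<Union>i\<in>I. cball (c i) (w i))"

text \<open>Equivalent to vanishing \<open>D\<close>-dimensional Hausdorff measure; the radii are kept positive so
  that a nested interval shrinking to a point eventually leaves every covering ball.\<close>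

definition power_null :: "real \<Rightarrow> real set \<Rightarrow> bool" where
  "power_null D E \<longleftrightarrow> (\<forall>\<eta>>0. \<exists>c w. power_cover D \<eta> (UNIV :: nat set) c w E)"

lemma power_coverI:
  assumes "\<And>i. i \<in> I \<Longrightarrow> 0 < w i" "\<And>F. finite F \<Longrightarrow> F \<subseteq> I \<Longrightarrow> (\<Sum>i\<in>F. w i powr D) \<le> \<eta>"
    "E \<subseteq> (\<Union>i\<in>I. cball (c i) (w i))"
  shows "power_cover D \<eta> I c w E"
  using assms by (simp add: power_cover_def)

lemma power_coverD:
  assumes "power_cover D \<eta> I c w E"
  shows "i \<in> I \<Longrightarrow> 0 < w i" "finite F \<Longrightarrow> F \<subseteq> I \<Longrightarrow> (\<Sum>i\<in>F. w i powr D) \<le> \<eta>"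
    "E \<subseteq> (\<Union>i\<in>I. cball (c i) (w i))"
  using assms by (simp_all add: power_cover_def)

lemma power_nullE:
  assumes "power_null D E" "0 < \<eta>"
  obtains w c :: "nat \<Rightarrow> real" where "\<And>n. 0 < w n" "\<And>F. finite F \<Longrightarrow> (\<Sum>n\<in>F. w n powr D) \<le> \<eta>"
    "E \<subseteq> (\<Union>n. cball (c n) (w n))"
proof -
  obtain c w where cw: "power_cover D \<eta> (UNIV :: nat set) c w E"
    using assms unfolding power_null_def by blast
  show ?thesis by (rule that[of w c]) (use power_coverD[OF cw] in auto)
qed

lemma power_null_subset:
  assumes "power_null D A" "B \<subseteq> A"
  shows "power_null D B"
proof -
  have "power_cover D \<eta> I c w B" if "power_cover D \<eta> I c w A" for \<eta> c w and I :: "nat set"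
    using power_coverD[OF that] assms(2) by (intro power_coverI) auto
  thus ?thesis using assms(1) unfolding power_null_def by blast
qed

lemma sum_half_powers_le: "finite F \<Longrightarrow> (\<Sum>n\<in>F. (1/2) ^ Suc n) \<le> (1::real)"
proof -
  assume F: "finite F"
  have "(\<lambda>n. (1/2::real) ^ Suc n) sums 1" using power_half_series .
  thus ?thesis using F by (metis sum_le_suminf sums_unique sums_summable zero_le_power
        divide_nonneg_nonneg zero_le_numeral zero_le_one)
qed

text \<open>Positive radii of small total cost, to fill indices without a ball and to replace
  covering sets of diameter 0.\<close>

lemma positive_pads:
  fixes D \<eta> :: real
  assumes "0 < D" "0 < \<eta>"
  obtains pad :: "nat \<Rightarrow> real" where "\<And>n. 0 < pad n" "\<And>F. finite F \<Longrightarrow> (\<Sum>n\<in>F. pad n powr D) \<le> \<eta>"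
proof -
  define pad where "pad n = (\<eta> * (1/2) ^ Suc n) powr (1 / D)" for n
  show ?thesis
  proof (rule that[of pad])
    show "0 < pad n" for n using assms by (simp add: pad_def)
    fix F :: "nat set" assume F: "finite F"
    have "(\<Sum>n\<in>F. pad n powr D) = \<eta> * (\<Sum>n\<in>F. (1/2) ^ Suc n)"
      using assms by (simp add: pad_def powr_powr sum_distrib_left)
    also have "\<dots> \<le> \<eta> * 1" using assms sum_half_powers_le[OF F] by (intro mult_left_mono) auto
    finally show "(\<Sum>n\<in>F. pad n powr D) \<le> \<eta>" by simp
  qed
qed

text \<open>A cover indexed by part of a countable type is moved to the naturals by
  \<open>to_nat\<close>. The remaining naturals receive padding balls; cover and padding take half
  of \<eta> each.\<close>

lemma power_nullI_countable:
  fixes E :: "real set"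
  assumes D: "0 < D"
    and cover: "\<And>\<eta>. 0 < \<eta> \<Longrightarrow> \<exists>(I :: 'i::countable set) c w. power_cover D \<eta> I c w E"
  shows "power_null D E"
  unfolding power_null_def
proof (intro allI impI)
  fix \<eta> :: real assume \<eta>: "0 < \<eta>"
  hence "0 < \<eta> / 2" by simp
  from cover[OF this] obtain I :: "'i set" and c w where "power_cover D (\<eta> / 2) I c w E" by blast
  note I = power_coverD[OF this]
  obtain pad :: "nat \<Rightarrow> real" where pad: "\<And>n. 0 < pad n" "\<And>F. finite F \<Longrightarrow> (\<Sum>n\<in>F. pad n powr D) \<le> \<eta> / 2"
    using positive_pads[OF D \<open>0 < \<eta> / 2\<close>] by blast
  define w' where "w' n = (if n \<in> to_nat ` I then w (from_nat n) else pad n)" for n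
  have "(\<Sum>n\<in>F. w' n powr D) \<le> \<eta>" if F: "finite F" for F
  proof -
    let ?G = "{i\<in>I. to_nat i \<in> F}"
    have "finite ((to_nat :: 'i \<Rightarrow> nat) -` F)" using F by (rule finite_vimageI) simp
    hence finG: "finite ?G" by (rule finite_subset[rotated]) auto
    have "(\<Sum>n\<in>F. w' n powr D) = (\<Sum>n\<in>F \<inter> to_nat ` I. w' n powr D) + (\<Sum>n\<in>F - to_nat ` I. w' n powr D)"
      using F by (subst sum.Int_Diff[where B="to_nat ` I"]) auto
    also have "(\<Sum>n\<in>F \<inter> to_nat ` I. w' n powr D) = (\<Sum>i\<in>?G. w i powr D)"
      by (rule sum.reindex_cong[of to_nat]) (auto simp: w'_def inj_on_def)
    also have "\<dots> \<le> \<eta> / 2" using finG by (intro I(2)) auto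
    also have "(\<Sum>n\<in>F - to_nat ` I. w' n powr D) = (\<Sum>n\<in>F - to_nat ` I. pad n powr D)"
      by (intro sum.cong) (auto simp: w'_def)
    also have "\<dots> \<le> \<eta> / 2" using F by (intro pad(2)) auto
    finally show ?thesis by simp
  qed
  moreover have "0 < w' n" for n using I(1) pad(1) by (auto simp: w'_def)
  moreover have "E \<subseteq> (\<Union>n. cball (c (from_nat n)) (w' n))"
  proof
    fix t assume "t \<in> E"
    then obtain i where "i \<in> I" "t \<in> cball (c i) (w i)" using I(3) by blast
    hence "t \<in> cball (c (from_nat (to_nat i))) (w' (to_nat i))" by (simp add: w'_def)
    thus "t \<in> (\<Union>n. cball (c (from_nat n)) (w' n))" by blast
  qed
  ultimately have "power_cover D \<eta> UNIV (\<lambda>n. c (from_nat n)) w' E" by (intro power_coverI) auto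
  thus "\<exists>c w. power_cover D \<eta> (UNIV :: nat set) c w E" by blast
qed

text \<open>The set \<open>E m\<close> is covered at cost \<eta> / 2^(m+1). A finite set of index
  pairs is enlarged to the product of its projections to sum row by row.\<close>

lemma power_null_UN:
  assumes D: "0 < D" and E: "\<And>m::nat. power_null D (E m)"
  shows "power_null D (\<Union>m. E m)"
proof (rule power_nullI_countable[OF D])
  fix \<eta> :: real assume \<eta>: "0 < \<eta>"
  have "\<forall>m. \<exists>c w. power_cover D (\<eta> * (1/2) ^ Suc m) (UNIV :: nat set) c w (E m)"
    using E \<eta> by (simp add: power_null_def)
  then obtain c w where "\<And>m. power_cover D (\<eta> * (1/2) ^ Suc m) (UNIV :: nat set) (c m) (w m) (E m)"
    by metis
  note cw = power_coverD[OF this]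
  have sums: "(\<Sum>i\<in>F. w (fst i) (snd i) powr D) \<le> \<eta>" if F: "finite F" for F
  proof -
    have "(\<Sum>i\<in>F. w (fst i) (snd i) powr D) \<le> (\<Sum>i\<in>fst ` F \<times> snd ` F. w (fst i) (snd i) powr D)"
      using F by (intro sum_mono2) (auto intro: rev_image_eqI)
    also have "\<dots> = (\<Sum>m\<in>fst ` F. \<Sum>n\<in>snd ` F. w m n powr D)"
      by (simp add: sum.cartesian_product case_prod_unfold)
    also have "\<dots> \<le> (\<Sum>m\<in>fst ` F. \<eta> * (1/2) ^ Suc m)"
      using F by (intro sum_mono cw(2)) auto
    also have "\<dots> = \<eta> * (\<Sum>m\<in>fst ` F. (1/2) ^ Suc m)" by (simp add: sum_distrib_left)
    also have "\<dots> \<le> \<eta> * 1" using \<eta> sum_half_powers_le F by (intro mult_left_mono) auto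
    finally show ?thesis by simp
  qed
  have cov: "(\<Union>m. E m) \<subseteq> (\<Union>i\<in>UNIV. cball (c (fst i) (snd i)) (w (fst i) (snd i)))"
    using cw(3) by fastforce
  have "power_cover D \<eta> UNIV (\<lambda>i. c (fst i) (snd i)) (\<lambda>i. w (fst i) (snd i)) (\<Union>m. E m)"
    using cw(1) sums cov by (intro power_coverI) auto
  thus "\<exists>(I :: (nat \<times> nat) set) c w. power_cover D \<eta> I c w (\<Union>m. E m)" by blast
qed

lemma power_null_Un:
  assumes "0 < D" "power_null D A" "power_null D B"
  shows "power_null D (A \<union> B)"
proof -
  have "power_null D (\<Union>m::nat. if m = 0 then A else B)"
    using assms by (intro power_null_UN) auto
  moreover have "(\<Union>m::nat. if m = 0 then A else B) = A \<union> B"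
    by (auto split: if_splits intro: exI[of _ 0] exI[of _ 1])
  ultimately show ?thesis by simp
qed

text \<open>The Borel-Cantelli half of Jarnik-Besicovitch. The set is unbounded, so the numerators
  run up to q^(1+e): this window eventually contains every fixed point, because q^e tends to
  infinity.\<close>

lemma power_null_approximable:
  assumes D: "0 < D" and \<nu>D: "2 < \<nu> * D"
  shows "power_null D (approximable \<nu>)"
proof (rule power_nullI_countable[OF D])
  fix \<eta> :: real assume \<eta>: "0 < \<eta>"
  have \<nu>: "0 < \<nu>" using \<nu>D D zero_less_mult_pos2[of \<nu> D] by linarith
  \<comment> \<open>The surplus of \<nu> D over 2 is split in halves: one e pays for the growing
    window of numerators, the other leaves the convergent series of q^(-1-e).\<close>
  define e where "e = (\<nu> * D - 2) / 2"
  have e: "0 < e" "\<nu> * D = 2 + 2 * e" using \<nu>D by (simp_all add: e_def field_simps)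
  have "summable (\<lambda>q. 3 * real q powr (- 1 - e))"
    using e by (intro summable_mult) (simp add: summable_real_powr_iff)
  hence "\<exists>N. \<forall>m\<ge>N. \<forall>n. norm (sum (\<lambda>q. 3 * real q powr (- 1 - e)) {m..<n}) < \<eta>"
    using \<eta> unfolding summable_Cauchy by blast
  then obtain Q where Q: "\<And>n. norm (sum (\<lambda>q. 3 * real q powr (- 1 - e)) {Q..<n}) < \<eta>" by blast
  define I where "I = {i :: int \<times> nat. Q \<le> snd i \<and> 1 \<le> snd i \<and> \<bar>real_of_int (fst i)\<bar> \<le> den i powr (1 + e)}"
  define w where "w i = den i powr (-\<nu>)" for i :: "int \<times> nat"
  have sums: "(\<Sum>i\<in>F. w i powr D) \<le> \<eta>" if F: "finite F" "F \<subseteq> I" for F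
  proof -
    let ?P = "\<lambda>q. {p. (p, q) \<in> F}"
    have Fe: "F = (\<lambda>(q, p). (p, q)) ` (SIGMA q:snd ` F. ?P q)" by force
    have finP: "finite (?P q)" for q using F(1) by (rule finite_subset[rotated, OF finite_imageI[of F fst]]) force
    have "(\<Sum>i\<in>F. w i powr D) = (\<Sum>(q, p)\<in>(SIGMA q:snd ` F. ?P q). w (p, q) powr D)"
      by (subst Fe, subst sum.reindex) (auto simp: inj_on_def case_prod_unfold)
    also have "\<dots> = (\<Sum>q\<in>snd ` F. \<Sum>p\<in>?P q. w (p, q) powr D)"
      using F finP by (subst sum.Sigma) auto
    also have "\<dots> \<le> (\<Sum>q\<in>snd ` F. 3 * real q powr (-1 - e))"
    proof (rule sum_mono)
      fix q assume "q \<in> snd ` F"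
      hence q: "1 \<le> q" using F(2) by (auto simp: I_def)
      have c: "real (card (?P q)) \<le> 3 * real q powr (1 + e)"
      proof -
        define z where "z = \<lfloor>real q powr (1 + e)\<rfloor>"
        have "1 \<le> real q powr (1 + e)" using q e by (intro ge_one_powr_ge_zero) auto
        hence z: "1 \<le> z" "of_int z \<le> real q powr (1 + e)" by (auto simp: z_def)
        have "?P q \<subseteq> {-z..z}"
        proof
          fix p assume "p \<in> ?P q"
          hence "\<bar>real_of_int p\<bar> \<le> real q powr (1 + e)" using F(2) by (auto simp: I_def)
          hence "\<bar>p\<bar> \<le> z" unfolding z_def by (simp add: le_floor_iff)
          thus "p \<in> {-z..z}" by auto
        qed
        hence "card (?P q) \<le> card {-z..z}" by (intro card_mono) auto
        also have "\<dots> = nat (2 * z + 1)" by simp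
        finally have "real (card (?P q)) \<le> 2 * of_int z + 1" using z(1) by linarith
        also have "\<dots> \<le> 3 * of_int z" using z by simp
        also have "\<dots> \<le> 3 * real q powr (1 + e)" using z by simp
        finally show ?thesis .
      qed
      have "(\<Sum>p\<in>?P q. w (p, q) powr D) = real (card (?P q)) * real q powr (- (\<nu> * D))"
        by (simp add: w_def powr_powr)
      also have "\<dots> \<le> 3 * real q powr (1 + e) * real q powr (- (\<nu> * D))"
        using c by (intro mult_right_mono) auto
      also have "\<dots> = 3 * real q powr (-1 - e)" by (simp add: e(2) powr_add[symmetric])
      finally show "(\<Sum>p\<in>?P q. w (p, q) powr D) \<le> 3 * real q powr (-1 - e)" .
    qed
    also have "\<dots> \<le> (\<Sum>q\<in>{Q..<Suc (Max (snd ` F))}. 3 * real q powr (-1 - e))"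
    proof (rule sum_mono2)
      show "snd ` F \<subseteq> {Q..<Suc (Max (snd ` F))}"
      proof
        fix q assume q: "q \<in> snd ` F"
        hence "q \<le> Max (snd ` F)" using F(1) by (intro Max_ge) auto
        thus "q \<in> {Q..<Suc (Max (snd ` F))}" using q F(2) by (auto simp: I_def)
      qed
    qed auto
    also have "\<dots> \<le> \<eta>" using Q[of "Suc (Max (snd ` F))"] by simp
    finally show ?thesis .
  qed
  have cov: "approximable \<nu> \<subseteq> (\<Union>i\<in>I. cball (frac_val i) (w i))"
  proof
    fix t assume t: "t \<in> approximable \<nu>"
    have "filterlim (\<lambda>q. real q powr e) at_top sequentially"
      using e by real_asymp
    hence "\<forall>\<^sub>F q in sequentially. \<bar>t\<bar> + 1 \<le> real q powr e"
      unfolding filterlim_at_top by blast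
    then obtain Q' where Q': "\<And>q. q \<ge> Q' \<Longrightarrow> \<bar>t\<bar> + 1 \<le> real q powr e"
      unfolding eventually_sequentially by blast
    obtain q p where qp: "q \<ge> max Q Q'" "1 \<le> q" "\<bar>t - of_int p / real q\<bar> \<le> real q powr (-\<nu>)"
      using t unfolding approximable_def by blast
    have "real q powr (-\<nu>) \<le> 1" using qp(2) \<nu> by (auto simp: powr_minus_divide intro!: ge_one_powr_ge_zero)
    hence "\<bar>of_int p / real q\<bar> \<le> \<bar>t\<bar> + 1" using qp(3) by linarith
    hence "\<bar>of_int p\<bar> \<le> (\<bar>t\<bar> + 1) * real q" using qp(2) by (simp add: abs_divide divide_le_eq)
    also have "\<dots> \<le> real q powr e * real q" using Q' qp by (intro mult_right_mono) auto
    also have "\<dots> = real q powr (1 + e)" using qp(2) by (simp add: powr_add)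
    finally have "(p, q) \<in> I" using qp by (auto simp: I_def)
    moreover have "t \<in> cball (frac_val (p, q)) (w (p, q))"
      using qp(3) by (simp add: w_def frac_val_def dist_real_def abs_minus_commute)
    ultimately show "t \<in> (\<Union>i\<in>I. cball (frac_val i) (w i))" by blast
  qed
  have "power_cover D \<eta> I frac_val w (approximable \<nu>)"
    using sums cov by (intro power_coverI) (auto simp: I_def w_def)
  thus "\<exists>(I :: (int \<times> nat) set) c w. power_cover D \<eta> I c w (approximable \<nu>)" by blast
qed

section \<open>Comparison of null covers with Hausdorff measure\<close>

lemma hausdorff_measure_power_null:
  assumes D: "0 < D" and E: "power_null D E"
  shows "hausdorff_measure D E = 0"
proof -
  have "hausdorff_premeasure D \<epsilon> E \<le> ennreal \<eta>" if \<epsilon>: "0 < \<epsilon>" and \<eta>: "0 < \<eta>" for \<epsilon> \<eta> :: real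
  proof -
    \<comment> \<open>The first bound absorbs the factor 2^D between radius and diameter; the
      second, applied to single balls, forces every diameter below the mesh \<epsilon>.\<close>
    define \<theta> where "\<theta> = min (\<eta> / 2 powr D) ((\<epsilon> / 2) powr D)"
    have \<theta>: "0 < \<theta>" using \<epsilon> \<eta> by (simp add: \<theta>_def)
    obtain w c :: "nat \<Rightarrow> real" where cw: "\<And>n. 0 < w n" "\<And>F. finite F \<Longrightarrow> (\<Sum>n\<in>F. w n powr D) \<le> \<theta>"
      "E \<subseteq> (\<Union>n. cball (c n) (w n))" by (rule power_nullE[OF E \<theta>]) (rule that)
    let ?U = "\<lambda>n. cball (c n) (w n)"
    have nn: "\<not> w n < 0" for n using cw(1)[of n] by simp
    have diam: "diameter (?U n) = 2 * w n" for n using cw(1)[of n] by (simp add: diameter_cball)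
    have "diameter (?U n) \<le> \<epsilon>" for n
    proof -
      have "w n powr D \<le> (\<epsilon> / 2) powr D" using cw(2)[of "{n}"] by (simp add: \<theta>_def)
      hence "w n \<le> \<epsilon> / 2" using D \<epsilon> cw(1)[of n] by (meson half_gt_zero less_eq_real_def linorder_not_le powr_less_mono2)
      thus ?thesis unfolding diam by simp
    qed
    hence "hausdorff_premeasure D \<epsilon> E \<le> (\<Sum>n. diam_power D (?U n))"
      unfolding hausdorff_premeasure_def using cw(3)
      by (intro Inf_lower CollectI exI[of _ ?U] conjI refl allI bounded_cball)
    also have "\<dots> \<le> ennreal \<eta>"
    proof (rule suminf_le_const)
      fix n
      have "(\<Sum>k<n. diam_power D (?U k)) = (\<Sum>k<n. ennreal (2 powr D * w k powr D))"
        using D by (intro sum.cong) (auto simp: diam_power_def diam powr_mult nn)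
      also have "\<dots> = ennreal (\<Sum>k<n. 2 powr D * w k powr D)" by (intro sum_ennreal) auto
      also have "(\<Sum>k<n. 2 powr D * w k powr D) = 2 powr D * (\<Sum>k<n. w k powr D)" by (simp add: sum_distrib_left)
      also have "\<dots> \<le> 2 powr D * (\<eta> / 2 powr D)"
        using cw(2)[of "{..<n}"] by (intro mult_left_mono) (auto simp: \<theta>_def)
      finally show "(\<Sum>k<n. diam_power D (?U k)) \<le> ennreal \<eta>" by (simp add: ennreal_leI)
    qed auto
    finally show ?thesis .
  qed
  note bound = this
  have zero: "hausdorff_premeasure D \<epsilon> E \<le> 0" if \<epsilon>: "0 < \<epsilon>" for \<epsilon>
  proof (rule ennreal_le_epsilon)
    fix \<eta> :: real assume "0 < \<eta>"
    thus "hausdorff_premeasure D \<epsilon> E \<le> 0 + ennreal \<eta>" using bound[OF \<epsilon>] by simp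
  qed
  have "hausdorff_measure D E \<le> 0"
    unfolding hausdorff_measure_def by (rule SUP_least) (use zero in simp)
  thus ?thesis by simp
qed

text \<open>Mesh 1 suffices, since for diameters at most 1 the larger exponent D only lowers the
  cost. The strict inequality gives D > 0 also when d = 0, where every nonempty set costs 1.\<close>

lemma power_null_hausdorff_measure:
  assumes d: "0 \<le> d" "d < D" and E: "hausdorff_measure d E = 0"
  shows "power_null D E"
  unfolding power_null_def
proof (intro allI impI)
  fix \<eta> :: real assume \<eta>: "0 < \<eta>"
  have D: "0 < D" using d by simp
  obtain pad :: "nat \<Rightarrow> real" where pad: "\<And>n. 0 < pad n" "\<And>F. finite F \<Longrightarrow> (\<Sum>n\<in>F. pad n powr D) \<le> \<eta> / 2"
    using positive_pads[OF D, of "\<eta> / 2"] \<eta> by auto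
  have "hausdorff_premeasure d 1 E \<le> hausdorff_measure d E"
    unfolding hausdorff_measure_def by (intro SUP_upper) auto
  hence "hausdorff_premeasure d 1 E < ennreal (\<eta> / 2)" using E \<eta> by simp
  then obtain U :: "nat \<Rightarrow> real set" where U: "(\<Sum>n. diam_power d (U n)) < ennreal (\<eta> / 2)" "E \<subseteq> (\<Union>n. U n)"
      "\<And>n. bounded (U n)" "\<And>n. diameter (U n) \<le> 1"
    unfolding hausdorff_premeasure_def Inf_less_iff by blast
  \<comment> \<open>A ball about any point of \<open>U n\<close> with radius its diameter contains
    \<open>U n\<close>; the padding keeps the radius positive for singletons.\<close>
  define w where "w n = max (diameter (U n)) (pad n)" for n
  define c where "c n = (SOME x. x \<in> U n)" for n
  have dn: "0 \<le> diameter (U n)" for n using U(3) by (rule diameter_ge_0)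
  have "(\<Sum>n\<in>F. w n powr D) \<le> \<eta>" if F: "finite F" for F
  proof -
    have "(\<Sum>n\<in>F. w n powr D) \<le> (\<Sum>n\<in>F. diameter (U n) powr D + pad n powr D)"
      by (intro sum_mono) (auto simp: w_def max_def)
    also have "\<dots> = (\<Sum>n\<in>F. diameter (U n) powr D) + (\<Sum>n\<in>F. pad n powr D)" by (rule sum.distrib)
    also have "(\<Sum>n\<in>F. diameter (U n) powr D) \<le> \<eta> / 2"
    proof -
      have "ennreal (\<Sum>n\<in>F. diameter (U n) powr D) = (\<Sum>n\<in>F. ennreal (diameter (U n) powr D))"
        by (simp add: sum_ennreal)
      also have "\<dots> \<le> (\<Sum>n\<in>F. diam_power d (U n))"
      proof (rule sum_mono)
        fix n
        show "ennreal (diameter (U n) powr D) \<le> diam_power d (U n)"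
        proof (cases "U n = {} \<or> d = 0")
          case True
          thus ?thesis using dn[of n] U(4)[of n] D by (auto simp: diam_power_def powr_le1 intro!: ennreal_le_1[THEN iffD2])
        next
          case False
          have "diameter (U n) powr D \<le> diameter (U n) powr d"
            using dn[of n] U(4)[of n] d by (intro powr_mono') auto
          thus ?thesis using False by (auto simp: diam_power_def intro!: ennreal_leI)
        qed
      qed
      also have "\<dots> \<le> (\<Sum>n. diam_power d (U n))" using F by (intro sum_le_suminf) auto
      also have "\<dots> \<le> ennreal (\<eta> / 2)" using U(1) by simp
      finally show ?thesis using \<eta> by (subst (asm) ennreal_le_iff) auto
    qed
    also have "(\<Sum>n\<in>F. pad n powr D) \<le> \<eta> / 2" using F by (rule pad(2))
    finally show ?thesis by simp
  qed
  moreover have "0 < w n" for n using pad(1)[of n] by (simp add: w_def)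
  moreover have "E \<subseteq> (\<Union>n. cball (c n) (w n))"
  proof
    fix t assume "t \<in> E"
    then obtain n where n: "t \<in> U n" using U(2) by blast
    hence "c n \<in> U n" unfolding c_def by (rule someI)
    hence "dist (c n) t \<le> diameter (U n)" using n U(3) by (intro diameter_bounded_bound) auto
    thus "t \<in> (\<Union>n. cball (c n) (w n))" by (auto simp: w_def max_def intro!: exI[of _ n])
  qed
  ultimately have "power_cover D \<eta> UNIV c w E" by (intro power_coverI) auto
  thus "\<exists>c w. power_cover D \<eta> (UNIV :: nat set) c w E" by blast
qed

section \<open>Spectrum of singularities\<close>

lemma card_int_interval_le:
  assumes "0 \<le> b"
  shows "finite {j::int. \<bar>of_int j - a\<bar> \<le> b}" "real (card {j::int. \<bar>of_int j - a\<bar> \<le> b}) \<le> 1 + 2 * b"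
proof -
  have inj: "inj_on (of_int :: int \<Rightarrow> real) A" for A by (simp add: inj_on_def)
  let ?A = "{j::int. \<bar>of_int j - a\<bar> \<le> b}"
  have *: "finite (of_int ` ?A :: real set)" "real (card (of_int ` ?A :: real set)) \<le> 1 + (a + b - (a - b)) / 1"
  proof -
    have sep: "1 \<le> \<bar>x - y\<bar>" if xy: "x \<in> of_int ` ?A" "y \<in> of_int ` ?A" "x \<noteq> y" for x y :: real
    proof -
      obtain i j where "x = of_int i" "y = of_int j" using xy(1,2) by blast
      hence "i \<noteq> j" "x - y = of_int (i - j)" using xy(3) by auto
      hence "1 \<le> \<bar>i - j\<bar>" "\<bar>x - y\<bar> = of_int \<bar>i - j\<bar>" by auto
      thus ?thesis by linarith
    qed
    have sub: "of_int ` ?A \<subseteq> {a - b..a + b}" by auto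
    show "finite (of_int ` ?A :: real set)" "real (card (of_int ` ?A :: real set)) \<le> 1 + (a + b - (a - b)) / 1"
      using card_separated_le[OF zero_less_one sub _ sep] assms by auto
  qed
  show "finite ?A" using *(1) finite_imageD[OF _ inj] by blast
  show "real (card ?A) \<le> 1 + 2 * b" using *(2) by (simp add: card_image[OF inj])
qed

text \<open>Giving up the factor Q^e in the number Q^2 of available fractions buys separation and a
  lower bound on the denominators. The radius 3 r / 4 leaves room for balls of radius r / 4 inside
  the ball of radius r about x.\<close>

definition frac_net :: "real \<Rightarrow> real \<Rightarrow> nat \<Rightarrow> real \<Rightarrow> real set \<Rightarrow> bool" where
  "frac_net e r Q x Y \<longleftrightarrow> finite Y \<and> r * real Q powr (2 - e) / 4 \<le> card Y \<and>
    (\<forall>y\<in>Y. \<bar>y - x\<bar> \<le> 3 * r / 4 \<and> (\<exists>(p::int) q. y = of_int p / real q \<and> 1 \<le> q \<and>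
        real Q powr (1 - 3 * e / 4) \<le> real q \<and> q \<le> Q)) \<and>
    (\<forall>y\<in>Y. \<forall>y'\<in>Y. y \<noteq> y' \<longrightarrow> 1 / (2 * real Q powr (2 - e)) \<le> \<bar>y - y'\<bar>)"

lemma frac_netD:
  assumes "frac_net e r Q x Y"
  shows "finite Y" "r * real Q powr (2 - e) / 4 \<le> card Y"
    "y \<in> Y \<Longrightarrow> \<bar>y - x\<bar> \<le> 3 * r / 4"
    "y \<in> Y \<Longrightarrow> \<exists>(p::int) q. y = of_int p / real q \<and> 1 \<le> q \<and> real Q powr (1 - 3 * e / 4) \<le> real q \<and> q \<le> Q"
    "y \<in> Y \<Longrightarrow> y' \<in> Y \<Longrightarrow> y \<noteq> y' \<Longrightarrow> 1 / (2 * real Q powr (2 - e)) \<le> \<bar>y - y'\<bar>"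
  using assms unfolding frac_net_def by blast+

text \<open>Dirichlet approximations of the points of a grid of mesh \<open>Q powr (e - 2)\<close>. Grid points
  close to a fraction of denominator below \<open>Q powr (1 - 3 * e / 4)\<close> are a negligible proportion; the
  others are moved by much less than the mesh, so their approximations remain separated.\<close>

lemma eventually_frac_net:
  fixes e r :: real
  assumes e: "0 < e" "e < 1" and r: "0 < r" "r \<le> 1"
  shows "\<forall>\<^sub>F Q in sequentially. \<forall>x. \<exists>Y. frac_net e r Q x Y"
proof -
  \<comment> \<open>15 = 5 + 10 collects the two terms in the count of bad grid points below. The
    bound r / 4 makes them at most half of the r X / 2 points that the grid is known to
    have.\<close>
  have "\<forall>\<^sub>F Q in sequentially. 15 * real Q powr (-(e/2)) \<le> r / 4" using e r by real_asymp
  moreover have "\<forall>\<^sub>F Q in sequentially. real Q powr (-(e/4)) \<le> 1 / 4" using e by real_asymp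
  moreover have "\<forall>\<^sub>F Q in sequentially. 1 / r \<le> real Q powr (2 - e)" using e by real_asymp
  ultimately show ?thesis using eventually_ge_at_top[of 1]
  proof eventually_elim
    case (elim Q)
    define X where "X = real Q powr (2 - e)"
    \<comment> \<open>Any exponent 1 - k e with 1/2 < k < 1 would do. Above 1/2, L^2 is negligible
      against X, so few grid points are bad; below 1, the displacement 1 / (L Q) is negligible
      against the mesh 1 / X.\<close>
    define L where "L = real Q powr (1 - 3 * e / 4)"
    have Q: "1 \<le> real Q" "Q > 0" using elim by auto
    have X: "0 < X" "1 \<le> r * X" using elim r Q by (auto simp: X_def field_simps)
    have X1: "1 \<le> X" using X r mult_right_mono[of r 1 X] by linarith
    have L: "1 \<le> L" "L \<le> Q" using Q e powr_mono[of "1 - 3*e/4" 1 "real Q"]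
      by (auto simp: L_def intro!: ge_one_powr_ge_zero)
    have LQ: "1 / (L * Q) = (1 / X) * real Q powr (-(e/4))"
    proof -
      have "L * real Q = real Q powr (2 - 3 * e / 4)" using Q powr_add[of "real Q" "1 - 3*e/4" 1] by (simp add: L_def)
      also have "\<dots> = X * real Q powr (e/4)" by (simp add: X_def powr_add[symmetric])
      finally show ?thesis using Q by (simp add: powr_minus field_simps)
    qed
    have LQ4: "1 / (L * Q) \<le> 1 / (4 * X)"
    proof -
      have "(1 / X) * real Q powr (-(e/4)) \<le> (1 / X) * (1 / 4)" using elim X by (intro mult_left_mono) auto
      thus ?thesis unfolding LQ by simp
    qed
    show ?case
    proof
      fix x :: real
      define J where "J = {j::int. \<bar>real_of_int j - 0\<bar> \<le> r * X / 2}"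
      have finJ: "finite J" unfolding J_def using r X by (intro card_int_interval_le) auto
      have cardJ: "r * X / 2 \<le> card J"
      proof -
        define n where "n = \<lfloor>r * X / 2\<rfloor>"
        have n: "0 \<le> n" "r * X / 2 - 1 < of_int n" "of_int n \<le> r * X / 2" using r X unfolding n_def by (simp_all add: le_floor_iff) linarith
        have "{-n..n} \<subseteq> J"
        proof
          fix j assume "j \<in> {-n..n}"
          hence "\<bar>j\<bar> \<le> n" by auto
          hence "real_of_int \<bar>j\<bar> \<le> of_int n" by (simp only: of_int_le_iff)
          thus "j \<in> J" using n(3) by (simp add: J_def)
        qed
        hence "card {-n..n} \<le> card J" using finJ by (intro card_mono)
        moreover have "real (card {-n..n}) = 2 * of_int n + 1" using n(1) by simp
        ultimately have "2 * of_int n + 1 \<le> real (card J)" by linarith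
        thus ?thesis using n X by linarith
      qed
      let ?x = "\<lambda>j. x + of_int j / X"
      have "\<exists>p q. 1 \<le> q \<and> q \<le> Q \<and> \<bar>?x j - of_int p / real q\<bar> \<le> 1 / (real q * real Q)" for j
      proof -
        obtain h k where hk: "0 < k" "k \<le> int Q" "\<bar>of_int k * ?x j - of_int h\<bar> < 1 / real Q"
          using Dirichlet_approx[OF Q(2), of "?x j"] by blast
        define q where "q = nat k"
        have q: "1 \<le> q" "q \<le> Q" "of_int k = real q" using hk by (auto simp: q_def)
        have "?x j - of_int h / real q = (of_int k * ?x j - of_int h) / real q"
          unfolding q(3) using q(1) by (simp add: diff_divide_distrib)
        hence "\<bar>?x j - of_int h / real q\<bar> = \<bar>of_int k * ?x j - of_int h\<bar> / real q" by simp
        also have "\<dots> \<le> (1 / real Q) / real q" using hk(3) by (intro divide_right_mono) auto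
        finally show ?thesis using q by (intro exI[of _ h] exI[of _ q]) (simp add: mult.commute)
      qed
      then obtain p q where pq: "\<And>j. 1 \<le> q j" "\<And>j. q j \<le> Q"
        "\<And>j. \<bar>?x j - of_int (p j) / real (q j)\<bar> \<le> 1 / (real (q j) * real Q)" by metis
      define y where "y j = of_int (p j) / real (q j)" for j
      define B where "B = {j\<in>J. real (q j) < L}"
      have cardB: "real (card B) \<le> r * X / 4"
      proof -
        define n where "n = nat \<lfloor>L\<rfloor>"
        have n: "real n \<le> L" using L by (simp add: n_def)
        \<comment> \<open>A bad grid point lies within 1 / (a Q) of some b / a with a <= L. For
          given a there are at most 1 + 4 a numerators b within reach of x, and each b / a attracts
          at most 1 + 2 X / (a Q) grid points.\<close>
        let ?P = "\<lambda>a. {b::int. \<bar>of_int b - real a * x\<bar> \<le> 2 * real a}"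
        let ?I = "\<lambda>a b. {j::int. \<bar>of_int j - X * (of_int b / real a - x)\<bar> \<le> X / (real a * real Q)}"
        have sub: "B \<subseteq> (\<Union>a\<in>{1..n}. \<Union>b\<in>?P a. ?I a b)"
        proof
          fix j assume j: "j \<in> B"
          have a: "q j \<in> {1..n}" using j pq(1)[of j] unfolding B_def n_def by (auto simp: le_nat_iff le_floor_iff)
          have qpos: "0 < real (q j)" using a by auto
          have d1: "\<bar>?x j - y j\<bar> \<le> 1 / (real (q j) * real Q)" using pq(3) by (simp add: y_def)
          have "1 / (real (q j) * real Q) \<le> 1 / (1 * 1)" using a Q by (intro divide_left_mono mult_mono) auto
          moreover have "\<bar>of_int j / X\<bar> \<le> 1"
          proof -
            have "\<bar>real_of_int j\<bar> \<le> r * X / 2" using j by (simp add: B_def J_def)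
            also have "\<dots> \<le> X" using r X by (simp add: mult_le_cancel_right2)
            finally show ?thesis using X by (simp add: abs_divide)
          qed
          ultimately have "\<bar>y j - x\<bar> \<le> 2" using d1 by linarith
          hence "real (q j) * \<bar>y j - x\<bar> \<le> real (q j) * 2" by (intro mult_left_mono) auto
          moreover have "real (q j) * \<bar>y j - x\<bar> = \<bar>of_int (p j) - real (q j) * x\<bar>"
          proof -
            have "real (q j) * \<bar>y j - x\<bar> = \<bar>real (q j) * (y j - x)\<bar>" using qpos by (simp add: abs_mult)
            also have "real (q j) * (y j - x) = of_int (p j) - real (q j) * x"
              using qpos by (simp add: y_def algebra_simps)
            finally show ?thesis .
          qed
          ultimately have b: "p j \<in> ?P (q j)" by simp
          have "X * \<bar>?x j - y j\<bar> \<le> X * (1 / (real (q j) * real Q))" using d1 X by (intro mult_left_mono) auto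
          moreover have "X * \<bar>?x j - y j\<bar> = \<bar>of_int j - X * (y j - x)\<bar>"
          proof -
            have "X * \<bar>?x j - y j\<bar> = \<bar>X * (?x j - y j)\<bar>" using X by (simp add: abs_mult)
            also have "X * (?x j - y j) = of_int j - X * (y j - x)" using X by (simp add: algebra_simps)
            finally show ?thesis .
          qed
          ultimately have "j \<in> ?I (q j) (p j)" by (simp add: y_def)
          thus "j \<in> (\<Union>a\<in>{1..n}. \<Union>b\<in>?P a. ?I a b)" using a b by blast
        qed
        have finP: "finite (?P a)" for a by (intro card_int_interval_le) auto
        have finI: "finite (?I a b)" for a b using X by (intro card_int_interval_le) auto
        have fin: "finite (\<Union>a\<in>{1..n}. \<Union>b\<in>?P a. ?I a b)" using finP finI by blast
        have "card B \<le> card (\<Union>a\<in>{1..n}. \<Union>b\<in>?P a. ?I a b)" using sub fin by (rule card_mono[rotated])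
        also have "\<dots> \<le> (\<Sum>a\<in>{1..n}. card (\<Union>b\<in>?P a. ?I a b))" by (rule card_UN_le) auto
        also have "\<dots> \<le> (\<Sum>a\<in>{1..n}. \<Sum>b\<in>?P a. card (?I a b))" by (intro sum_mono card_UN_le finP)
        finally have "real (card B) \<le> (\<Sum>a\<in>{1..n}. \<Sum>b\<in>?P a. real (card (?I a b)))"
          by (metis (mono_tags, lifting) of_nat_le_iff of_nat_sum sum.cong)
        also have "\<dots> \<le> (\<Sum>a\<in>{1..n}. 5 * L + 10 * X / Q)"
        proof (rule sum_mono)
          fix a assume a: "a \<in> {1..n}"
          have "(\<Sum>b\<in>?P a. real (card (?I a b))) \<le> (\<Sum>b\<in>?P a. 1 + 2 * (X / (real a * real Q)))"
            using X by (intro sum_mono card_int_interval_le) auto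
          also have "\<dots> = real (card (?P a)) * (1 + 2 * (X / (real a * real Q)))" by simp
          also have "\<dots> \<le> (1 + 2 * (2 * real a)) * (1 + 2 * (X / (real a * real Q)))"
            using X by (intro mult_right_mono card_int_interval_le) auto
          also have "\<dots> \<le> (5 * real a) * (1 + 2 * (X / (real a * real Q)))"
            using a X by (intro mult_right_mono) auto
          also have "\<dots> = 5 * real a + 10 * X / Q" using a by (simp add: field_simps)
          also have "\<dots> \<le> 5 * L + 10 * X / Q" using a n by auto
          finally show "(\<Sum>b\<in>?P a. real (card (?I a b))) \<le> 5 * L + 10 * X / Q" .
        qed
        also have "\<dots> = real n * (5 * L + 10 * X / Q)" by simp
        also have "\<dots> \<le> L * (5 * L + 10 * X / Q)" using n L X by (intro mult_right_mono) auto
        also have "\<dots> = 5 * (L * L) + 10 * X * (L / Q)" by (simp add: algebra_simps)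
        also have "L * L = X * real Q powr (-(e/2))" by (simp add: L_def X_def powr_add[symmetric])
        also have "L / Q = real Q powr (-(3*e/4))" using Q by (simp add: L_def powr_diff powr_minus_divide)
        also have "5 * (X * real Q powr (-(e/2))) + 10 * X * real Q powr (-(3*e/4)) \<le>
           5 * (X * real Q powr (-(e/2))) + 10 * X * real Q powr (-(e/2))"
          using Q X e by (intro add_left_mono mult_left_mono powr_mono) auto
        also have "\<dots> = X * (15 * real Q powr (-(e/2)))" by simp
        also have "\<dots> \<le> X * (r / 4)" using elim X by (intro mult_left_mono) auto
        finally show ?thesis by (simp add: mult.commute)
      qed
      define G where "G = J - B"
      have good: "\<bar>?x j - y j\<bar> \<le> 1 / (4 * X)" if "j \<in> G" for j
      proof -
        have "\<bar>?x j - y j\<bar> \<le> 1 / (real (q j) * real Q)" using pq(3) by (simp add: y_def)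
        also have "\<dots> \<le> 1 / (L * Q)" using that Q L
          by (intro divide_left_mono mult_right_mono mult_pos_pos) (auto simp: G_def B_def)
        finally show ?thesis using LQ4 by linarith
      qed
      have sep: "1 / (2 * X) \<le> \<bar>y i - y j\<bar>" if ij: "i \<in> G" "j \<in> G" "i \<noteq> j" for i j
      proof -
        have "1 \<le> \<bar>i - j\<bar>" using ij by linarith
        hence "1 \<le> \<bar>real_of_int (i - j)\<bar>" by linarith
        hence "1 / X \<le> \<bar>real_of_int (i - j)\<bar> / X" using X by (intro divide_right_mono) auto
        also have "\<dots> = \<bar>?x i - ?x j\<bar>" using X by (simp add: abs_divide diff_divide_distrib[symmetric])
        finally have "1 / X \<le> \<bar>?x i - ?x j\<bar>" .
        moreover have "1 / X = 4 * (1 / (4 * X))" "1 / (2 * X) = 2 * (1 / (4 * X))" by auto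
        ultimately show ?thesis using good[OF ij(1)] good[OF ij(2)] by linarith
      qed
      have inj: "inj_on y G"
      proof (rule inj_onI, rule ccontr)
        fix i j assume "i \<in> G" "j \<in> G" "y i = y j" "i \<noteq> j"
        with sep[of i j] X show False by simp
      qed
      have cardG: "r * X / 4 \<le> card (y ` G)"
      proof -
        have "card G = card J - card B" unfolding G_def using finJ by (intro card_Diff_subset) (auto simp: B_def)
        hence "real (card G) = real (card J) - real (card B)"
          using card_mono[OF finJ, of B] by (simp add: B_def of_nat_diff)
        thus ?thesis using cardJ cardB card_image[OF inj] by simp
      qed
      show "\<exists>Y. frac_net e r Q x Y"
        unfolding frac_net_def X_def[symmetric] L_def[symmetric]
      proof (intro exI[of _ "y ` G"] conjI ballI impI)
        show "finite (y ` G)" using finJ by (simp add: G_def)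
        show "r * X / 4 \<le> card (y ` G)" by (rule cardG)
      next
        fix z assume "z \<in> y ` G"
        then obtain j where j: "j \<in> G" "z = y j" by blast
        have "\<bar>real_of_int j\<bar> \<le> r * X / 2" using j by (simp add: G_def J_def)
        hence "\<bar>real_of_int j / X\<bar> \<le> r / 2" using X by (simp add: abs_divide field_simps)
        \<comment> \<open>From r X >= 1: the grid reaches r / 2 and the displacement adds at most r
          / 4.\<close>
        moreover have "1 / (4 * X) \<le> r / 4" using X by (simp add: field_simps)
        ultimately show "\<bar>z - x\<bar> \<le> 3 * r / 4" using good[OF j(1)] unfolding j(2) by linarith
        show "\<exists>(p::int) q. z = of_int p / real q \<and> 1 \<le> q \<and> L \<le> real q \<and> q \<le> Q"
          using j pq(1,2)[of j] by (intro exI[of _ "p j"] exI[of _ "q j"]) (auto simp: y_def G_def B_def)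
      next
        fix z z' assume "z \<in> y ` G" "z' \<in> y ` G" "z \<noteq> z'"
        thus "1 / (2 * X) \<le> \<bar>z - z'\<bar>" using sep by blast
      qed
    qed
  qed
qed

text \<open>The inequality on \<open>c n\<close> says that the n-th covering ball meets the ball
  about x. Asking that such balls cost at most a fixed fraction of r^D plays the part of a mass
  distribution. The constant is 144 = 9 * 16: a covering ball meets at most 9 candidates or 9 times
  its width in meshes, and each kind may spoil at most r X / 16 of at least r X / 4
  candidates.\<close>

definition light_ball :: "(nat \<Rightarrow> real) \<Rightarrow> (nat \<Rightarrow> real) \<Rightarrow> real \<Rightarrow> real \<Rightarrow> real \<Rightarrow> bool" where
  "light_ball c w D x r \<longleftrightarrow> 0 < r \<and> r \<le> 1 \<and>
     (\<forall>F. finite F \<longrightarrow> (\<forall>n\<in>F. \<bar>c n - x\<bar> \<le> w n + r) \<longrightarrow> (\<Sum>n\<in>F. w n powr D) \<le> r powr D / 144)"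

text \<open>Averaging over the separated fractions in the ball. Sets wider than the separation distance
  meet few of the candidate subballs because their total length is small; the narrower sets meet
  boundedly many candidates each, so some candidate receives little of their total weight.\<close>

lemma light_ball_step:
  fixes c w :: "nat \<Rightarrow> real" and Q1 :: nat
  assumes w: "\<And>n. 0 < w n" and D: "0 < D" "D < 1" and \<nu>: "2 < \<nu>" "\<nu> * D < 2"
    and light: "light_ball c w D x r"
  shows "\<exists>y r' (p::int) q. light_ball c w D y r' \<and> cball y r' \<subseteq> cball x r \<and> Q1 \<le> q \<and> 1 \<le> q \<and>
    y = of_int p / real q \<and> r' \<le> real q powr (-\<nu>)"
proof -
  have r: "0 < r" "r \<le> 1" using light by (auto simp: light_ball_def)
  have light_sum: "(\<Sum>n\<in>F. w n powr D) \<le> r powr D / 144"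
    if "finite F" "\<And>n. n \<in> F \<Longrightarrow> \<bar>c n - x\<bar> \<le> w n + r" for F
    using light that by (simp add: light_ball_def)
  \<comment> \<open>At most half of the gap 2 - \<nu> D and at most 1/2, so that the number of
    candidates, of order Q^(2-e), still exceeds Q^(\<nu> D) by the power Q^g.\<close>
  define e where "e = (2 - max 1 (\<nu> * D)) / 2"
  have e: "0 < e" "e < 1" using \<nu> by (auto simp: e_def max_def)
  define g where "g = 2 - e - \<nu> * D"
  have g: "0 < g" using \<nu> by (auto simp: e_def g_def max_def field_simps)
  have "\<forall>\<^sub>F Q in sequentially. real Q1 \<le> real Q powr (1 - 3 * e / 4)" using e by real_asymp
  moreover have "\<forall>\<^sub>F Q in sequentially. real Q powr (-\<nu>) \<le> r / 4" using \<nu> r by real_asymp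
  moreover have "\<forall>\<^sub>F Q in sequentially. 144 * real Q powr (-g) < r" using g r by real_asymp
  ultimately have "\<forall>\<^sub>F Q in sequentially. \<exists>y r' (p::int) q. light_ball c w D y r' \<and> cball y r' \<subseteq> cball x r \<and> Q1 \<le> q \<and> 1 \<le> q \<and>
    y = of_int p / real q \<and> r' \<le> real q powr (-\<nu>)"
    using eventually_frac_net[OF e r] eventually_ge_at_top[of 1]
  proof eventually_elim
    case (elim Q)
    define X where "X = real Q powr (2 - e)"
    define \<rho> where "\<rho> = real Q powr (-\<nu>)"
    have Q: "1 \<le> real Q" using elim by simp
    have X: "0 < X" using Q by (simp add: X_def)
    have \<rho>: "0 < \<rho>" "\<rho> \<le> r / 4" using Q elim by (auto simp: \<rho>_def)
    have "X * \<rho> = real Q powr (2 - e - \<nu>)" by (simp add: X_def \<rho>_def powr_add[symmetric])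
    also have "\<dots> \<le> real Q powr 0" using Q e \<nu> by (intro powr_mono) auto
    finally have X\<rho>: "X * \<rho> \<le> 1" using Q by simp
    have Qg: "144 * real Q powr (\<nu> * D) < r * X"
    proof -
      have "144 * real Q powr (-g) * X < r * X" using elim X by (intro mult_strict_right_mono) auto
      moreover have "real Q powr (-g) * X = real Q powr (\<nu> * D)"
        by (simp add: X_def g_def powr_add[symmetric])
      ultimately show ?thesis by (simp add: mult.assoc)
    qed
    obtain Y where "frac_net e r Q x Y" using elim(4) by blast
    note Y = frac_netD[OF this, folded X_def]
    have ex: "\<exists>y\<in>Y. light_ball c w D y \<rho>"
    proof (rule ccontr)
      assume none: "\<not> (\<exists>y\<in>Y. light_ball c w D y \<rho>)"
      have "\<exists>F. finite F \<and> (\<forall>n\<in>F. \<bar>c n - y\<bar> \<le> w n + \<rho>) \<and> \<rho> powr D / 144 < (\<Sum>n\<in>F. w n powr D)"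
        if "y \<in> Y" for y
        using none that \<rho> r by (force simp: light_ball_def not_le)
      then obtain F where F: "\<And>y. y \<in> Y \<Longrightarrow> finite (F y) \<and> (\<forall>n\<in>F y. \<bar>c n - y\<bar> \<le> w n + \<rho>) \<and>
          \<rho> powr D / 144 < (\<Sum>n\<in>F y. w n powr D)" by metis
      define A where "A = (\<Union>y\<in>Y. F y)"
      have finA: "finite A" unfolding A_def using Y(1) F by auto
      have meetA: "\<bar>c n - x\<bar> \<le> w n + r" if n: "n \<in> A" for n
      proof -
        obtain y where "y \<in> Y" "n \<in> F y" using n by (auto simp: A_def)
        hence "\<bar>c n - y\<bar> \<le> w n + \<rho>" "\<bar>y - x\<bar> \<le> 3 * r / 4" using F Y(3) by auto
        thus ?thesis using \<rho> by linarith
      qed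
      have sumA: "(\<Sum>n\<in>A. w n powr D) \<le> r powr D / 144" by (rule light_sum[OF finA meetA])
      \<comment> \<open>The candidates whose ball of radius \<rho> meets the n-th covering ball.
        Their number is at most 9 X w when X w >= 1, and at most 9 when X w < 1.\<close>
      define M where "M n = {y\<in>Y. \<bar>c n - y\<bar> \<le> w n + \<rho>}" for n
      have cardM: "real (card (M n)) \<le> 5 + 4 * X * w n" for n
      proof -
        have "real (card (M n)) \<le> 1 + ((c n + (w n + \<rho>)) - (c n - (w n + \<rho>))) / (1 / (2 * X))"
        proof (rule card_separated_le(2))
          show "1 / (2 * X) \<le> \<bar>y - y'\<bar>" if "y \<in> M n" "y' \<in> M n" "y \<noteq> y'" for y y'
            using that Y(5) by (auto simp: M_def)
        qed (use X w[of n] \<rho> in \<open>auto simp: M_def\<close>)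
        also have "\<dots> = 1 + 4 * X * w n + 4 * (X * \<rho>)" using X by (simp add: field_simps)
        also have "\<dots> \<le> 5 + 4 * X * w n" using X\<rho> by simp
        finally show ?thesis .
      qed
      have finM: "finite (M n)" for n using Y(1) by (simp add: M_def)
      define Big where "Big = {n\<in>A. 1 \<le> X * w n}"
      define Small where "Small = {n\<in>A. X * w n < 1}"
      define Y2 where "Y2 = (\<Union>n\<in>Big. M n)"
      have finS: "finite Small" "finite Big" using finA by (auto simp: Small_def Big_def)
      \<comment> \<open>Converts D-cost into length: the total cost already forces w <= r, and
        w^(1-D) <= r^(1-D) as D < 1.\<close>
      have w_le: "w n \<le> r powr (1 - D) * w n powr D" if n: "n \<in> A" for n
      proof -
        have "w n powr D \<le> (\<Sum>n\<in>A. w n powr D)" using finA n by (intro member_le_sum) auto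
        also have "\<dots> \<le> r powr D" using sumA powr_ge_zero[of r D] by linarith
        finally have "w n \<le> r" using D r w[of n] by (meson not_less powr_less_mono2 less_imp_le)
        have "w n = w n powr (1 - D) * w n powr D" using w[of n] by (simp add: powr_add[symmetric])
        also have "\<dots> \<le> r powr (1 - D) * w n powr D"
          using D w[of n] \<open>w n \<le> r\<close> by (intro mult_right_mono powr_mono2) auto
        finally show ?thesis .
      qed
      have cardY2: "real (card Y2) \<le> r * X / 16"
      proof -
        have "card Y2 \<le> (\<Sum>n\<in>Big. card (M n))" unfolding Y2_def by (rule card_UN_le[OF finS(2)])
        hence "real (card Y2) \<le> (\<Sum>n\<in>Big. real (card (M n)))" by (metis of_nat_le_iff of_nat_sum)
        also have "\<dots> \<le> (\<Sum>n\<in>Big. 9 * X * w n)"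
        proof (rule sum_mono)
          fix n assume "n \<in> Big"
          thus "real (card (M n)) \<le> 9 * X * w n" using cardM[of n] by (auto simp: Big_def)
        qed
        also have "\<dots> \<le> (\<Sum>n\<in>A. 9 * X * w n)"
          using finA X w by (intro sum_mono2) (auto simp: Big_def less_imp_le)
        also have "\<dots> \<le> (\<Sum>n\<in>A. 9 * X * (r powr (1 - D) * w n powr D))"
          using X w_le by (intro sum_mono mult_left_mono) auto
        also have "\<dots> = 9 * X * r powr (1 - D) * (\<Sum>n\<in>A. w n powr D)"
          by (simp add: sum_distrib_left mult.assoc)
        also have "\<dots> \<le> 9 * X * r powr (1 - D) * (r powr D / 144)"
          using X sumA by (intro mult_left_mono) auto
        also have "\<dots> = X * (r powr (1 - D) * r powr D) / 16" by simp
        also have "r powr (1 - D) * r powr D = r" using r by (simp add: powr_add[symmetric])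
        finally show ?thesis by (simp add: mult.commute)
      qed
      have small: "\<rho> powr D / 144 \<le> (\<Sum>n\<in>Small. if y \<in> M n then w n powr D else 0)" if y: "y \<in> Y - Y2" for y
      proof -
        have Fy: "finite (F y)" "\<And>n. n \<in> F y \<Longrightarrow> \<bar>c n - y\<bar> \<le> w n + \<rho>" "\<rho> powr D / 144 < (\<Sum>n\<in>F y. w n powr D)"
          using F[of y] y by auto
        have sub: "F y \<subseteq> {n\<in>Small. y \<in> M n}"
        proof
          fix n assume n: "n \<in> F y"
          have M: "y \<in> M n" using Fy(2)[OF n] y by (simp add: M_def)
          have A: "n \<in> A" using n y by (auto simp: A_def)
          have "n \<notin> Big" using M y by (auto simp: Y2_def)
          thus "n \<in> {n\<in>Small. y \<in> M n}" using M A by (auto simp: Small_def Big_def)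
        qed
        have "(\<Sum>n\<in>F y. w n powr D) \<le> (\<Sum>n\<in>{n\<in>Small. y \<in> M n}. w n powr D)"
          using sub finS(1) by (intro sum_mono2) auto
        also have "\<dots> = (\<Sum>n\<in>Small. if y \<in> M n then w n powr D else 0)"
          using finS(1) by (rule sum.inter_filter)
        finally show ?thesis using Fy(3) by linarith
      qed
      \<comment> \<open>Double counting of the cost that narrow balls bring to the candidates in Y -
        Y2. Each such candidate receives at least \<rho>^D / 144, each narrow ball is counted at
        most 9 times, and \<rho>^(-D) = Q^(\<nu> D).\<close>
      have cardY3: "real (card (Y - Y2)) \<le> 9 * real Q powr (\<nu> * D)"
      proof -
        have "real (card (Y - Y2)) * (\<rho> powr D / 144) = (\<Sum>y\<in>Y - Y2. \<rho> powr D / 144)" by simp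
        also have "\<dots> \<le> (\<Sum>y\<in>Y - Y2. \<Sum>n\<in>Small. if y \<in> M n then w n powr D else 0)"
          by (intro sum_mono small)
        also have "\<dots> \<le> (\<Sum>y\<in>Y. \<Sum>n\<in>Small. if y \<in> M n then w n powr D else 0)"
          using Y(1) by (intro sum_mono2) (auto intro!: sum_nonneg)
        also have "\<dots> = (\<Sum>n\<in>Small. \<Sum>y\<in>Y. if y \<in> M n then w n powr D else 0)" by (rule sum.swap)
        also have "\<dots> = (\<Sum>n\<in>Small. real (card (M n)) * w n powr D)"
        proof (rule sum.cong[OF refl])
          fix n
          have "(\<Sum>y\<in>Y. if y \<in> M n then w n powr D else 0) = (\<Sum>y\<in>{y\<in>Y. y \<in> M n}. w n powr D)"
            using Y(1) by (rule sum.inter_filter[symmetric])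
          also have "{y\<in>Y. y \<in> M n} = M n" by (auto simp: M_def)
          finally show "(\<Sum>y\<in>Y. if y \<in> M n then w n powr D else 0) = real (card (M n)) * w n powr D" by simp
        qed
        also have "\<dots> \<le> (\<Sum>n\<in>Small. 9 * w n powr D)"
        proof (intro sum_mono mult_right_mono)
          fix n assume "n \<in> Small"
          thus "real (card (M n)) \<le> 9" using cardM[of n] by (auto simp: Small_def)
        qed auto
        also have "\<dots> = 9 * (\<Sum>n\<in>Small. w n powr D)" by (simp add: sum_distrib_left)
        also have "\<dots> \<le> 9 * (\<Sum>n\<in>A. w n powr D)"
          using finA by (intro mult_left_mono sum_mono2) (auto simp: Small_def)
        also have "\<dots> \<le> 9 * (r powr D / 144)" using sumA by simp
        also have "\<dots> \<le> 9 * (1 / 144)" using r D by (intro mult_left_mono divide_right_mono powr_le1) auto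
        finally have "real (card (Y - Y2)) * \<rho> powr D \<le> 9" by (simp add: mult.commute)
        hence "real (card (Y - Y2)) \<le> 9 / \<rho> powr D" using \<rho> by (simp add: field_simps)
        also have "\<rho> powr D = 1 / real Q powr (\<nu> * D)"
          unfolding \<rho>_def powr_powr by (simp add: powr_minus_divide)
        also have "9 / (1 / real Q powr (\<nu> * D)) = 9 * real Q powr (\<nu> * D)" by simp
        finally show ?thesis .
      qed
      have "Y = Y2 \<union> (Y - Y2)" by (auto simp: Y2_def M_def)
      hence "card Y \<le> card Y2 + card (Y - Y2)" by (metis card_Un_le)
      hence "real (card Y) \<le> r * X / 16 + 9 * real Q powr (\<nu> * D)" using cardY2 cardY3 by linarith
      moreover have "0 < r * X" using r X by simp
      \<comment> \<open>By \<open>Qg\<close> the second term is below r X / 16, so fewer than r X /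
        8 candidates would be spoiled, against at least r X / 4 present.\<close>
      ultimately show False using Y(2) Qg by linarith
    qed
    then obtain y where y: "y \<in> Y" "light_ball c w D y \<rho>" by blast
    obtain p :: int and q where pq: "y = of_int p / real q" "1 \<le> q" "real Q powr (1 - 3 * e / 4) \<le> real q" "q \<le> Q"
      using Y(4)[OF y(1)] by blast
    have "real Q1 \<le> real q" using elim pq(3) by linarith
    hence "Q1 \<le> q" by simp
    moreover have "\<rho> \<le> real q powr (-\<nu>)" unfolding \<rho>_def using pq \<nu> by (intro powr_mono2') auto
    moreover have "cball y \<rho> \<subseteq> cball x r"
    proof
      fix z assume "z \<in> cball y \<rho>"
      hence "\<bar>y - z\<bar> \<le> \<rho>" by (simp add: dist_real_def)
      hence "\<bar>x - z\<bar> \<le> r" using Y(3)[OF y(1)] \<rho> by linarith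
      thus "z \<in> cball x r" by (simp add: dist_real_def)
    qed
    ultimately show ?case using y(2) pq(1,2) by blast
  qed
  from eventually_happens'[OF sequentially_bot this] show ?thesis by (rule exE)
qed

text \<open>Iterating \<open>light_ball_step\<close> with orders increasing to 2 / D gives nested
  balls with a common point t. If t lay in the n-th covering ball, that ball would meet every ball
  of the nest, so lightness would bound \<open>w n\<close> by radii tending to 0, contradicting
  \<open>0 < w n\<close>.\<close>

lemma exists_approximable_not_null:
  assumes D: "0 < D" "D < 1" and E: "power_null D E"
  shows "\<exists>t. t \<notin> E \<and> (\<forall>\<nu><2 / D. t \<in> approximable \<nu>)"
proof -
  obtain w c :: "nat \<Rightarrow> real" where cw: "\<And>n. 0 < w n" "\<And>F. finite F \<Longrightarrow> (\<Sum>n\<in>F. w n powr D) \<le> 1 / 144"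
    "E \<subseteq> (\<Union>n. cball (c n) (w n))"
    by (rule power_nullE[OF E, of "1/144"]) (simp, rule that)
  \<comment> \<open>The offset 2 matters: with \<open>real k + 1\<close> the first order would equal
    2, and the step needs it strictly larger.\<close>
  define \<nu> where "\<nu> k = 2 / D - (2 / D - 2) / (real k + 2)" for k :: nat
  have D2: "2 < 2 / D" using D by (simp add: field_simps)
  have \<nu>: "2 < \<nu> k" "\<nu> k < 2 / D" for k
  proof -
    have "(2 / D - 2) / (real k + 2) < (2 / D - 2) / 1" using D2 by (intro divide_strict_left_mono) auto
    thus "2 < \<nu> k" by (simp add: \<nu>_def)
    show "\<nu> k < 2 / D" using D2 by (simp add: \<nu>_def)
  qed
  have \<nu>D: "\<nu> k * D < 2" for k using \<nu>(2)[of k] D by (simp add: field_simps)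
  let ?good = "\<lambda>s :: real \<times> real. light_ball c w D (fst s) (snd s)"
  let ?next = "\<lambda>k (s :: real \<times> real) s'. cball (fst s') (snd s') \<subseteq> cball (fst s) (snd s) \<and>
      (\<exists>(p::int) q. Suc k \<le> q \<and> fst s' = of_int p / real q \<and> snd s' \<le> real q powr (-\<nu> k))"
  have "\<exists>f. \<forall>k. ?good (f k) \<and> ?next k (f k) (f (Suc k))"
  proof (rule dependent_nat_choice)
    have "light_ball c w D 0 1" using cw(2) by (simp add: light_ball_def)
    thus "\<exists>s. ?good s" by (intro exI[of _ "(0, 1)"]) simp
  next
    fix s k assume "?good s"
    from light_ball_step[OF cw(1) D \<nu>(1) \<nu>D this, of "Suc k" k]
    obtain y r' and p :: int and q where "light_ball c w D y r'" "cball y r' \<subseteq> cball (fst s) (snd s)"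
      "Suc k \<le> q" "y = of_int p / real q" "r' \<le> real q powr (-\<nu> k)" by blast
    thus "\<exists>s'. ?good s' \<and> ?next k s s'" by (intro exI[of _ "(y, r')"]) auto
  qed
  then obtain f where f: "\<And>k. ?good (f k)" "\<And>k. ?next k (f k) (f (Suc k))" by blast
  let ?C = "\<lambda>k. cball (fst (f k)) (snd (f k))"
  have "\<Inter> (range ?C) \<noteq> {}"
  proof (rule compact_nest)
    fix k show "compact (?C k)" "?C k \<noteq> {}" using f(1)[of k] by (auto simp: light_ball_def)
  next
    fix m n :: nat assume mn: "m \<le> n"
    have "?C (Suc k) \<subseteq> ?C k" for k using f(2)[of k] by (rule conjunct1)
    from lift_Suc_antimono_le[of ?C, OF this mn] show "?C n \<subseteq> ?C m" .
  qed
  then obtain t where t: "\<And>k. t \<in> ?C k" by blast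
  have close: "\<exists>(p::int) q. Suc k \<le> q \<and> fst (f (Suc k)) = of_int p / real q \<and> snd (f (Suc k)) \<le> real q powr (-\<nu> k)" for k
    using f(2)[of k] by blast
  have "t \<notin> E"
  proof
    assume "t \<in> E"
    then obtain n where n: "t \<in> cball (c n) (w n)" using cw(3) by blast
    have "w n \<le> 1 / real (Suc k)" for k
    proof -
      let ?s = "f (Suc k)"
      obtain p :: int and q where pq: "Suc k \<le> q" "snd ?s \<le> real q powr (-\<nu> k)" using close by blast
      have g: "0 < snd ?s" "snd ?s \<le> 1"
        "(\<forall>n\<in>{n}. \<bar>c n - fst ?s\<bar> \<le> w n + snd ?s) \<Longrightarrow> (\<Sum>n\<in>{n}. w n powr D) \<le> snd ?s powr D / 144"
        using f(1)[of "Suc k"] unfolding light_ball_def by blast+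
      have "\<bar>c n - fst ?s\<bar> \<le> w n + snd ?s" using n t[of "Suc k"] by (auto simp: dist_real_def)
      hence "w n powr D \<le> snd ?s powr D / 144" using g(3) by simp
      also have "\<dots> \<le> snd ?s powr D" by simp
      finally have "w n \<le> snd ?s" using D g cw(1)[of n] by (meson not_less powr_less_mono2 less_imp_le)
      also have "\<dots> \<le> real q powr (-\<nu> k)" by (rule pq(2))
      also have "\<dots> \<le> real q powr (-1)" using pq(1) \<nu>(1)[of k] by (intro powr_mono) auto
      also have "\<dots> = 1 / real q" using pq(1) by (simp add: powr_minus_divide)
      also have "\<dots> \<le> 1 / real (Suc k)" using pq(1) by (intro divide_left_mono) (auto simp del: of_nat_Suc)
      finally show ?thesis .
    qed
    moreover obtain k where "inverse (real (Suc k)) < w n" using reals_Archimedean[OF cw(1)] by blast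
    ultimately show False by (metis inverse_eq_divide not_le)
  qed
  moreover have "t \<in> approximable \<mu>" if \<mu>: "\<mu> < 2 / D" for \<mu>
    unfolding approximable_def
  proof (intro CollectI allI)
    fix Q
    have "(\<lambda>k. \<nu> k) \<longlonglongrightarrow> 2 / D" unfolding \<nu>_def by real_asymp
    hence "\<forall>\<^sub>F k in sequentially. \<mu> < \<nu> k" using \<mu> by (rule order_tendstoD(1))
    hence "\<forall>\<^sub>F k in sequentially. \<mu> < \<nu> k \<and> Q \<le> k" using eventually_ge_at_top by (rule eventually_conj)
    then obtain k where k: "\<mu> < \<nu> k" "Q \<le> k" using eventually_happens'[of sequentially] by fastforce
    obtain p :: int and q where pq: "Suc k \<le> q" "fst (f (Suc k)) = of_int p / real q" "snd (f (Suc k)) \<le> real q powr (-\<nu> k)"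
      using close by blast
    have "\<bar>t - of_int p / real q\<bar> \<le> snd (f (Suc k))"
      using t[of "Suc k"] pq(2) by (simp add: dist_real_def abs_minus_commute)
    also have "\<dots> \<le> real q powr (-\<nu> k)" by (rule pq(3))
    also have "\<dots> \<le> real q powr (-\<mu>)" using pq(1) k by (intro powr_mono) auto
    finally show "\<exists>q\<ge>Q. \<exists>p::int. 1 \<le> q \<and> \<bar>t - of_int p / real q\<bar> \<le> real q powr (-\<mu>)"
      using pq(1) k(2) by (intro exI[of _ q] conjI exI[of _ p]) auto
  qed
  ultimately show ?thesis by blast
qed

text \<open>The endpoint D = 1 escapes the nested construction, which needs \<nu> > 2 and \<nu> D <
  2. Here Lebesgue measure decides: intervals of total length at most 1/2 cannot cover
  {0..1}.\<close>

lemma power_null_one_neq_UNIV: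
  assumes "power_null 1 E"
  shows "\<exists>t. t \<notin> E"
proof (rule ccontr)
  assume "\<nexists>t. t \<notin> E"
  obtain w c :: "nat \<Rightarrow> real" where cw: "\<And>n. 0 < w n" "\<And>F. finite F \<Longrightarrow> (\<Sum>n\<in>F. w n powr 1) \<le> 1 / 4"
    "E \<subseteq> (\<Union>n. cball (c n) (w n))"
    by (rule power_nullE[OF assms, of "1/4"]) (simp, rule that)
  have nn: "\<not> w n < 0" for n using cw(1)[of n] by simp
  have "{0..1} \<subseteq> (\<Union>n. cball (c n) (w n))" using cw(3) \<open>\<nexists>t. t \<notin> E\<close> by blast
  hence "emeasure lborel {0..1::real} \<le> emeasure lborel (\<Union>n. cball (c n) (w n))"
    by (intro emeasure_mono) auto
  also have "\<dots> \<le> (\<Sum>n. emeasure lborel (cball (c n) (w n)))"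
    by (rule emeasure_subadditive_countably) auto
  also have "\<dots> \<le> ennreal (1/2)"
  proof (rule suminf_le_const)
    fix n
    have "(\<Sum>k<n. emeasure lborel (cball (c k) (w k))) = (\<Sum>k<n. ennreal (2 * w k))"
      using nn by (intro sum.cong) (auto simp: cball_eq_atLeastAtMost not_less)
    also have "\<dots> = ennreal (\<Sum>k<n. 2 * w k)" using cw(1) by (intro sum_ennreal) (simp add: less_imp_le)
    also have "(\<Sum>k<n. 2 * w k) = 2 * (\<Sum>k<n. w k powr 1)"
      using cw(1) by (simp add: sum_distrib_left less_imp_le)
    also have "\<dots> \<le> 2 * (1 / 4)" using cw(2)[of "{..<n}"] by (intro mult_left_mono) auto
    finally show "(\<Sum>k<n. emeasure lborel (cball (c k) (w k))) \<le> ennreal (1 / 2)" by (simp add: ennreal_leI)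
  qed auto
  finally have "ennreal 1 \<le> ennreal (1 / 2)" by simp
  thus False by (subst (asm) ennreal_le_iff) auto
qed

lemma exists_approximable:
  assumes D: "0 < D" "D \<le> 1" and E: "power_null D E"
  shows "\<exists>t. t \<notin> E \<and> (\<forall>\<nu><2 / D. t \<in> approximable \<nu>)"
proof (cases "D = 1")
  case True
  then obtain t where "t \<notin> E" using power_null_one_neq_UNIV E by blast
  \<comment> \<open>For D = 1 the required orders are those below 2, which Dirichlet's theorem
    grants to every point.\<close>
  moreover have "t \<in> approximable \<nu>" if "\<nu> < 2" for \<nu>
    using approximable_two[of t] approximable_antimono[of \<nu> 2] that by auto
  ultimately show ?thesis using True by auto
next
  case False
  thus ?thesis using exists_approximable_not_null D E by simp
qed

section \<open>The spectrum of the jump function\<close>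

context jump_function
begin

text \<open>Upper bound: exponent h forces order s / h' for h' slightly above h. Lower bound: the
  escaping point has order s / h exactly. Nonemptiness is separate, because the spectrum of an empty
  level set is minus infinity.\<close>

lemma singularity_spectrum_H:
  assumes h: "0 \<le> h" "h \<le> s / 2"
  shows "singularity_spectrum H h = ereal (2 * h / s)"
proof -
  define S where "S = {t. holder_exponent H t = ereal h}"
  have s: "0 < s" using s_bounds by simp
  have upper: "hausdorff_measure d S = 0" if d: "2 * h / s < d" for d
  proof -
    have "0 \<le> 2 * h / s" using h s by simp
    hence d0: "0 < d" using d by linarith
    obtain \<nu> where \<nu>: "S \<subseteq> approximable \<nu>" "2 < \<nu> * d"
    proof (cases "h < s / 2")
      case True
      have "h < s * d / 2" using d s by (simp add: field_simps)
      then obtain h' where h': "h < h'" "h' < min (s / 2) (s * d / 2)" using True dense[of h "min (s / 2) (s * d / 2)"] by auto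
      have hp: "0 < h'" using h h' by linarith
      have \<nu>2: "2 \<le> s / h'" using h' hp by (simp add: field_simps)
      have "S \<subseteq> approximable (s / h')"
      proof
        fix t assume t: "t \<in> S"
        show "t \<in> approximable (s / h')"
        proof (rule ccontr)
          assume "t \<notin> approximable (s / h')"
          from holder_exponent_H_ge[OF this \<nu>2] have "ereal h' \<le> ereal h"
            using t hp s by (simp add: S_def)
          thus False using h' by simp
        qed
      qed
      moreover have "2 < s / h' * d" using h' hp by (simp add: field_simps)
      ultimately show thesis by (rule that)
    next
      case False
      \<comment> \<open>At h = s / 2 there is no h' to interpose; the trivial order 2 suffices, as d
        > 1.\<close>
      hence "2 * h / s = 1" using h s by (simp add: field_simps)
      thus thesis using d approximable_two by (intro that[of 2]) auto
    qed
    have "power_null d S"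
      using power_null_approximable[OF d0 \<nu>(2)] \<nu>(1) by (rule power_null_subset)
    thus ?thesis by (rule hausdorff_measure_power_null[OF d0])
  qed
  have lower: "2 * h / s \<le> d" if d: "0 \<le> d" "hausdorff_measure d S = 0" for d
  proof (rule ccontr)
    assume "\<not> 2 * h / s \<le> d"
    define D where "D = 2 * h / s"
    have "d < D" using \<open>\<not> 2 * h / s \<le> d\<close> by (simp add: D_def)
    moreover have "D \<le> 1" using h s by (simp add: D_def field_simps)
    ultimately have D: "0 < D" "D \<le> 1" "d < D" using d by auto
    have hp: "0 < h" using D s by (simp add: D_def zero_less_divide_iff)
    have \<nu>: "2 / D = s / h" by (simp add: D_def)
    have n1: "power_null D S" by (rule power_null_hausdorff_measure[OF d(1) D(3) d(2)])
    \<comment> \<open>Covering these sets as well keeps the order of the escaping point from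
      exceeding s / h, hence its exponent from falling below h.\<close>
    have n2: "power_null D (\<Union>m::nat. approximable (2 / D + 1 / real (Suc m)))"
    proof (rule power_null_UN[OF D(1)], rule power_null_approximable[OF D(1)])
      fix m :: nat
      have "2 = 2 / D * D" using D by simp
      also have "\<dots> < (2 / D + 1 / real (Suc m)) * D" using D by (intro mult_strict_right_mono) auto
      finally show "2 < (2 / D + 1 / real (Suc m)) * D" .
    qed
    obtain t where t: "t \<notin> S" "\<And>m. t \<notin> approximable (2 / D + 1 / real (Suc m))" "\<And>\<nu>. \<nu> < 2 / D \<Longrightarrow> t \<in> approximable \<nu>"
      using exists_approximable[OF D(1,2) power_null_Un[OF D(1) n1 n2]] by blast
    have "holder_exponent H t \<le> ereal h"
    proof (rule ereal_le_epsilon2)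
      fix \<epsilon> :: real assume \<epsilon>: "0 < \<epsilon>"
      have "s / (h + \<epsilon>) < 2 / D" unfolding \<nu> using hp \<epsilon> s by (intro divide_strict_left_mono) auto
      hence "t \<in> approximable (s / (h + \<epsilon>))" by (rule t(3))
      from holder_exponent_H_le[OF this] show "holder_exponent H t \<le> ereal h + ereal \<epsilon>"
        using hp \<epsilon> s by simp
    qed
    moreover have "ereal h \<le> holder_exponent H t"
    proof -
      have le: "ereal (s / (2 / D + 1 / real (Suc m))) \<le> holder_exponent H t" for m
      proof (rule holder_exponent_H_ge[OF t(2)])
        have "2 \<le> 2 / D" using D by (simp add: field_simps)
        moreover have "0 \<le> 1 / real (Suc m)" by simp
        ultimately show "2 \<le> 2 / D + 1 / real (Suc m)" by linarith
      qed
      have lim: "(\<lambda>m. ereal (s / (2 / D + 1 / real (Suc m)))) \<longlonglongrightarrow> ereal h"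
      proof -
        have "(\<lambda>m. 1 / real (Suc m)) \<longlonglongrightarrow> 0" by (rule LIMSEQ_Suc[OF lim_1_over_n])
        hence "(\<lambda>m. s / (2 / D + 1 / real (Suc m))) \<longlonglongrightarrow> s / (2 / D + 0)"
          using D by (intro tendsto_intros) auto
        also have "s / (2 / D + 0) = h" using s hp by (simp add: D_def)
        finally show ?thesis by simp
      qed
      show ?thesis using lim by (rule LIMSEQ_le_const2) (use le in blast)
    qed
    ultimately show False using t(1) by (simp add: S_def)
  qed
  have ne: "S \<noteq> {}"
  proof
    assume S: "S = {}"
    show False
    proof (cases "h = 0")
      case True
      \<comment> \<open>For h = 0 a rational point is a witness: 0 = 0 / q is approximable to every
        order.\<close>
      have le: "holder_exponent H 0 \<le> ereal e" if e: "0 < e" for e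
      proof -
        have "0 \<in> approximable (s / e)" unfolding approximable_def
        proof (intro CollectI allI)
          fix Q
          show "\<exists>q\<ge>Q. \<exists>p::int. 1 \<le> q \<and> \<bar>0 - of_int p / real q\<bar> \<le> real q powr (- (s / e))"
            by (intro exI[of _ "Suc Q"] conjI exI[of _ 0]) auto
        qed
        from holder_exponent_H_le[OF this] show ?thesis using e s by simp
      qed
      have "holder_exponent H 0 \<le> 0" by (rule ereal_le_epsilon2) (use le in simp)
      hence "holder_exponent H 0 = 0" using holder_exponent_H_nonneg[of 0] by (rule antisym)
      hence "0 \<in> S" using True by (simp add: S_def flip: zero_ereal_def)
      thus False using S by simp
    next
      case False
      hence D: "0 < 2 * h / s" using h s by simp
      \<comment> \<open>For h > 0 an empty level set would have measure zero in dimension h / s,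
        below the bound 2 h / s proved in \<open>lower\<close>.\<close>
      have "hausdorff_measure (h / s) S \<le> 0"
      proof -
        have hs: "0 < h / s" using D by simp
        have "h \<noteq> 0" using False .
        hence "power_null (h / s) (approximable (3 / (h / s)))"
          using s by (intro power_null_approximable[OF hs]) simp
        hence "power_null (h / s) {}" by (rule power_null_subset) simp
        from hausdorff_measure_power_null[OF _ this] show ?thesis using S D by simp
      qed
      hence "2 * h / s \<le> h / s" using D by (intro lower) auto
      thus False using D by simp
    qed
  qed
  have "hausdorff_dim S = ereal (2 * h / s)"
    unfolding hausdorff_dim_def
  proof (rule antisym)
    show "Inf {ereal d |d. 0 \<le> d \<and> hausdorff_measure d S = 0} \<le> ereal (2 * h / s)"
    proof (rule ereal_le_epsilon2)
      fix \<epsilon> :: real assume \<epsilon>: "0 < \<epsilon>"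
      have "0 \<le> 2 * h / s" using h s by simp
      thus "Inf {ereal d |d. 0 \<le> d \<and> hausdorff_measure d S = 0} \<le> ereal (2 * h / s) + ereal \<epsilon>"
        using upper[of "2 * h / s + \<epsilon>"] \<epsilon> by (intro Inf_lower) auto
    qed
    show "ereal (2 * h / s) \<le> Inf {ereal d |d. 0 \<le> d \<and> hausdorff_measure d S = 0}"
      using lower by (intro Inf_greatest) auto
  qed
  thus ?thesis using ne unfolding singularity_spectrum_def S_def[symmetric] Let_def by simp
qed

end

section \<open>Integrals and scaling exponents\<close>

lemma integrable_one_plus_abs_powr:
  assumes "1 < \<gamma>"
  shows "integrable lebesgue (\<lambda>z::real. (1 + \<bar>z\<bar>) powr (-\<gamma>))"
proof -
  have "(\<lambda>x::real. x powr (-\<gamma>)) integrable_on {1..}"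
    using has_integral_powr_to_inf[of "-\<gamma>" 1] assms by (auto simp: integrable_on_def)
  hence "(\<lambda>x::real. x powr (-\<gamma>)) absolutely_integrable_on {1..}"
    by (rule nonnegative_absolutely_integrable_1) auto
  hence f: "integrable lebesgue (\<lambda>x::real. indicator {1..} x * x powr (-\<gamma>))" (is "integrable _ ?f")
    by (simp add: set_integrable_def)
  \<comment> \<open>The two copies of the tail of z^(-\<gamma>) from 1 on cover the two half-lines,
    by z -> 1 + z and z -> 1 - z.\<close>
  have g: "integrable lebesgue (\<lambda>x. ?f (1 + 1 * x) + ?f (1 + (-1) * x))"
    using f by (intro Bochner_Integration.integrable_add lebesgue_integrable_real_affine) auto
  show ?thesis
  proof (rule Bochner_Integration.integrable_bound[OF g])
    have "(\<lambda>z::real. (1 + \<bar>z\<bar>) powr (-\<gamma>)) \<in> borel_measurable lborel" by measurable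
    thus "(\<lambda>z::real. (1 + \<bar>z\<bar>) powr (-\<gamma>)) \<in> borel_measurable lebesgue" by (rule measurable_completion)
    show "AE z in lebesgue. norm ((1 + \<bar>z\<bar>) powr (-\<gamma>)) \<le> norm (?f (1 + 1 * z) + ?f (1 + (-1) * z))"
    proof (rule AE_I2)
      fix z :: real
      show "norm ((1 + \<bar>z\<bar>) powr (-\<gamma>)) \<le> norm (?f (1 + 1 * z) + ?f (1 + (-1) * z))"
        by (cases "0 \<le> z") (auto simp: indicator_def)
    qed
  qed
qed

lemma sigma_finite_lebesgue: "sigma_finite_measure (lebesgue :: 'a::euclidean_space measure)"
proof (rule sigma_finite_measure.intro)
  obtain A :: "'a set set" where A: "countable A" "A \<subseteq> sets lborel" "\<Union>A = space lborel" "\<forall>a\<in>A. emeasure lborel a \<noteq> \<infinity>"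
    using sigma_finite_measure.sigma_finite_countable[OF sigma_finite_lborel] by blast
  show "\<exists>A. countable A \<and> A \<subseteq> sets lebesgue \<and> \<Union>A = space (lebesgue :: 'a measure) \<and> (\<forall>a\<in>A. emeasure lebesgue a \<noteq> \<infinity>)"
    using A by (intro exI[of _ A]) auto
qed

text \<open>Half-lines generate the Borel sets: the measures with densities the positive and the
  negative part agree on half-lines, hence everywhere, so all integrals over Borel sets vanish. A
  Borel representative \<open>g\<close> replaces \<open>f\<close>, which is measurable only for the
  completed measure.\<close>

lemma AE_zero_of_integral_halflines_real:
  fixes f :: "real \<Rightarrow> real"
  assumes f: "integrable lebesgue f"
    and zero: "\<And>x. (LINT z|lebesgue. indicator {x<..} z * f z) = 0"
  shows "AE x in lebesgue. f x = 0"
proof -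
  obtain g where g[measurable]: "g \<in> borel_measurable lborel" and fg: "AE x in lborel. f x = g x"
    using completion_ex_borel_measurable_real[of f lborel] f by auto
  have fg': "AE x in lebesgue. f x = g x" using fg by (rule AE_completion)
  have gm: "g \<in> borel_measurable lebesgue" using g by (rule measurable_completion)
  have "integrable lebesgue g" using f integrable_cong_AE[OF borel_measurable_integrable[OF f] gm fg'] by simp
  hence gi: "integrable lborel g" using integrable_completion[OF g] by simp
  have g0: "(LINT z|lborel. indicator {x<..} z * g z) = 0" for x
  proof -
    have m: "(\<lambda>z. indicator {x<..} z * g z) \<in> borel_measurable lborel" by measurable
    have "(LINT z|lborel. indicator {x<..} z * g z) = (LINT z|lebesgue. indicator {x<..} z * g z)"
      using integral_completion[OF m] by simp
    also have "\<dots> = (LINT z|lebesgue. indicator {x<..} z * f z)"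
    proof (rule integral_cong_AE)
      show "(\<lambda>z. indicator {x<..} z * g z) \<in> borel_measurable lebesgue" by (rule measurable_completion[OF m])
      show "(\<lambda>z. indicator {x<..} z * f z) \<in> borel_measurable lebesgue"
        by (rule borel_measurable_times[OF borel_measurable_indicator borel_measurable_integrable[OF f]]) simp
      show "AE z in lebesgue. indicator {x<..} z * g z = indicator {x<..} z * f z"
        using fg' by eventually_elim simp
    qed
    finally show ?thesis using zero by simp
  qed
  have part: "(\<integral>\<^sup>+z. ennreal (h z) \<partial>lborel) = (\<integral>\<^sup>+z. ennreal (- h z) \<partial>lborel) \<longleftrightarrow> (LINT z|lborel. h z) = 0"
    and fin: "(\<integral>\<^sup>+z. ennreal (h z) \<partial>lborel) < \<infinity>"
    if h: "integrable lborel h" for h :: "real \<Rightarrow> real"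
  proof -
    have *: "(\<integral>\<^sup>+z. ennreal (h z) \<partial>lborel) < \<infinity>" if "integrable lborel h" for h :: "real \<Rightarrow> real"
    proof -
      have "(\<integral>\<^sup>+z. ennreal (h z) \<partial>lborel) \<le> (\<integral>\<^sup>+z. ennreal (norm (h z)) \<partial>lborel)"
        by (intro nn_integral_mono ennreal_leI) auto
      also have "\<dots> < \<infinity>" using that by (simp add: integrable_iff_bounded)
      finally show ?thesis .
    qed
    show "(\<integral>\<^sup>+z. ennreal (h z) \<partial>lborel) < \<infinity>" using *[OF h] .
    have 2: "(\<integral>\<^sup>+z. ennreal (- h z) \<partial>lborel) < \<infinity>" using *[of "\<lambda>z. - h z"] h by simp
    obtain a where a: "0 \<le> a" "(\<integral>\<^sup>+z. ennreal (h z) \<partial>lborel) = ennreal a"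
      using *[OF h] by (cases "\<integral>\<^sup>+z. ennreal (h z) \<partial>lborel") auto
    obtain b where b: "0 \<le> b" "(\<integral>\<^sup>+z. ennreal (- h z) \<partial>lborel) = ennreal b"
      using 2 by (cases "\<integral>\<^sup>+z. ennreal (- h z) \<partial>lborel") auto
    show "(\<integral>\<^sup>+z. ennreal (h z) \<partial>lborel) = (\<integral>\<^sup>+z. ennreal (- h z) \<partial>lborel) \<longleftrightarrow> (LINT z|lborel. h z) = 0"
      using a(1) b(1) unfolding real_lebesgue_integral_def[OF h] a(2) b(2) by simp
  qed
  have ind: "(\<integral>\<^sup>+z. ennreal (g' z) * indicator A z \<partial>lborel) = (\<integral>\<^sup>+z. ennreal (indicator A z * g' z) \<partial>lborel)" for g' :: "real \<Rightarrow> real" and A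
    by (intro nn_integral_cong) (auto simp: indicator_def)
  have gA: "integrable lborel (\<lambda>z. indicator A z * g z)" if "A \<in> sets borel" for A
    using integrable_mult_indicator[OF _ gi, of A] that by simp
  \<comment> \<open>\<open>ennreal\<close> sends negative numbers to 0, so these densities are the
    positive and negative parts of \<open>g\<close>.\<close>
  have eq: "density lborel (\<lambda>z. ennreal (g z)) = density lborel (\<lambda>z. ennreal (- g z))"
  proof (rule measure_eqI_lessThan)
    fix x :: real
    have i: "integrable lborel (\<lambda>z. indicator {x<..} z * g z)" by (rule gA) simp
    show "emeasure (density lborel (\<lambda>z. ennreal (g z))) {x<..} < \<infinity>"
      using fin[OF i] by (subst emeasure_density) (auto simp: ind)
    show "emeasure (density lborel (\<lambda>z. ennreal (g z))) {x<..} = emeasure (density lborel (\<lambda>z. ennreal (- g z))) {x<..}"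
      using part[OF i] g0[of x] by (subst (1 2) emeasure_density) (auto simp: ind)
  qed auto
  have "AE x in lborel. g x = 0"
  proof (rule sigma_finite_measure.density_zero[OF sigma_finite_lborel gi])
    fix A assume A: "A \<in> sets (lborel :: real measure)"
    hence i: "integrable lborel (\<lambda>z. indicator A z * g z)" by (intro gA) simp
    have "emeasure (density lborel (\<lambda>z. ennreal (g z))) A = emeasure (density lborel (\<lambda>z. ennreal (- g z))) A"
      unfolding eq ..
    hence "(\<integral>\<^sup>+z. ennreal (indicator A z * g z) \<partial>lborel) = (\<integral>\<^sup>+z. ennreal (- (indicator A z * g z)) \<partial>lborel)"
      using A by (subst (asm) (1 2) emeasure_density) (auto simp: ind)
    thus "set_lebesgue_integral lborel A g = 0" using part[OF i] by (simp add: set_lebesgue_integral_def)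
  qed
  hence "AE x in lebesgue. g x = 0" by (rule AE_completion)
  thus ?thesis using fg' by eventually_elim simp
qed

text \<open>Mean zero exchanges \<open>{..x}\<close> for \<open>{x<..}\<close>; then the real and
  imaginary parts are treated separately.\<close>

lemma AE_zero_of_integral_halflines:
  fixes f :: "real \<Rightarrow> complex"
  assumes f: "integrable lebesgue f" and mean: "(LINT z|lebesgue. f z) = 0"
    and zero: "\<And>x. (LINT z|lebesgue. indicator {..x} z *\<^sub>R f z) = 0"
  shows "AE x in lebesgue. f x = 0"
proof -
  have i: "integrable lebesgue (\<lambda>z. indicator A z *\<^sub>R f z)" if "A \<in> sets borel" for A
    using that f by (intro integrable_mult_indicator) auto
  have z: "(LINT z|lebesgue. indicator {x<..} z *\<^sub>R f z) = 0" for x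
  proof -
    have "(LINT z|lebesgue. indicator {x<..} z *\<^sub>R f z) = (LINT z|lebesgue. f z - indicator {..x} z *\<^sub>R f z)"
      by (intro Bochner_Integration.integral_cong) (auto simp: indicator_def)
    also have "\<dots> = 0" using i f by (subst Bochner_Integration.integral_diff) (auto simp: mean zero)
    finally show ?thesis .
  qed
  have "AE x in lebesgue. Re (f x) = 0"
  proof (rule AE_zero_of_integral_halflines_real)
    fix x :: real
    have "(LINT z|lebesgue. indicator {x<..} z * Re (f z)) = (LINT z|lebesgue. Re (indicator {x<..} z *\<^sub>R f z))" by simp
    also have "\<dots> = Re (LINT z|lebesgue. indicator {x<..} z *\<^sub>R f z)" by (rule integral_Re[OF i]) simp
    finally show "(LINT z|lebesgue. indicator {x<..} z * Re (f z)) = 0" by (simp add: z)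
  qed (use f in simp)
  moreover have "AE x in lebesgue. Im (f x) = 0"
  proof (rule AE_zero_of_integral_halflines_real)
    fix x :: real
    have "(LINT z|lebesgue. indicator {x<..} z * Im (f z)) = (LINT z|lebesgue. Im (indicator {x<..} z *\<^sub>R f z))" by simp
    also have "\<dots> = Im (LINT z|lebesgue. indicator {x<..} z *\<^sub>R f z)" by (rule integral_Im[OF i]) simp
    finally show "(LINT z|lebesgue. indicator {x<..} z * Im (f z)) = 0" by (simp add: z)
  qed (use f in simp)
  ultimately show ?thesis by eventually_elim (simp add: complex_eq_iff)
qed

section \<open>From power bounds on norms to scaling exponents\<close>

lemma convol_dilate:
  assumes N: "0 < N"
  shows "convol (dilate N \<psi>) f x = (LINT z|lebesgue. \<psi> z * of_real (f (x - z / N)))"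
proof -
  have "(LINT z|lebesgue. \<psi> z * of_real (f (x - z / N))) =
      \<bar>N\<bar> *\<^sub>R (LINT y|lebesgue. \<psi> (0 + N * y) * of_real (f (x - (0 + N * y) / N)))"
    using N by (intro lebesgue_integral_real_affine) auto
  also have "\<dots> = (LINT y|lebesgue. of_real N * (\<psi> (N * y) * of_real (f (x - y))))"
    using N by (simp add: scaleR_conv_of_real)
  finally show ?thesis by (simp add: convol_def dilate_def mult.assoc)
qed

lemma ln_ennreal_ge:
  assumes "0 < c" "ennreal c \<le> L"
  shows "ereal (ln c) \<le> ln_ennreal L"
proof (cases "L = top")
  case False
  then obtain l where l: "0 \<le> l" "L = ennreal l" by (cases L) auto
  hence "c \<le> l" using assms by (simp add: ennreal_le_iff)
  thus ?thesis using l assms by (auto simp: ln_ennreal_def)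
qed (simp add: ln_ennreal_def)

lemma ln_ennreal_le:
  assumes "0 < c" "L \<le> ennreal c"
  shows "ln_ennreal L \<le> ereal (ln c)"
proof (cases "L = 0")
  case False
  have "L \<noteq> top" using assms by (auto simp: top_unique)
  then obtain l where l: "0 \<le> l" "L = ennreal l" by (cases L) auto
  hence "0 < l" using False by (cases "l = 0") auto
  moreover have "l \<le> c" using assms l by (simp add: ennreal_le_iff)
  ultimately show ?thesis using l by (auto simp: ln_ennreal_def)
qed (simp add: ln_ennreal_def)

lemma Liminf_log_quotient:
  assumes "0 < c"
  shows "Liminf at_top (\<lambda>N::real. ereal (ln (c * N powr (-a))) / ereal (ln N)) = ereal (- a)"
proof (rule lim_imp_Liminf)
  have "((\<lambda>N::real. ln c / ln N - a) \<longlongrightarrow> - a) at_top" by real_asymp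
  hence "((\<lambda>N::real. ereal (ln c / ln N - a)) \<longlongrightarrow> ereal (- a)) at_top" by simp
  moreover have "\<forall>\<^sub>F N::real in at_top. ereal (ln c / ln N - a) = ereal (ln (c * N powr (-a))) / ereal (ln N)"
    using eventually_gt_at_top[of 1]
  proof eventually_elim
    case (elim N)
    have "ln (c * N powr (-a)) = ln c - a * ln N" using assms elim by (simp add: ln_mult ln_powr)
    thus ?case using elim by (simp add: diff_divide_distrib)
  qed
  ultimately show "((\<lambda>N::real. ereal (ln (c * N powr (-a))) / ereal (ln N)) \<longlongrightarrow> ereal (- a)) at_top"
    by (rule Lim_transform_eventually)
qed simp

lemma scaling_exponent_le:
  assumes c: "0 < c"
    and "\<forall>\<^sub>F N in at_top. ennreal (c * N powr (-a)) \<le> Lp_power p (convol (dilate N \<psi>) f)"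
  shows "scaling_exponent \<psi> f p \<le> ereal a"
proof -
  have "ereal (- a) = Liminf at_top (\<lambda>N::real. ereal (ln (c * N powr (-a))) / ereal (ln N))"
    using Liminf_log_quotient[OF c] by simp
  also have "\<dots> \<le> Liminf at_top (\<lambda>N. ln_ennreal (Lp_power p (convol (dilate N \<psi>) f)) / ereal (ln N))"
  proof (rule Liminf_mono)
    show "\<forall>\<^sub>F N in at_top. ereal (ln (c * N powr (-a))) / ereal (ln N) \<le> ln_ennreal (Lp_power p (convol (dilate N \<psi>) f)) / ereal (ln N)"
      using assms(2) eventually_gt_at_top[of 1]
    proof eventually_elim
      case (elim N)
      show ?case
      proof (rule ereal_divide_right_mono[OF ln_ennreal_ge])
        show "0 < c * N powr (-a)" using c elim by simp
      qed (use elim in simp_all)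
    qed
  qed
  finally show ?thesis unfolding scaling_exponent_def by (simp add: ereal_uminus_le_reorder)
qed

lemma scaling_exponent_ge:
  assumes c: "0 < c"
    and "\<forall>\<^sub>F N in at_top. Lp_power p (convol (dilate N \<psi>) f) \<le> ennreal (c * N powr (-a))"
  shows "ereal a \<le> scaling_exponent \<psi> f p"
proof -
  have "Liminf at_top (\<lambda>N. ln_ennreal (Lp_power p (convol (dilate N \<psi>) f)) / ereal (ln N)) \<le>
      Liminf at_top (\<lambda>N::real. ereal (ln (c * N powr (-a))) / ereal (ln N))"
  proof (rule Liminf_mono)
    show "\<forall>\<^sub>F N in at_top. ln_ennreal (Lp_power p (convol (dilate N \<psi>) f)) / ereal (ln N) \<le> ereal (ln (c * N powr (-a))) / ereal (ln N)"
      using assms(2) eventually_gt_at_top[of 1]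
    proof eventually_elim
      case (elim N)
      show ?case
      proof (rule ereal_divide_right_mono[OF ln_ennreal_le])
        show "0 < c * N powr (-a)" using c elim by simp
      qed (use elim in simp_all)
    qed
  qed
  also have "\<dots> = ereal (- a)" by (rule Liminf_log_quotient[OF c])
  finally have "- ereal (- a) \<le> scaling_exponent \<psi> f p"
    unfolding scaling_exponent_def by (simp only: ereal_minus_le_minus)
  thus ?thesis by simp
qed

text \<open>After division by a + b both terms lie in [0, 1], where x <= x^p.\<close>

lemma powr_add_subadditive:
  fixes a b p :: real
  assumes "0 \<le> a" "0 \<le> b" "0 < p" "p \<le> 1"
  shows "(a + b) powr p \<le> a powr p + b powr p"
proof (cases "a + b = 0")
  case False
  hence S: "0 < a + b" using assms by simp
  have *: "x / (a + b) \<le> (x / (a + b)) powr p" if "0 \<le> x" "x \<le> a + b" for x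
    using powr_mono'[of p 1 "x / (a + b)"] that S assms by simp
  have "1 = a / (a + b) + b / (a + b)" using S by (simp add: add_divide_distrib[symmetric])
  also have "\<dots> \<le> (a / (a + b)) powr p + (b / (a + b)) powr p" using * assms by (intro add_mono) auto
  also have "\<dots> = (a powr p + b powr p) / (a + b) powr p"
    using assms S by (simp add: powr_divide add_divide_distrib)
  finally show ?thesis using S by (simp add: field_simps)
qed (use assms in simp)

lemma powr_sum_subadditive:
  fixes f :: "'i \<Rightarrow> real"
  assumes "finite F" "\<And>i. i \<in> F \<Longrightarrow> 0 \<le> f i" "0 < p" "p \<le> 1"
  shows "(\<Sum>i\<in>F. f i) powr p \<le> (\<Sum>i\<in>F. f i powr p)"
  using assms(1,2)
proof (induction F rule: finite_induct)
  case (insert i F)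
  have "(f i + sum f F) powr p \<le> f i powr p + sum f F powr p"
    using insert assms by (intro powr_add_subadditive sum_nonneg) auto
  also have "\<dots> \<le> f i powr p + (\<Sum>i\<in>F. f i powr p)" using insert by simp
  finally show ?case using insert by simp
qed simp

section \<open>The wavelet transform\<close>

locale wavelet = jump_function +
  fixes \<psi> :: "real \<Rightarrow> complex" and C \<beta> :: real
  assumes psi_integrable: "integrable lebesgue \<psi>"
    and psi_nonzero: "\<not> (AE x in lebesgue. \<psi> x = 0)"
    and psi_mean: "(LINT x|lebesgue. \<psi> x) = 0"
    and C_pos: "C > 0" and beta: "\<beta> > 1 + s"
    and psi_decay: "\<And>x. x \<noteq> 0 \<Longrightarrow> norm (\<psi> x) \<le> C * \<bar>x\<bar> powr (- \<beta>)"
begin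

definition psi_moment :: real where
  "psi_moment = (LINT z|lebesgue. (1 + \<bar>z\<bar>) powr s * norm (\<psi> z))"

lemma psi_measurable: "\<psi> \<in> borel_measurable lebesgue"
  using psi_integrable by (rule borel_measurable_integrable)

lemma borel_measurable_lebesgue_of_borel:
  fixes g :: "real \<Rightarrow> 'b::topological_space"
  assumes "g \<in> borel_measurable borel"
  shows "g \<in> borel_measurable lebesgue"
  by (rule measurable_completion) (use assms in simp)

text \<open>Near 0 the pointwise bound blows up, so integrability of \<psi> is used there, with
  weight at most 2^s. Away from 0 one has |z| >= (1 + |z|) / 2, whence the factor 2^\<beta>, and
  \<beta> - s > 1.\<close>

lemma integrable_psi_moment: "integrable lebesgue (\<lambda>z. (1 + \<bar>z\<bar>) powr s * norm (\<psi> z))"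
proof (rule Bochner_Integration.integrable_bound)
  show "integrable lebesgue (\<lambda>z. 2 powr s * norm (\<psi> z) + 2 powr \<beta> * C * (1 + \<bar>z\<bar>) powr (-(\<beta> - s)))"
    using psi_integrable beta by (intro Bochner_Integration.integrable_add integrable_mult_right
        integrable_norm integrable_one_plus_abs_powr) auto
  have "(\<lambda>z::real. (1 + \<bar>z\<bar>) powr s) \<in> borel_measurable lebesgue"
    by (rule borel_measurable_lebesgue_of_borel) measurable
  thus "(\<lambda>z. (1 + \<bar>z\<bar>) powr s * norm (\<psi> z)) \<in> borel_measurable lebesgue"
    by (intro borel_measurable_times borel_measurable_integrable[OF integrable_norm[OF psi_integrable]])
  have dom: "(1 + \<bar>z\<bar>) powr s * norm (\<psi> z) \<le> 2 powr s * norm (\<psi> z) + 2 powr \<beta> * C * (1 + \<bar>z\<bar>) powr (-(\<beta> - s))" for z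
  proof (cases "\<bar>z\<bar> \<le> 1")
    case True
    have "(1 + \<bar>z\<bar>) powr s * norm (\<psi> z) \<le> 2 powr s * norm (\<psi> z)"
      using True s_bounds by (intro mult_right_mono powr_mono2) auto
    thus ?thesis using C_pos by (simp add: add_increasing2)
  next
    case False
    have "norm (\<psi> z) \<le> C * \<bar>z\<bar> powr (-\<beta>)" using False by (intro psi_decay) auto
    also have "\<bar>z\<bar> powr (-\<beta>) \<le> ((1 + \<bar>z\<bar>) / 2) powr (-\<beta>)"
      using False beta s_bounds by (intro powr_mono2') auto
    also have "\<dots> = 2 powr \<beta> * (1 + \<bar>z\<bar>) powr (-\<beta>)"
      by (simp add: powr_divide powr_minus_divide)
    finally have "(1 + \<bar>z\<bar>) powr s * norm (\<psi> z) \<le> (1 + \<bar>z\<bar>) powr s * (C * (2 powr \<beta> * (1 + \<bar>z\<bar>) powr (-\<beta>)))"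
      using C_pos by (intro mult_left_mono) auto
    also have "\<dots> = 2 powr \<beta> * C * ((1 + \<bar>z\<bar>) powr s * (1 + \<bar>z\<bar>) powr (-\<beta>))" by simp
    also have "(1 + \<bar>z\<bar>) powr s * (1 + \<bar>z\<bar>) powr (-\<beta>) = (1 + \<bar>z\<bar>) powr (-(\<beta> - s))"
      by (simp add: powr_add[symmetric])
    finally show ?thesis by (simp add: add_increasing)
  qed
  show "AE z in lebesgue. norm ((1 + \<bar>z\<bar>) powr s * norm (\<psi> z)) \<le>
      norm (2 powr s * norm (\<psi> z) + 2 powr \<beta> * C * (1 + \<bar>z\<bar>) powr (-(\<beta> - s)))"
  proof (rule AE_I2)
    fix z :: real
    have "norm ((1 + \<bar>z\<bar>) powr s * norm (\<psi> z)) = (1 + \<bar>z\<bar>) powr s * norm (\<psi> z)" by simp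
    also note dom
    also have "2 powr s * norm (\<psi> z) + 2 powr \<beta> * C * (1 + \<bar>z\<bar>) powr (-(\<beta> - s)) \<le>
      norm (2 powr s * norm (\<psi> z) + 2 powr \<beta> * C * (1 + \<bar>z\<bar>) powr (-(\<beta> - s)))"
      unfolding real_norm_def by (rule abs_ge_self)
    finally show "norm ((1 + \<bar>z\<bar>) powr s * norm (\<psi> z)) \<le>
      norm (2 powr s * norm (\<psi> z) + 2 powr \<beta> * C * (1 + \<bar>z\<bar>) powr (-(\<beta> - s)))" .
  qed
qed

lemma psi_moment_nonneg: "0 \<le> psi_moment"
  unfolding psi_moment_def by (intro Bochner_Integration.integral_nonneg) auto

lemma psi_integral_bound:
  fixes g :: "real \<Rightarrow> real"
  assumes g: "g \<in> borel_measurable borel" and bound: "\<And>z. \<bar>g z\<bar> \<le> K * (1 + \<bar>z\<bar>) powr s"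
  shows "integrable lebesgue (\<lambda>z. \<psi> z * of_real (g z))"
    "norm (LINT z|lebesgue. \<psi> z * of_real (g z)) \<le> K * psi_moment"
proof -
  have i: "integrable lebesgue (\<lambda>z. K * ((1 + \<bar>z\<bar>) powr s * norm (\<psi> z)))"
    using integrable_psi_moment by simp
  have n: "norm (\<psi> z * of_real (g z)) \<le> K * ((1 + \<bar>z\<bar>) powr s * norm (\<psi> z))" for z
  proof -
    have "norm (\<psi> z) * \<bar>g z\<bar> \<le> norm (\<psi> z) * (K * (1 + \<bar>z\<bar>) powr s)"
      by (intro mult_left_mono bound) auto
    thus ?thesis by (simp add: norm_mult algebra_simps)
  qed
  have "(\<lambda>z. of_real (g z) :: complex) \<in> borel_measurable lebesgue"
    by (rule borel_measurable_lebesgue_of_borel) (use g in measurable)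
  hence m: "(\<lambda>z. \<psi> z * of_real (g z)) \<in> borel_measurable lebesgue"
    using psi_measurable by (intro borel_measurable_times)
  show int: "integrable lebesgue (\<lambda>z. \<psi> z * of_real (g z))"
  proof (rule Bochner_Integration.integrable_bound[OF i m], rule AE_I2)
    fix z show "norm (\<psi> z * of_real (g z)) \<le> norm (K * ((1 + \<bar>z\<bar>) powr s * norm (\<psi> z)))"
      using n[of z] abs_ge_self[of "K * ((1 + \<bar>z\<bar>) powr s * norm (\<psi> z))"] unfolding real_norm_def by linarith
  qed
  have "norm (LINT z|lebesgue. \<psi> z * of_real (g z)) \<le> (LINT z|lebesgue. K * ((1 + \<bar>z\<bar>) powr s * norm (\<psi> z)))"
    by (rule Bochner_Integration.integral_norm_bound_integral[OF int i]) (rule n)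
  thus "norm (LINT z|lebesgue. \<psi> z * of_real (g z)) \<le> K * psi_moment"
    by (simp add: psi_moment_def)
qed

text \<open>The convolution after the substitution z = N y, which leaves \<psi> fixed and puts the
  scale into \<open>H\<close>.\<close>

definition wave :: "real \<Rightarrow> real \<Rightarrow> complex" where
  "wave N x = (LINT z|lebesgue. \<psi> z * of_real (H (x - z / N)))"

lemma one_le_weight: "1 \<le> (1 + \<bar>z\<bar>) powr s"
  using s_bounds by (intro ge_one_powr_ge_zero) auto

lemma weight_ge: "1 + \<bar>z\<bar> \<le> (1 + \<bar>z\<bar>) powr s"
  using powr_mono[of 1 s "1 + \<bar>z\<bar>"] s_bounds by simp

text \<open>Mean zero kills the constant k, a step of height m at y contributes m times the
  primitive of \<psi> at y, and the remainder is paid for by the weighted moment.\<close>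

lemma wave_decompose:
  fixes E :: "real \<Rightarrow> real" and k m y :: real
  assumes N: "0 < N"
    and E: "\<And>z. \<bar>E z\<bar> \<le> K * (1 + \<bar>z\<bar>) powr s"
    and H: "\<And>z. H (x - z / N) = k + m * indicator {..y} z + E z"
  shows "norm (wave N x - of_real m * (LINT z|lebesgue. indicator {..y} z *\<^sub>R \<psi> z)) \<le> K * psi_moment"
proof -
  have Eeq: "E = (\<lambda>z. H (x - z / N) - k - m * indicator {..y} z)" using H by (auto simp: fun_eq_iff)
  have Em: "E \<in> borel_measurable borel" unfolding Eeq by measurable
  note b = psi_integral_bound[OF Em E]
  have i: "integrable lebesgue (\<lambda>z. indicator {..y} z *\<^sub>R \<psi> z)"
    by (rule integrable_mult_indicator[OF _ psi_integrable]) simp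
  have i1: "integrable lebesgue (\<lambda>z. of_real k * \<psi> z)" using psi_integrable by simp
  have i2: "integrable lebesgue (\<lambda>z. of_real m * (indicator {..y} z *\<^sub>R \<psi> z))"
    using i by (rule integrable_mult_right)
  have "wave N x = (LINT z|lebesgue. of_real k * \<psi> z + of_real m * (indicator {..y} z *\<^sub>R \<psi> z) + \<psi> z * of_real (E z))"
    unfolding wave_def H by (intro Bochner_Integration.integral_cong) (auto simp: indicator_def algebra_simps)
  also have "\<dots> = (LINT z|lebesgue. of_real k * \<psi> z) + (LINT z|lebesgue. of_real m * (indicator {..y} z *\<^sub>R \<psi> z))
      + (LINT z|lebesgue. \<psi> z * of_real (E z))"
    unfolding Bochner_Integration.integral_add[OF Bochner_Integration.integrable_add[OF i1 i2] b(1)]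
      Bochner_Integration.integral_add[OF i1 i2] ..
  also have "\<dots> = of_real m * (LINT z|lebesgue. indicator {..y} z *\<^sub>R \<psi> z) + (LINT z|lebesgue. \<psi> z * of_real (E z))"
    unfolding integral_mult_right_zero psi_mean by simp
  finally show ?thesis using b(2) by simp
qed

text \<open>A primitive vanishing everywhere would make \<psi> zero almost everywhere; continuity
  spreads one nonzero value to an interval, which gives the set of good points positive
  length.\<close>

lemma primitive_nonzero:
  obtains a b \<kappa> :: real where "a < b" "0 < \<kappa>"
    "\<And>y. a \<le> y \<Longrightarrow> y \<le> b \<Longrightarrow> \<kappa> \<le> norm (LINT z|lebesgue. indicator {..y} z *\<^sub>R \<psi> z)"
proof -
  let ?P = "\<lambda>y. LINT z|lebesgue. indicator {..y} z *\<^sub>R \<psi> z"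
  obtain a where a: "?P a \<noteq> 0"
    using AE_zero_of_integral_halflines[OF psi_integrable psi_mean] psi_nonzero by blast
  define \<kappa> where "\<kappa> = norm (?P a) / 2"
  have \<kappa>: "0 < \<kappa>" "\<kappa> < norm (?P a)" using a by (auto simp: \<kappa>_def)
  have "\<exists>n::nat. \<forall>y. a \<le> y \<longrightarrow> y \<le> a + 1 / real (Suc n) \<longrightarrow> \<kappa> \<le> norm (?P y)"
  proof (rule ccontr)
    assume "\<not> ?thesis"
    hence "\<forall>n::nat. \<exists>y. a \<le> y \<and> y \<le> a + 1 / real (Suc n) \<and> norm (?P y) < \<kappa>" by (force simp: not_le)
    then obtain y where y: "\<And>n. a \<le> y n" "\<And>n. y n \<le> a + 1 / real (Suc n)" "\<And>n. norm (?P (y n)) < \<kappa>"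
      by metis
    have "(\<lambda>n. a + 1 / real (Suc n)) \<longlonglongrightarrow> a + 0" by (intro tendsto_intros LIMSEQ_Suc[OF lim_1_over_n])
    hence ylim: "y \<longlonglongrightarrow> a" using y(1,2)
      by (intro tendsto_sandwich[where f="\<lambda>_. a" and g="y" and h="\<lambda>n. a + 1 / real (Suc n)"]) auto
    have "(\<lambda>n. ?P (y n)) \<longlonglongrightarrow> ?P a"
    proof (rule integral_dominated_convergence[where w="\<lambda>z. norm (\<psi> z)"])
      \<comment> \<open>As the \<open>y n\<close> approach a from the right, the indicators converge
        at every z, including z = a.\<close>
      show "AE z in lebesgue. (\<lambda>n. indicator {..y n} z *\<^sub>R \<psi> z) \<longlonglongrightarrow> indicator {..a} z *\<^sub>R \<psi> z"
      proof (rule AE_I2)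
        fix z :: real
        have "\<forall>\<^sub>F n in sequentially. indicator {..y n} z *\<^sub>R \<psi> z = indicator {..a} z *\<^sub>R \<psi> z"
        proof (cases "z \<le> a")
          case True
          hence "z \<le> y n" for n using y(1)[of n] by linarith
          thus ?thesis using True by simp
        next
          case False
          hence "\<forall>\<^sub>F n in sequentially. y n < z" using ylim by (intro order_tendstoD(2)) auto
          thus ?thesis by eventually_elim (use False in simp)
        qed
        thus "(\<lambda>n. indicator {..y n} z *\<^sub>R \<psi> z) \<longlonglongrightarrow> indicator {..a} z *\<^sub>R \<psi> z"
          by (rule tendsto_eventually)
      qed
      show "(\<lambda>z. indicator {..x} z *\<^sub>R \<psi> z) \<in> borel_measurable lebesgue" for x :: real
        using integrable_mult_indicator[OF _ psi_integrable, of "{..x}"] by (intro borel_measurable_integrable) auto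
      thus "(\<lambda>z. indicator {..y n} z *\<^sub>R \<psi> z) \<in> borel_measurable lebesgue" for n .
      show "AE z in lebesgue. norm (indicator {..y n} z *\<^sub>R \<psi> z) \<le> norm (\<psi> z)" for n
        by (intro AE_I2) (auto simp: indicator_def)
    qed (use psi_integrable in simp)
    hence "(\<lambda>n. norm (?P (y n))) \<longlonglongrightarrow> norm (?P a)" by (rule tendsto_norm)
    hence "norm (?P a) \<le> \<kappa>" using y(3) by (intro LIMSEQ_le_const2) (auto intro: less_imp_le)
    thus False using \<kappa> by simp
  qed
  then obtain n where "\<forall>y. a \<le> y \<longrightarrow> y \<le> a + 1 / real (Suc n) \<longrightarrow> \<kappa> \<le> norm (?P y)" by blast
  thus ?thesis using \<kappa> by (intro that[of a "a + 1 / real (Suc n)" \<kappa>]) auto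
qed

text \<open>At x = p / q + y / N the jump at p / q sits at z = y in the integration variable. It
  contributes at least 2 c q^(-s); all other jumps together contribute at most B q^(-s) \<theta>
  with \<theta> = q^2 / N, which is made at most c q^(-s).\<close>

lemma wave_near_fraction:
  obtains a b c \<rho> :: real where "a < b" "0 < c" "0 < \<rho>" "\<rho> \<le> 1" "\<rho> * (b - a) \<le> 1 / 4"
    "\<And>N i y. 1 \<le> N \<Longrightarrow> i \<in> reduced_pairs \<Longrightarrow> (den i)\<^sup>2 \<le> \<rho> * N \<Longrightarrow> a \<le> y \<Longrightarrow> y \<le> b \<Longrightarrow>
      c * den i powr (-s) \<le> norm (wave N (frac_val i + y / N))"
proof -
  obtain a b \<kappa> where ab: "a < b" "0 < \<kappa>"
    "\<And>y. a \<le> y \<Longrightarrow> y \<le> b \<Longrightarrow> \<kappa> \<le> norm (LINT z|lebesgue. indicator {..y} z *\<^sub>R \<psi> z)"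
    using primitive_nonzero by blast
  \<comment> \<open>Chosen so that |y - z| <= Y (1 + |z|) for every y between a and b.\<close>
  define Y where "Y = 1 + \<bar>a\<bar> + \<bar>b\<bar>"
  have Y: "1 \<le> Y" by (simp add: Y_def)
  define B where "B = 2 * hp_const * Y powr s * (psi_moment + 1)"
  have B: "0 < B" using hp_const_pos Y psi_moment_nonneg by (auto simp: B_def intro!: mult_pos_pos)
  define c where "c = mass_const * \<kappa> / 2"
  have c: "0 < c" using mass_const_pos ab by (simp add: c_def)
  \<comment> \<open>The bound 1 keeps \<theta> <= 1, the second later keeps the windows of different
    fractions disjoint, and c / B makes the error half of the main term.\<close>
  define \<rho> where "\<rho> = min 1 (min (1 / (4 * (b - a))) (c / B))"
  have \<rho>: "0 < \<rho>" "\<rho> \<le> 1" "\<rho> \<le> 1 / (4 * (b - a))" "\<rho> \<le> c / B" using ab c B by (auto simp: \<rho>_def)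
  show ?thesis
  proof (rule that[OF ab(1) c \<rho>(1,2)])
    show "\<rho> * (b - a) \<le> 1 / 4" using \<rho>(3) ab(1) by (simp add: field_simps)
    fix N y :: real and i assume N: "1 \<le> N" and i: "i \<in> reduced_pairs" and qN: "(den i)\<^sup>2 \<le> \<rho> * N"
      and y: "a \<le> y" "y \<le> b"
    define q where "q = real (snd i)"
    have q: "1 \<le> q" using i by (auto simp: q_def reduced_pairs_def)
    define r where "r = frac_val i"
    define \<theta> where "\<theta> = q\<^sup>2 / N"
    have \<theta>: "0 < \<theta>" "\<theta> \<le> \<rho>" using q N qN by (auto simp: \<theta>_def q_def field_simps)
    \<comment> \<open>\<open>H r - mass i\<close> is the left limit at r. The argument of
      \<open>H\<close> is at least r exactly when z <= y, and then the jump is added.\<close>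
    let ?E = "\<lambda>z. H (r + y / N - z / N) - (H r - mass i) - mass i * indicator {..y} z"
    have Ebound: "\<bar>?E z\<bar> \<le> (2 * hp_const * Y powr s * q powr (-s) * \<theta>) * (1 + \<bar>z\<bar>) powr s" for z
    proof -
      define W where "W = Y * (1 + \<bar>z\<bar>)"
      have W: "1 \<le> W" using Y mult_mono[of 1 Y 1 "1 + \<bar>z\<bar>"] by (simp add: W_def)
      define u where "u = W / N"
      have u: "0 < u" using W N by (simp add: u_def)
      define v where "v = r + y / N - z / N"
      have vr: "v = r + (y - z) / N" by (simp add: v_def diff_divide_distrib)
      have "\<bar>y - z\<bar> \<le> W"
      proof -
        have "\<bar>y\<bar> \<le> \<bar>a\<bar> + \<bar>b\<bar>" using y by linarith
        moreover have "Y + \<bar>z\<bar> \<le> W" using Y mult_right_mono[of 1 Y "\<bar>z\<bar>"] by (simp add: W_def algebra_simps)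
        ultimately show ?thesis by (simp add: Y_def)
      qed
      hence vu: "\<bar>v - r\<bar> \<le> u" using N by (simp add: vr u_def abs_divide divide_right_mono)
      have qu: "(q * u) powr a = W powr a * q powr (-a) * \<theta> powr a" for a
      proof -
        have "q * u = W * inverse q * \<theta>" using q by (simp add: u_def \<theta>_def power2_eq_square)
        hence "(q * u) powr a = (W * inverse q * \<theta>) powr a" by simp
        also have "\<dots> = W powr a * inverse q powr a * \<theta> powr a"
          using W q \<theta> by (simp add: powr_mult)
        also have "inverse q powr a = q powr (-a)" using q by (simp add: inverse_powr powr_minus)
        finally show ?thesis .
      qed
      have sub: "{r<..v} \<subseteq> cball (frac_val i) u" "{v<..r} \<subseteq> cball (frac_val i) u"
      proof -
        have "w \<in> cball r u" if "w \<in> {r<..v} \<union> {v<..r}" for w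
        proof -
          have "\<bar>r - w\<bar> \<le> \<bar>v - r\<bar>" using that by auto
          thus ?thesis using vu by (simp add: dist_real_def)
        qed
        thus "{r<..v} \<subseteq> cball (frac_val i) u" "{v<..r} \<subseteq> cball (frac_val i) u" unfolding r_def by blast+
      qed
      have "\<bar>?E z\<bar> \<le> hp_const * ((q * u) powr s + u * (q * u) powr (s - 2))"
      proof (cases "r \<le> v")
        case True
        hence "z \<le> y" using N by (simp add: vr zero_le_divide_iff)
        hence "?E z = H v - H r" by (simp add: v_def)
        also have "\<dots> = hp \<delta> {r<..v} - mass i * indicator {r<..v} (frac_val i)"
          using H_diff[OF True] by (simp add: r_def)
        finally have "\<bar>?E z\<bar> = \<bar>hp \<delta> {r<..v} - mass i * indicator {r<..v} (frac_val i)\<bar>" by simp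
        moreover have "\<bar>hp \<delta> {r<..v} - mass i * indicator {r<..v} (frac_val i)\<bar> \<le> hp_const * ((q * u) powr s + u * (q * u) powr (s - 2))"
          unfolding q_def by (rule hp_near_frac[OF i u]) (use sub in auto)
        ultimately show ?thesis by simp
      next
        case False
        hence "\<not> z \<le> y" using N by (simp add: vr zero_le_divide_iff)
        hence "?E z = - (H r - H v - mass i)" by (simp add: v_def)
        also have "\<dots> = - (hp \<delta> {v<..r} - mass i * indicator {v<..r} (frac_val i))"
          using H_diff[of v r] False by (simp add: r_def)
        finally have "\<bar>?E z\<bar> = \<bar>hp \<delta> {v<..r} - mass i * indicator {v<..r} (frac_val i)\<bar>" by simp
        moreover have "\<bar>hp \<delta> {v<..r} - mass i * indicator {v<..r} (frac_val i)\<bar> \<le> hp_const * ((q * u) powr s + u * (q * u) powr (s - 2))"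
          unfolding q_def by (rule hp_near_frac[OF i u]) (use sub in auto)
        ultimately show ?thesis by simp
      qed
      also note qu[of s]
      also note qu[of "s - 2"]
      also have "u * (W powr (s - 2) * q powr (-(s - 2)) * \<theta> powr (s - 2)) = W powr (s - 1) * q powr (-s) * \<theta> powr (s - 1)"
      proof -
        have "u = W powr 1 * q powr (-2) * \<theta> powr 1"
          using N W q \<theta> by (simp add: u_def \<theta>_def powr_minus powr_numeral field_simps)
        hence "u * (W powr (s - 2) * q powr (-(s - 2)) * \<theta> powr (s - 2)) = (W powr 1 * W powr (s - 2)) * (q powr (-2) * q powr (-(s - 2))) * (\<theta> powr 1 * \<theta> powr (s - 2))"
          by (simp only: mult_ac)
        moreover have "1 + (s - 2) = s - 1" "- 2 + - (s - 2) = - s" by auto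
        ultimately show ?thesis unfolding powr_add[symmetric] by simp
      qed
      \<comment> \<open>Both \<theta>^s and \<theta>^(s-1) are at most \<theta>, because \<theta> <=
        1 and s > 2; W >= 1 raises the other power to W^s.\<close>
      also have "hp_const * (W powr s * q powr (-s) * \<theta> powr s + W powr (s - 1) * q powr (-s) * \<theta> powr (s - 1)) \<le>
         hp_const * (W powr s * q powr (-s) * \<theta> powr 1 + W powr s * q powr (-s) * \<theta> powr 1)"
        using hp_const_pos W q \<theta> \<rho>(2) s_bounds
        by (intro mult_left_mono add_mono mult_mono powr_mono powr_mono' mult_nonneg_nonneg) auto
      also have "\<dots> = (2 * hp_const * Y powr s * q powr (-s) * \<theta>) * (1 + \<bar>z\<bar>) powr s"
        using \<theta> Y by (simp add: W_def powr_mult)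
      finally show ?thesis .
    qed
    have main: "norm (wave N (r + y / N) - of_real (mass i) * (LINT z|lebesgue. indicator {..y} z *\<^sub>R \<psi> z))
        \<le> (2 * hp_const * Y powr s * q powr (-s) * \<theta>) * psi_moment"
      by (rule wave_decompose[where E="?E" and k="H r - mass i"]) (use N Ebound in auto)
    also have "\<dots> \<le> B * q powr (-s) * \<theta>"
    proof -
      have "2 * hp_const * Y powr s * q powr (-s) * \<theta> * psi_moment \<le> 2 * hp_const * Y powr s * q powr (-s) * \<theta> * (psi_moment + 1)"
        using hp_const_pos \<theta> by (intro mult_left_mono) auto
      thus ?thesis by (simp add: B_def mult_ac)
    qed
    also have "\<dots> \<le> B * q powr (-s) * (c / B)" using \<theta> \<rho> B by (intro mult_left_mono) auto
    also have "\<dots> = c * q powr (-s)" using B by simp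
    finally have err: "norm (wave N (r + y / N) - of_real (mass i) * (LINT z|lebesgue. indicator {..y} z *\<^sub>R \<psi> z))
      \<le> c * q powr (-s)" .
    have "2 * c * q powr (-s) = (mass_const * q powr (-s)) * \<kappa>" by (simp add: c_def)
    also have "\<dots> \<le> \<bar>mass i\<bar> * norm (LINT z|lebesgue. indicator {..y} z *\<^sub>R \<psi> z)"
      using abs_mass(1)[of i] ab y by (intro mult_mono) (auto simp: q_def)
    also have "\<dots> = norm (of_real (mass i) * (LINT z|lebesgue. indicator {..y} z *\<^sub>R \<psi> z))"
      by (simp add: norm_mult)
    also have "\<dots> \<le> norm (wave N (r + y / N)) +
        norm (wave N (r + y / N) - of_real (mass i) * (LINT z|lebesgue. indicator {..y} z *\<^sub>R \<psi> z))"
      by (metis norm_triangle_sub norm_minus_commute)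
    finally show "c * den i powr (-s) \<le> norm (wave N (frac_val i + y / N))"
      using err by (simp add: q_def r_def)
  qed
qed

section \<open>Upper bounds for the scaling exponent\<close>

abbreviation eta :: "real \<Rightarrow> ereal" where
  "eta p \<equiv> scaling_exponent \<psi> H p"

lemma convol_eq_wave: "0 < N \<Longrightarrow> convol (dilate N \<psi>) H = wave N"
  by (rule ext) (simp add: convol_dilate wave_def)

lemma eta_le:
  assumes "0 < c" and "\<forall>\<^sub>F N in at_top. ennreal (c * N powr (-a)) \<le> Lp_power p (wave N)"
  shows "eta p \<le> ereal a"
proof (rule scaling_exponent_le[OF assms(1)])
  show "\<forall>\<^sub>F N in at_top. ennreal (c * N powr (-a)) \<le> Lp_power p (convol (dilate N \<psi>) H)"
    using assms(2) eventually_gt_at_top[of 0] by eventually_elim (simp add: convol_eq_wave)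
qed

lemma eta_ge:
  assumes "0 < c" and "\<forall>\<^sub>F N in at_top. Lp_power p (wave N) \<le> ennreal (c * N powr (-a))"
  shows "ereal a \<le> eta p"
proof (rule scaling_exponent_ge[OF assms(1)])
  show "\<forall>\<^sub>F N in at_top. Lp_power p (convol (dilate N \<psi>) H) \<le> ennreal (c * N powr (-a))"
    using assms(2) eventually_gt_at_top[of 0] by eventually_elim (simp add: convol_eq_wave)
qed

lemma borel_measurable_wave: "wave N \<in> borel_measurable borel"
  unfolding wave_def
proof (rule sigma_finite_measure.borel_measurable_lebesgue_integral[OF sigma_finite_lebesgue])
  have "(\<lambda>p. snd p / N) \<in> borel_measurable (borel \<Otimes>\<^sub>M lebesgue)"
    by (rule measurable_compose[OF measurable_snd]) (rule borel_measurable_lebesgue_of_borel, measurable)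
  hence "(\<lambda>p. H (fst p - snd p / N)) \<in> borel_measurable (borel \<Otimes>\<^sub>M lebesgue)"
    by measurable
  moreover have "(\<lambda>p. \<psi> (snd p)) \<in> borel_measurable (borel \<Otimes>\<^sub>M lebesgue)"
    by (rule measurable_compose[OF measurable_snd psi_measurable])
  ultimately show "(\<lambda>(x, z). \<psi> z * of_real (H (x - z / N))) \<in> borel_measurable (borel \<Otimes>\<^sub>M lebesgue)"
    unfolding case_prod_unfold by measurable
qed

text \<open>The norm of the transform is at least c Q^(-s) on a window of length L / N at each
  chosen fraction. Separation makes the windows disjoint; the distance 3/8 from 1/2 leaves 1/8 on
  either side for the offsets a / N and b / N, small once N >= N0.\<close>

lemma Lp_power_lower:
  obtains c \<rho> L N0 :: real where "0 < c" "0 < \<rho>" "0 < L" "\<rho> * L \<le> 1 / 4" "1 \<le> N0"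
    "\<And>N p Q Y. N0 \<le> N \<Longrightarrow> 0 < p \<Longrightarrow> finite Y \<Longrightarrow>
      (\<And>y. y \<in> Y \<Longrightarrow> \<bar>y - 1/2\<bar> \<le> 3/8 \<and> (\<exists>i\<in>reduced_pairs. y = frac_val i \<and> den i \<le> Q)) \<Longrightarrow>
      0 < Q \<Longrightarrow> Q\<^sup>2 \<le> \<rho> * N \<Longrightarrow> (\<And>y y'. y \<in> Y \<Longrightarrow> y' \<in> Y \<Longrightarrow> y \<noteq> y' \<Longrightarrow> L / N < \<bar>y - y'\<bar>) \<Longrightarrow>
      ennreal (real (card Y) * (L / N) * (c * Q powr (-s)) powr p) \<le> Lp_power p (wave N)"
proof -
  obtain a b c \<rho> where w: "a < b" "0 < c" "0 < \<rho>" "\<rho> \<le> 1" "\<rho> * (b - a) \<le> 1 / 4"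
    "\<And>N i y. 1 \<le> N \<Longrightarrow> i \<in> reduced_pairs \<Longrightarrow> (den i)\<^sup>2 \<le> \<rho> * N \<Longrightarrow> a \<le> y \<Longrightarrow> y \<le> b \<Longrightarrow>
      c * den i powr (-s) \<le> norm (wave N (frac_val i + y / N))"
    using wave_near_fraction by blast
  define N0 where "N0 = max 1 (8 * (\<bar>a\<bar> + \<bar>b\<bar>))"
  show ?thesis
  proof (rule that[of c \<rho> "b - a" N0])
    fix N p Q :: real and Y :: "real set"
    assume N0: "N0 \<le> N" and p: "0 < p" and finY: "finite Y"
      and Y: "\<And>y. y \<in> Y \<Longrightarrow> \<bar>y - 1/2\<bar> \<le> 3/8 \<and> (\<exists>i\<in>reduced_pairs. y = frac_val i \<and> den i \<le> Q)"
      and Q: "0 < Q" "Q\<^sup>2 \<le> \<rho> * N"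
      and sep: "\<And>y y'. y \<in> Y \<Longrightarrow> y' \<in> Y \<Longrightarrow> y \<noteq> y' \<Longrightarrow> (b - a) / N < \<bar>y - y'\<bar>"
    have N: "1 \<le> N" "8 * (\<bar>a\<bar> + \<bar>b\<bar>) \<le> N" using N0 by (auto simp: N0_def)
    define J where "J y = {y + a / N .. y + b / N}" for y :: real
    define U where "U = (\<Union>y\<in>Y. J y)"
    define \<kappa> where "\<kappa> = c * Q powr (-s)"
    have \<kappa>: "0 < \<kappa>" using w Q by (simp add: \<kappa>_def)
    have abN: "\<bar>a / N\<bar> \<le> 1 / 8" "\<bar>b / N\<bar> \<le> 1 / 8" using N by (auto simp: abs_divide field_simps)
    have abN2: "b / N - a / N = (b - a) / N" by (simp add: diff_divide_distrib)
    have U01: "U \<subseteq> {0..1}"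
    proof
      fix x assume "x \<in> U"
      then obtain y where "y \<in> Y" "x \<in> J y" by (auto simp: U_def)
      thus "x \<in> {0..1}" using Y[of y] abN unfolding J_def atLeastAtMost_iff by linarith
    qed
    have Um: "U \<in> sets borel" unfolding U_def J_def using finY by auto
    have large: "\<kappa> \<le> norm (wave N x)" if xU: "x \<in> U" for x
    proof -
      obtain y where y: "y \<in> Y" "x \<in> J y" using xU by (auto simp: U_def)
      obtain i where i: "i \<in> reduced_pairs" "y = frac_val i" "den i \<le> Q" using Y[OF y(1)] by blast
      have q: "1 \<le> real (snd i)" using i by (auto simp: reduced_pairs_def)
      have "(den i)\<^sup>2 \<le> Q\<^sup>2" using i by (intro power_mono) auto
      hence qN: "(den i)\<^sup>2 \<le> \<rho> * N" using Q by linarith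
      have "a / N \<le> x - y" "x - y \<le> b / N" using y(2) by (auto simp: J_def)
      hence ay: "a \<le> N * (x - y)" "N * (x - y) \<le> b" using N by (auto simp: field_simps)
      have "\<kappa> \<le> c * den i powr (-s)"
        unfolding \<kappa>_def using w q i s_bounds by (intro mult_left_mono powr_mono2') auto
      also have "\<dots> \<le> norm (wave N (frac_val i + N * (x - y) / N))" by (rule w(6)[OF N(1) i(1) qN ay])
      also have "frac_val i + N * (x - y) / N = x" using N i by simp
      finally show ?thesis .
    qed
    have disj: "disjoint_family_on J Y"
      unfolding disjoint_family_on_def
    proof (intro ballI impI)
      fix y y' assume yy: "y \<in> Y" "y' \<in> Y" "y \<noteq> y'"
      have "x \<notin> J y'" if "x \<in> J y" for x
        using sep[OF yy] that abN2 unfolding J_def atLeastAtMost_iff by linarith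
      thus "J y \<inter> J y' = {}" by blast
    qed
    have J_borel: "J y \<in> sets borel" for y by (simp add: J_def)
    have "emeasure lborel U = (\<Sum>y\<in>Y. emeasure lborel (J y))"
      unfolding U_def using disj finY by (intro sum_emeasure[symmetric]) (auto simp: J_borel)
    also have "\<dots> = (\<Sum>y\<in>Y. ennreal ((b - a) / N))"
    proof (rule sum.cong[OF refl])
      fix y
      have "y + a / N \<le> y + b / N" using w(1) N by (simp add: divide_right_mono)
      thus "emeasure lborel (J y) = ennreal ((b - a) / N)" by (simp add: J_def abN2)
    qed
    also have "\<dots> = ennreal (real (card Y) * ((b - a) / N))"
      using w(1) N by (subst sum_ennreal) auto
    finally have eU: "emeasure lebesgue U = ennreal (real (card Y) * ((b - a) / N))" using Um by simp
    have "ennreal (real (card Y) * ((b - a) / N) * \<kappa> powr p) = ennreal (\<kappa> powr p) * emeasure lebesgue U"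
      unfolding eU using w(1) N by (subst ennreal_mult[symmetric]) (auto simp: mult_ac)
    also have "\<dots> = (\<integral>\<^sup>+x. ennreal (\<kappa> powr p) * indicator U x \<partial>lebesgue)"
      using Um by (intro nn_integral_cmult_indicator[symmetric]) auto
    also have "\<dots> \<le> (\<integral>\<^sup>+x. ennreal (norm (wave N x) powr p) * indicator {0..1} x \<partial>lebesgue)"
    proof (rule nn_integral_mono)
      fix x
      show "ennreal (\<kappa> powr p) * indicator U x \<le> ennreal (norm (wave N x) powr p) * indicator {0..1} x"
      proof (cases "x \<in> U")
        case True
        have "\<kappa> powr p \<le> norm (wave N x) powr p" using large[OF True] \<kappa> p by (intro powr_mono2) auto
        thus ?thesis using True U01 by (auto simp: indicator_def intro!: ennreal_leI)
      qed simp
    qed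
    also have "\<dots> = Lp_power p (wave N)"
      by (simp add: Lp_power_def)
    finally show "ennreal (real (card Y) * ((b - a) / N) * (c * Q powr (-s)) powr p)
        \<le> Lp_power p (wave N)" by (simp add: \<kappa>_def)
  qed (use w in \<open>auto simp: N0_def\<close>)
qed

lemma eta_upper:
  assumes p: "0 < p"
  shows "eta p \<le> 1" "eta p \<le> ereal (s * p / 2)"
proof -
  obtain c \<rho> L N0 :: real where w: "0 < c" "0 < \<rho>" "0 < L" "\<rho> * L \<le> 1 / 4" "1 \<le> N0"
    "\<And>N p Q Y. N0 \<le> N \<Longrightarrow> 0 < p \<Longrightarrow> finite Y \<Longrightarrow>
      (\<And>y. y \<in> Y \<Longrightarrow> \<bar>y - 1/2\<bar> \<le> 3/8 \<and> (\<exists>i\<in>reduced_pairs. y = frac_val i \<and> den i \<le> Q)) \<Longrightarrow>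
      0 < Q \<Longrightarrow> Q\<^sup>2 \<le> \<rho> * N \<Longrightarrow> (\<And>y y'. y \<in> Y \<Longrightarrow> y' \<in> Y \<Longrightarrow> y \<noteq> y' \<Longrightarrow> L / N < \<bar>y - y'\<bar>) \<Longrightarrow>
      ennreal (real (card Y) * (L / N) * (c * Q powr (-s)) powr p) \<le> Lp_power p (wave N)"
    using Lp_power_lower by blast
  have "eta p \<le> ereal 1"
  proof (rule eta_le)
    show "0 < L * (c * 2 powr (-s)) powr p" using w by simp
    show "\<forall>\<^sub>F N in at_top. ennreal (L * (c * 2 powr (-s)) powr p * N powr (- 1)) \<le> Lp_power p (wave N)"
      using eventually_ge_at_top[of N0] eventually_ge_at_top[of "4 / \<rho>"]
    proof eventually_elim
      case (elim N)
      have N: "0 < N" using elim w by linarith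
      \<comment> \<open>The fraction 1/2 is interior, so its window stays in {0..1}; N >= 4 / \<rho>
        admits its denominator 2.\<close>
      have "ennreal (real (card {1/2::real}) * (L / N) * (c * 2 powr (-s)) powr p) \<le> Lp_power p (wave N)"
      proof (rule w(6)[OF elim(1) p])
        show "\<bar>y - 1/2\<bar> \<le> 3/8 \<and> (\<exists>i\<in>reduced_pairs. y = frac_val i \<and> den i \<le> 2)" if "y \<in> {1/2}" for y :: real
        proof -
          have "y = 1/2" using that by simp
          thus ?thesis by (intro conjI bexI[of _ "(1, 2)"]) (auto simp: reduced_pairs_def frac_val_def)
        qed
        show "2\<^sup>2 \<le> \<rho> * N" using elim(2) w(2) by (simp add: field_simps)
      qed auto
      moreover have "L * (c * 2 powr (-s)) powr p * N powr (- 1) = real (card {1/2::real}) * (L / N) * (c * 2 powr (-s)) powr p"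
        using N by (simp add: powr_minus_divide)
      ultimately show ?case by (simp only:)
    qed
  qed
  thus "eta p \<le> 1" unfolding one_ereal_def .
  \<comment> \<open>About N^(1 - e/2) fractions, windows of length of order 1 / N and p-th powers of
    order N^(-s p / 2) give this exponent; e is the loss in \<open>frac_net\<close>.\<close>
  have eps: "eta p \<le> ereal (s * p / 2 + e / 2)" if e: "0 < e" "e < 1" for e
  proof -
    define k where "k = L / 8 * 2 powr (e - 2) * c powr p * \<rho> powr (1 - e/2 - s * p / 2)"
    \<comment> \<open>The largest denominator bound whose square is at most \<rho> N.\<close>
    define D where "D N = nat \<lfloor>sqrt (\<rho> * N)\<rfloor>" for N :: real
    have Dlim: "filterlim D sequentially at_top"
      unfolding D_def
      using w(2) by (intro filterlim_compose[OF filterlim_nat_sequentially]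
          filterlim_compose[OF filterlim_floor_sequentially] filterlim_compose[OF sqrt_at_top]
          filterlim_tendsto_pos_mult_at_top[OF tendsto_const] filterlim_ident)
    show ?thesis
    proof (rule eta_le)
      show "0 < k" using w by (simp add: k_def)
      show "\<forall>\<^sub>F N in at_top. ennreal (k * N powr (- (s * p / 2 + e / 2))) \<le> Lp_power p (wave N)"
        using eventually_compose_filterlim[OF eventually_frac_net[OF e, of "1/2"] Dlim, simplified]
          eventually_ge_at_top[of N0] eventually_ge_at_top[of "4 / \<rho>"]
      proof eventually_elim
        case (elim N)
        have N: "1 \<le> N" using elim w by linarith
        have rN: "4 \<le> \<rho> * N" using elim(3) w(2) by (simp add: field_simps)
        define Q where "Q = real (D N)"
        define S where "S = sqrt (\<rho> * N)"
        have S: "2 \<le> S" "S\<^sup>2 = \<rho> * N" using rN real_le_rsqrt[of 2 "\<rho> * N"] by (auto simp: S_def)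
        have "Q = of_int \<lfloor>S\<rfloor>" using S by (simp add: Q_def D_def S_def[symmetric])
        hence Q: "S / 2 \<le> Q" "Q \<le> S" "1 \<le> Q" using S by linarith+
        have QN: "Q\<^sup>2 \<le> \<rho> * N" using Q S(2) power_mono[of Q S 2] by simp
        define X where "X = Q powr (2 - e)"
        \<comment> \<open>Centre 1/2 and r = 1/2 give exactly the distance 3/8 required by
          \<open>Lp_power_lower\<close>.\<close>
        obtain Y where "frac_net e (1/2) (D N) (1/2) Y" using elim(1) by blast
        note Y = frac_netD[OF this, folded Q_def, folded X_def]
        have "ennreal (real (card Y) * (L / N) * (c * Q powr (-s)) powr p) \<le> Lp_power p (wave N)"
        proof (rule w(6)[OF elim(2) p Y(1) _ _ QN])
          fix y assume y: "y \<in> Y"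
          obtain a :: int and q where aq: "y = of_int a / real q" "1 \<le> q" "q \<le> D N" using Y(4)[OF y] by blast
          obtain i where "i \<in> reduced_pairs" "frac_val i = of_int a / real q" "1 \<le> snd i" "snd i \<le> q"
            using reduced_pair_of_fraction[OF aq(2)] by blast
          thus "\<bar>y - 1/2\<bar> \<le> 3/8 \<and> (\<exists>i\<in>reduced_pairs. y = frac_val i \<and> den i \<le> Q)"
            using Y(3)[OF y] aq by (auto simp: Q_def intro!: bexI[of _ i])
        next
          fix y y' assume yy: "y \<in> Y" "y' \<in> Y" "y \<noteq> y'"
          have "X \<le> Q powr 2" unfolding X_def using Q e by (intro powr_mono) auto
          also have "\<dots> \<le> \<rho> * N" using QN Q by simp
          finally have X: "X \<le> \<rho> * N" .
          have X0: "0 < X" using Q by (simp add: X_def)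
          have "L * X \<le> L * (\<rho> * N)" using X w(3) by (intro mult_left_mono) auto
          also have "\<dots> = (\<rho> * L) * N" by simp
          also have "\<dots> \<le> 1 / 4 * N" using w(4) N by (intro mult_right_mono) auto
          also have "\<dots> < 1 / 2 * N" using N by simp
          finally have "L / N < 1 / (2 * X)" using X0 N by (simp add: field_simps)
          thus "L / N < \<bar>y - y'\<bar>" using Y(5)[OF yy] by linarith
        qed (use Q in simp)
        moreover have "k * N powr (- (s * p / 2 + e / 2)) \<le> real (card Y) * (L / N) * (c * Q powr (-s)) powr p"
        proof -
          have sq: "S powr a = (\<rho> * N) powr (a / 2)" for a
            using rN by (simp add: S_def powr_half_sqrt[symmetric] powr_powr)
          have "2 powr (e - 2) * (\<rho> * N) powr (1 - e / 2) = (S / 2) powr (2 - e)"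
          proof -
            have "(S / 2) powr (2 - e) = S powr (2 - e) * 2 powr (e - 2)"
              using S by (simp add: powr_divide powr_diff powr_add field_simps)
            thus ?thesis by (simp add: sq diff_divide_distrib)
          qed
          also have "\<dots> \<le> X" unfolding X_def using Q S e by (intro powr_mono2) auto
          finally have X: "2 powr (e - 2) * (\<rho> * N) powr (1 - e / 2) / 8 \<le> real (card Y)" using Y(2) by simp
          have "(\<rho> * N) powr (- (s * p / 2)) = S powr (- (s * p))" by (simp add: sq)
          also have "\<dots> \<le> Q powr (- (s * p))" using Q s_bounds p by (intro powr_mono2') auto
          finally have Qp: "c powr p * (\<rho> * N) powr (- (s * p / 2)) \<le> (c * Q powr (-s)) powr p"
            using w(1) by (simp add: powr_mult powr_powr mult_left_mono)
          have "k * N powr (- (s * p / 2 + e / 2)) =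
            (2 powr (e - 2) * (\<rho> * N) powr (1 - e / 2) / 8) * (L / N) * (c powr p * (\<rho> * N) powr (- (s * p / 2)))"
          proof -
            have a: "\<rho> powr (1 - e/2 - s * p / 2) = \<rho> powr (1 - e/2) * \<rho> powr (- (s * p / 2))"
              by (simp add: powr_add[symmetric])
            have "N powr (- (s * p / 2 + e / 2)) = N powr ((1 - e/2) + (- 1) + (- (s * p / 2)))"
              by (rule arg_cong[where f="\<lambda>x. N powr x"]) simp
            also have "\<dots> = N powr (1 - e/2) * N powr (- 1) * N powr (- (s * p / 2))"
              by (simp only: powr_add)
            finally have b: "N powr (- (s * p / 2 + e / 2)) = N powr (1 - e/2) / N * N powr (- (s * p / 2))"
              using N by (simp add: powr_minus_divide)
            have m: "(\<rho> * N) powr t = \<rho> powr t * N powr t" for t using w(2) N by (simp add: powr_mult)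
            show ?thesis unfolding k_def a b m by (simp add: mult_ac)
          qed
          also have "\<dots> \<le> real (card Y) * (L / N) * (c * Q powr (-s)) powr p"
            using X Qp w N by (intro mult_mono) auto
          finally show ?thesis .
        qed
        ultimately show ?case by (meson ennreal_leI order_trans)
      qed
    qed
  qed
  show "eta p \<le> ereal (s * p / 2)"
  proof (rule ereal_le_epsilon2)
    fix \<epsilon> :: real assume "0 < \<epsilon>"
    hence "eta p \<le> ereal (s * p / 2 + min \<epsilon> (1/2) / 2)" by (intro eps) auto
    also have "\<dots> \<le> ereal (s * p / 2) + ereal \<epsilon>" using \<open>0 < \<epsilon>\<close> by simp
    finally show "eta p \<le> ereal (s * p / 2) + ereal \<epsilon>" .
  qed
qed

section \<open>Lower bounds for the scaling exponent\<close>

lemma wave_norm_le: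
  assumes "0 < N" "\<And>z. \<bar>H (x - z / N) - H x\<bar> \<le> K * (1 + \<bar>z\<bar>) powr s"
  shows "norm (wave N x) \<le> K * psi_moment"
  using wave_decompose[where E="\<lambda>z. H (x - z / N) - H x" and k="H x" and m=0 and K=K] assms
  by simp

text \<open>The 1 pays for fractions of denominator above R, the other term for increments with |z|
  > N.\<close>

definition far_const :: real where
  "far_const = 1 + 2 * hp_const"

lemma far_const_pos: "0 < far_const"
  using hp_const_pos by (simp add: far_const_def)

lemma borel_measurable_wave_powr:
  "(\<lambda>x. ennreal (norm (wave N x) powr p) * indicator {0..1} x) \<in> borel_measurable lebesgue"
  by (rule borel_measurable_lebesgue_of_borel) (use borel_measurable_wave in measurable)

text \<open>The uniform bound that carries an estimate at p1 over to every larger p.\<close>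

lemma wave_bounded:
  assumes N: "1 \<le> N"
  shows "norm (wave N x) \<le> hp_const * psi_moment"
proof (rule wave_norm_le)
  fix z
  have "\<bar>H (x - z / N) - H x\<bar> \<le> hp_const * (1 + \<bar>z / N\<bar>)" using H_growth[of "x - z / N" x] by simp
  also have "\<bar>z / N\<bar> \<le> \<bar>z\<bar>" using N mult_right_mono[of 1 N "\<bar>z\<bar>"] by (simp add: abs_divide divide_le_eq mult.commute)
  hence "hp_const * (1 + \<bar>z / N\<bar>) \<le> hp_const * (1 + \<bar>z\<bar>)" using hp_const_pos by (intro mult_left_mono) auto
  also have "\<dots> \<le> hp_const * (1 + \<bar>z\<bar>) powr s" using hp_const_pos weight_ge by (intro mult_left_mono) auto
  finally show "\<bar>H (x - z / N) - H x\<bar> \<le> hp_const * (1 + \<bar>z\<bar>) powr s" .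
qed (use N in simp)

text \<open>Each jump contributes a bump of width \<open>1 / N\<close>. Far increments of \<open>H\<close>, and the
  jumps at fractions of large denominator, are absorbed in an error of order \<open>N powr (-s)\<close>.\<close>

lemma wave_upper_pointwise:
  assumes N: "1 \<le> N"
  obtains F where "finite F" "F \<subseteq> reduced_pairs" "\<And>i. i \<in> F \<Longrightarrow> \<bar>frac_val i - 1/2\<bar> \<le> 3/2"
    "\<And>x. x \<in> {0..1} \<Longrightarrow> norm (wave N x) \<le>
      ((\<Sum>i\<in>F. \<bar>mass i\<bar> * (1 + N * \<bar>x - frac_val i\<bar>) powr (-s)) + far_const * N powr (-s)) * psi_moment"
proof -
  have Ns: "0 < N powr (-s)" using N by simp
  have "((\<lambda>R. hp_const * (R powr (-s) + 1 * R powr (2 - s))) \<longlongrightarrow> hp_const * (0 + 1 * 0)) at_top"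
    using s_bounds by (intro tendsto_intros tendsto_neg_powr filterlim_ident) auto
  hence "\<forall>\<^sub>F R in at_top. hp_const * (R powr (-s) + 1 * R powr (2 - s)) < N powr (-s)"
    using Ns by (intro order_tendstoD(2)) auto
  hence "\<forall>\<^sub>F R in at_top. hp_const * (R powr (-s) + 1 * R powr (2 - s)) < N powr (-s) \<and> 1 \<le> R"
    using eventually_ge_at_top eventually_conj by blast
  \<comment> \<open>R depends on N, and with it the finite set \<open>F\<close>; the later estimates
    are uniform because the sums of q^(-\<sigma>) do not depend on how far they extend.\<close>
  then obtain R where R: "hp_const * (R powr (-s) + 1 * R powr (2 - s)) < N powr (-s)" "1 \<le> R"
    using eventually_happens'[OF trivial_limit_at_top_linorder] by blast
  \<comment> \<open>This is the interval from -1 to 2, which contains every point within 1 of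
    {0..1}.\<close>
  define F where "F = {i\<in>reduced_pairs. den i \<le> R \<and> \<bar>frac_val i - 1/2\<bar> \<le> 3/2}"
  have F: "finite F" "F \<subseteq> reduced_pairs" unfolding F_def by (rule finite_reduced_bounded) auto
  show ?thesis
  proof (rule that[OF F])
    show "\<bar>frac_val i - 1/2\<bar> \<le> 3/2" if "i \<in> F" for i using that by (simp add: F_def)
    fix x :: real assume x: "x \<in> {0..1}"
    let ?g = "\<Sum>i\<in>F. \<bar>mass i\<bar> * (1 + N * \<bar>x - frac_val i\<bar>) powr (-s)"
    have g0: "0 \<le> ?g" by (intro sum_nonneg) auto
    show "norm (wave N x) \<le> (?g + far_const * N powr (-s)) * psi_moment"
    proof (rule wave_norm_le)
      fix z :: real
      define v where "v = x - z / N"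
      define W where "W = (1 + \<bar>z\<bar>) powr s"
      have W: "1 \<le> W" using one_le_weight by (simp add: W_def)
      show "\<bar>H (x - z / N) - H x\<bar> \<le> (?g + far_const * N powr (-s)) * (1 + \<bar>z\<bar>) powr s"
      proof (cases "\<bar>z\<bar> \<le> N")
        case True
        have vx: "\<bar>v - x\<bar> = \<bar>z\<bar> / N" using N by (simp add: v_def abs_divide)
        have vx1: "\<bar>v - x\<bar> \<le> 1" unfolding vx using True N by simp
        define A where "A = {min v x<..max v x}"
        have Ax: "\<bar>a - x\<bar> \<le> \<bar>v - x\<bar>" if "a \<in> A" for a using that by (auto simp: A_def)
        have "\<bar>H v - H x\<bar> = \<bar>hp \<delta> A\<bar>"
          using H_diff[of v x] H_diff[of x v] by (cases "v \<le> x") (auto simp: A_def min_def max_def)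
        also have "\<dots> \<le> \<bar>\<Sum>i\<in>F. mass i * indicator A (frac_val i)\<bar> + N powr (-s)"
        proof -
          have "\<bar>hp \<delta> A - (\<Sum>i\<in>F. mass i * indicator A (frac_val i))\<bar> \<le> hp_const * (R powr (-s) + 1 * R powr (2 - s))"
          proof (rule hp_approx[OF F _ R(2)])
            show "A \<subseteq> cball x 1"
            proof
              fix a assume "a \<in> A"
              thus "a \<in> cball x 1" using Ax[of a] vx1 by (simp add: dist_real_def abs_minus_commute)
            qed
            fix i assume i: "i \<in> reduced_pairs - F" "frac_val i \<in> A"
            have "\<bar>frac_val i - 1/2\<bar> \<le> 3/2"
              using Ax[OF i(2)] vx1 x unfolding atLeastAtMost_iff by linarith
            thus "R \<le> real (snd i)" using i(1) by (auto simp: F_def)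
          qed simp
          thus ?thesis using R(1) by linarith
        qed
        also have "\<bar>\<Sum>i\<in>F. mass i * indicator A (frac_val i)\<bar> \<le> (\<Sum>i\<in>F. \<bar>mass i * indicator A (frac_val i)\<bar>)"
          by (rule sum_abs)
        also have "\<dots> \<le> (\<Sum>i\<in>F. \<bar>mass i\<bar> * (1 + N * \<bar>x - frac_val i\<bar>) powr (-s) * W)"
        proof (rule sum_mono)
          fix i
          define d where "d = 1 + N * \<bar>x - frac_val i\<bar>"
          have d: "1 \<le> d" using N by (simp add: d_def)
          show "\<bar>mass i * indicator A (frac_val i)\<bar> \<le> \<bar>mass i\<bar> * (1 + N * \<bar>x - frac_val i\<bar>) powr (-s) * W"
          proof (cases "frac_val i \<in> A")
            case True
            \<comment> \<open>A jump enters only if it lies between x and x - z / N; the weight (1 +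
              |z|)^s then outgrows (1 + N |x - f|)^s for f its position, so the bump times the
              weight is at least 1.\<close>
            have "N * \<bar>x - frac_val i\<bar> \<le> N * (\<bar>z\<bar> / N)"
              using Ax[OF True] N unfolding vx by (intro mult_left_mono) (auto simp: abs_minus_commute)
            hence "d \<le> 1 + \<bar>z\<bar>" using N by (simp add: d_def)
            hence "d powr s \<le> W" unfolding W_def using d s_bounds by (intro powr_mono2) auto
            hence "1 \<le> d powr (-s) * W" using d by (simp add: powr_minus field_simps)
            hence "\<bar>mass i\<bar> * 1 \<le> \<bar>mass i\<bar> * (d powr (-s) * W)" by (intro mult_left_mono) auto
            thus ?thesis using True by (simp add: d_def mult.assoc)
          qed (use W in simp)
        qed
        also have "\<dots> = ?g * W" by (simp add: sum_distrib_right)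
        finally have "\<bar>H v - H x\<bar> \<le> ?g * W + N powr (-s)" by simp
        also have "N powr (-s) \<le> far_const * N powr (-s) * W"
        proof -
          have "1 * N powr (-s) * 1 \<le> far_const * N powr (-s) * W"
            using W hp_const_pos by (intro mult_mono) (auto simp: far_const_def)
          thus ?thesis by simp
        qed
        finally show ?thesis by (simp add: v_def W_def algebra_simps)
      next
        case False
        have zN: "1 \<le> \<bar>z\<bar> / N" using False N by simp
        have "\<bar>H (x - z / N) - H x\<bar> \<le> hp_const * (1 + \<bar>z / N\<bar>)" using H_growth[of "x - z / N" x] by simp
        also have "\<dots> \<le> hp_const * (2 * (\<bar>z\<bar> / N))"
        proof (rule mult_left_mono)
          have "\<bar>z / N\<bar> = \<bar>z\<bar> / N" using N by (simp add: abs_divide)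
          thus "1 + \<bar>z / N\<bar> \<le> 2 * (\<bar>z\<bar> / N)" using zN by linarith
        qed (use hp_const_pos in simp)
        also have "\<dots> \<le> hp_const * (2 * (N powr (-s) * W))"
        proof (intro mult_left_mono)
          \<comment> \<open>Beyond N the ratio exceeds 1, so linear growth is dominated by the s-th
            power, which releases the factor N^(-s).\<close>
          have "\<bar>z\<bar> / N \<le> (\<bar>z\<bar> / N) powr s" using powr_mono[of 1 s "\<bar>z\<bar> / N"] zN N s_bounds by simp
          also have "\<dots> \<le> ((1 + \<bar>z\<bar>) / N) powr s" using N s_bounds by (intro powr_mono2 divide_right_mono) auto
          also have "\<dots> = N powr (-s) * W" using N by (simp add: W_def powr_divide powr_minus_divide)
          finally show "\<bar>z\<bar> / N \<le> N powr (-s) * W" .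
        qed (use hp_const_pos in auto)
        also have "\<dots> = 2 * hp_const * (N powr (-s) * W)" by simp
        also have "\<dots> \<le> far_const * (N powr (-s) * W)" using W by (intro mult_right_mono) (auto simp: far_const_def)
        also have "\<dots> \<le> (?g + far_const * N powr (-s)) * W" using g0 W by (simp add: algebra_simps)
        finally show ?thesis by (simp add: W_def)
      qed
    qed (use N in simp)
  qed
qed

text \<open>With \<sigma> = s p > 2 each bump has integral J / N by scaling, the p-th powers of the
  masses have a bounded sum, and the error N^(-\<sigma>) is at most 1 / N.\<close>

lemma Lp_power_wave_upper:
  assumes p: "2 / s < p" "p < 1"
  obtains C' where "0 < C'" "\<And>N. 1 \<le> N \<Longrightarrow> Lp_power p (wave N) \<le> ennreal (C' / N)"
proof -
  have s: "0 < s" using s_bounds by simp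
  have p0: "0 < p" using p s by (meson divide_pos_pos less_trans zero_less_numeral)
  define \<sigma> where "\<sigma> = s * p"
  have \<sigma>: "2 < \<sigma>" using p s by (simp add: \<sigma>_def field_simps)
  define \<mu> where "\<mu> = mass_const * 2 powr s"
  define J where "J = (LINT z|lebesgue. (1 + \<bar>z\<bar>) powr (-\<sigma>))"
  have Ji: "integrable lebesgue (\<lambda>z::real. (1 + \<bar>z\<bar>) powr (-\<sigma>))"
    using \<sigma> by (intro integrable_one_plus_abs_powr) simp
  have J0: "0 \<le> J" unfolding J_def by (intro Bochner_Integration.integral_nonneg) auto
  define M where "M = psi_moment powr p"
  have M0: "0 \<le> M" by (simp add: M_def)
  \<comment> \<open>The factor 1 + 3/2 is \<open>reduced_power_sum_bound\<close> with R = 1, u =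
    3/2; the final 1 keeps C' positive.\<close>
  define C' where "C' = M * (\<mu> powr p * (frac_sum_const \<sigma> * (1 + 3 / 2))) * J + M * far_const powr p + 1"
  have C'0: "0 < C'"
    unfolding C'_def using M0 J0 frac_sum_const_pos[OF \<sigma>] by (intro add_nonneg_pos add_nonneg_nonneg mult_nonneg_nonneg) auto
  show ?thesis
  proof (rule that[OF C'0])
    fix N :: real assume N: "1 \<le> N"
    obtain F where F: "finite F" "F \<subseteq> reduced_pairs" "\<And>i. i \<in> F \<Longrightarrow> \<bar>frac_val i - 1/2\<bar> \<le> 3/2"
      "\<And>x. x \<in> {0..1} \<Longrightarrow> norm (wave N x) \<le>
        ((\<Sum>i\<in>F. \<bar>mass i\<bar> * (1 + N * \<bar>x - frac_val i\<bar>) powr (-s)) + far_const * N powr (-s)) * psi_moment"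
      using wave_upper_pointwise[OF N] by blast
    define g where "g x = M * (\<Sum>i\<in>F. \<bar>mass i\<bar> powr p * (1 + N * \<bar>x - frac_val i\<bar>) powr (-\<sigma>))" for x
    define k where "k = M * (far_const powr p * N powr (-\<sigma>))"
    have g0: "0 \<le> g x" for x unfolding g_def using M0 by (intro mult_nonneg_nonneg sum_nonneg) auto
    have k0: "0 \<le> k" unfolding k_def using M0 by simp
    have gm: "g \<in> borel_measurable borel" unfolding g_def by measurable
    have bump: "integrable lebesgue (\<lambda>x. (1 + N * \<bar>x - f\<bar>) powr (-\<sigma>))"
      "(LINT x|lebesgue. (1 + N * \<bar>x - f\<bar>) powr (-\<sigma>)) = J / N" for f :: real
    proof -
      have e: "(1 + \<bar>- N * f + N * x\<bar>) powr (-\<sigma>) = (1 + N * \<bar>x - f\<bar>) powr (-\<sigma>)" for x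
      proof -
        have "\<bar>- N * f + N * x\<bar> = \<bar>N * (x - f)\<bar>" by (simp add: algebra_simps)
        also have "\<dots> = N * \<bar>x - f\<bar>" using N by (simp add: abs_mult)
        finally show ?thesis by simp
      qed
      show "integrable lebesgue (\<lambda>x. (1 + N * \<bar>x - f\<bar>) powr (-\<sigma>))"
        using lebesgue_integrable_real_affine[OF Ji, of N "- N * f"] N unfolding e by simp
      have "J = \<bar>N\<bar> *\<^sub>R (LINT x|lebesgue. (1 + \<bar>- N * f + N * x\<bar>) powr (-\<sigma>))"
        unfolding J_def using N by (intro lebesgue_integral_real_affine) simp
      thus "(LINT x|lebesgue. (1 + N * \<bar>x - f\<bar>) powr (-\<sigma>)) = J / N"
        unfolding e using N by simp
    qed
    have gi: "integrable lebesgue g"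
      unfolding g_def using bump(1) by (intro integrable_mult_right Bochner_Integration.integrable_sum) auto
    have gint: "(LINT x|lebesgue. g x) = M * (\<Sum>i\<in>F. \<bar>mass i\<bar> powr p) * (J / N)"
    proof -
      have "(LINT x|lebesgue. g x) = M * (\<Sum>i\<in>F. LINT x|lebesgue. \<bar>mass i\<bar> powr p * (1 + N * \<bar>x - frac_val i\<bar>) powr (-\<sigma>))"
        unfolding g_def integral_mult_right_zero using bump(1)
        by (subst Bochner_Integration.integral_sum) auto
      also have "\<dots> = M * (\<Sum>i\<in>F. \<bar>mass i\<bar> powr p * (J / N))"
        unfolding integral_mult_right_zero bump(2) ..
      finally show ?thesis by (simp only: sum_distrib_right mult.assoc)
    qed
    have masses: "(\<Sum>i\<in>F. \<bar>mass i\<bar> powr p) \<le> \<mu> powr p * (frac_sum_const \<sigma> * (1 + 3 / 2))"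
    proof -
      have "(\<Sum>i\<in>F. \<bar>mass i\<bar> powr p) \<le> (\<Sum>i\<in>F. \<mu> powr p * den i powr (-\<sigma>))"
      proof (rule sum_mono)
        fix i
        have "\<bar>mass i\<bar> powr p \<le> (\<mu> * den i powr (-s)) powr p"
          using abs_mass(2)[of i] p0 by (intro powr_mono2) (auto simp: \<mu>_def)
        also have "\<dots> = \<mu> powr p * den i powr (-\<sigma>)"
          using mass_const_pos by (simp add: powr_mult powr_powr \<sigma>_def \<mu>_def)
        finally show "\<bar>mass i\<bar> powr p \<le> \<mu> powr p * den i powr (-\<sigma>)" .
      qed
      also have "\<dots> = \<mu> powr p * (\<Sum>i\<in>F. den i powr (-\<sigma>))" by (simp add: sum_distrib_left)
      also have "\<dots> \<le> \<mu> powr p * (frac_sum_const \<sigma> * (1 powr (-\<sigma>) + 3 / 2 * 1 powr (2 - \<sigma>)))"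
        using F by (intro mult_left_mono reduced_power_sum_bound[where t="1/2", OF \<sigma>]) (auto simp: reduced_pairs_def)
      finally show ?thesis by simp
    qed
    have majorant: "norm (wave N x) powr p \<le> g x + k" if x: "x \<in> {0..1}" for x
    proof -
      let ?a = "\<lambda>i. \<bar>mass i\<bar> * (1 + N * \<bar>x - frac_val i\<bar>) powr (-s)"
      have nn: "0 \<le> 1 + N * \<bar>x - f\<bar>" for f using N by simp
      have a0: "0 \<le> sum ?a F" by (intro sum_nonneg) auto
      have "norm (wave N x) powr p \<le> ((sum ?a F + far_const * N powr (-s)) * psi_moment) powr p"
        using F(4)[OF x] p0 by (intro powr_mono2) auto
      also have "\<dots> = M * (sum ?a F + far_const * N powr (-s)) powr p"
        using a0 far_const_pos psi_moment_nonneg by (simp add: powr_mult M_def mult.commute)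
      also have "\<dots> \<le> M * ((\<Sum>i\<in>F. ?a i powr p) + (far_const * N powr (-s)) powr p)"
      proof (rule mult_left_mono[OF _ M0])
        have "(sum ?a F + far_const * N powr (-s)) powr p \<le> sum ?a F powr p + (far_const * N powr (-s)) powr p"
          using a0 far_const_pos p0 p by (intro powr_add_subadditive) auto
        also have "sum ?a F powr p \<le> (\<Sum>i\<in>F. ?a i powr p)"
          using F(1) p0 p by (intro powr_sum_subadditive) auto
        finally show "(sum ?a F + far_const * N powr (-s)) powr p \<le> (\<Sum>i\<in>F. ?a i powr p) + (far_const * N powr (-s)) powr p" by simp
      qed
      also have "\<dots> = g x + k"
        using far_const_pos by (simp add: g_def k_def powr_mult powr_powr \<sigma>_def algebra_simps)
      finally show ?thesis .
    qed
    have "Lp_power p (wave N) \<le> (\<integral>\<^sup>+x. ennreal (g x + k) * indicator {0..1} x \<partial>lebesgue)"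
      unfolding Lp_power_def using majorant by (intro nn_integral_mono) (auto simp: indicator_def intro!: ennreal_leI)
    also have "\<dots> \<le> (\<integral>\<^sup>+x. ennreal (g x) + ennreal k * indicator {0..1::real} x \<partial>lebesgue)"
      using g0 k0 by (intro nn_integral_mono) (auto simp: indicator_def ennreal_plus)
    also have "\<dots> = (\<integral>\<^sup>+x. ennreal (g x) \<partial>lebesgue) + (\<integral>\<^sup>+x. ennreal k * indicator {0..1::real} x \<partial>lebesgue)"
    proof (rule nn_integral_add)
      show "(\<lambda>x. ennreal (g x)) \<in> borel_measurable lebesgue"
        by (rule borel_measurable_lebesgue_of_borel) (use gm in measurable)
      show "(\<lambda>x. ennreal k * indicator {0..1::real} x) \<in> borel_measurable lebesgue"
        by (rule borel_measurable_lebesgue_of_borel) measurable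
    qed
    also have "(\<integral>\<^sup>+x. ennreal k * indicator {0..1::real} x \<partial>lebesgue) = ennreal k"
      by (subst nn_integral_cmult_indicator) auto
    also have "(\<integral>\<^sup>+x. ennreal (g x) \<partial>lebesgue) = ennreal (LINT x|lebesgue. g x)"
      using gi g0 by (intro nn_integral_eq_integral) auto
    also have "ennreal (LINT x|lebesgue. g x) + ennreal k = ennreal ((LINT x|lebesgue. g x) + k)"
      using g0 k0 by (intro ennreal_plus[symmetric] Bochner_Integration.integral_nonneg) auto
    also have "\<dots> \<le> ennreal (C' / N)"
    proof (rule ennreal_leI)
      have "(LINT x|lebesgue. g x) \<le> M * (\<mu> powr p * (frac_sum_const \<sigma> * (1 + 3 / 2))) * (J / N)"
        unfolding gint using masses M0 J0 N by (intro mult_right_mono mult_left_mono) auto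
      moreover have "k \<le> M * far_const powr p / N"
      proof -
        have "N powr (-\<sigma>) \<le> N powr (-1)" using N \<sigma> by (intro powr_mono) auto
        hence "N powr (-\<sigma>) \<le> 1 / N" using N by (simp add: powr_minus_divide)
        hence "M * far_const powr p * N powr (-\<sigma>) \<le> M * far_const powr p * (1 / N)" using M0 by (intro mult_left_mono) auto
        thus ?thesis by (simp add: k_def mult.assoc)
      qed
      moreover have "C' / N = M * (\<mu> powr p * (frac_sum_const \<sigma> * (1 + 3 / 2))) * (J / N) + M * far_const powr p / N + 1 / N"
        by (simp add: C'_def add_divide_distrib)
      moreover have "0 \<le> 1 / N" using N by simp
      ultimately show "(LINT x|lebesgue. g x) + k \<le> C' / N" by linarith
    qed
    finally show "Lp_power p (wave N) \<le> ennreal (C' / N)" .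
  qed
qed

lemma eta_ge_one:
  assumes p: "2 / s < p"
  shows "1 \<le> eta p"
proof -
  have s: "0 < s" "2 / s < 1" using s_bounds by auto
  obtain p1 where p1: "2 / s < p1" "p1 < min 1 p" using dense[of "2 / s" "min 1 p"] p s by auto
  hence p1_less: "p1 < 1" by simp
  obtain C' where C': "0 < C'" "\<And>N. 1 \<le> N \<Longrightarrow> Lp_power p1 (wave N) \<le> ennreal (C' / N)"
    using Lp_power_wave_upper[OF p1(1) p1_less] by blast
  have "ereal 1 \<le> eta p"
  proof (rule eta_ge)
    \<comment> \<open>Adding 1 makes the base positive even if only \<open>psi_moment_nonneg\<close>
      is known.\<close>
    define k where "k = (hp_const * psi_moment + 1) powr (p - p1)"
    have k0: "0 < k" using hp_const_pos psi_moment_nonneg by (simp add: k_def add_nonneg_eq_0_iff)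
    show "0 < k * C'" using C' k0 by simp
    show "\<forall>\<^sub>F N in at_top. Lp_power p (wave N) \<le> ennreal (k * C' * N powr (- 1))"
      using eventually_ge_at_top[of 1]
    proof eventually_elim
      case (elim N)
      have "Lp_power p (wave N) = (\<integral>\<^sup>+x. ennreal (norm (wave N x) powr p) * indicator {0..1} x \<partial>lebesgue)"
        by (simp add: Lp_power_def)
      also have "\<dots> \<le> (\<integral>\<^sup>+x. ennreal k * (ennreal (norm (wave N x) powr p1) * indicator {0..1} x) \<partial>lebesgue)"
      proof (rule nn_integral_mono)
        fix x
        show "ennreal (norm (wave N x) powr p) * indicator {0..1} x \<le> ennreal k * (ennreal (norm (wave N x) powr p1) * indicator {0..1} x)"
        proof (cases "x \<in> {0..1}")
          case True
          have "norm (wave N x) powr p = norm (wave N x) powr (p - p1) * norm (wave N x) powr p1"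
            by (simp add: powr_add[symmetric])
          also have "\<dots> \<le> k * norm (wave N x) powr p1"
            unfolding k_def using wave_bounded[OF elim, of x] p1 by (intro mult_right_mono powr_mono2) auto
          finally show ?thesis using True k0 by (simp add: ennreal_mult[symmetric] ennreal_leI)
        qed simp
      qed
      also have "\<dots> = ennreal k * (\<integral>\<^sup>+x. ennreal (norm (wave N x) powr p1) * indicator {0..1} x \<partial>lebesgue)"
        by (rule nn_integral_cmult[OF borel_measurable_wave_powr])
      also have "\<dots> \<le> ennreal k * ennreal (C' / N)" using C'(2)[OF elim] unfolding Lp_power_def by (rule mult_left_mono) simp
      also have "\<dots> = ennreal (k * C' * N powr (- 1))"
        using k0 C'(1) elim by (simp add: ennreal_mult[symmetric] powr_minus_divide)
      finally show ?case .
    qed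
  qed
  thus ?thesis unfolding one_ereal_def .
qed

text \<open>For \<open>p \<le> p1\<close> the bound at \<open>p1\<close> is interpolated through
  \<open>g powr p \<le> l powr p + l powr (p - p1) * g powr p1\<close> with \<open>l = N powr (- 1 / p1)\<close>.\<close>

lemma eta_ge_quotient:
  assumes p: "0 < p" "p \<le> 2 / s" and p1: "2 / s < p1" "p1 < 1"
  shows "ereal (p / p1) \<le> eta p"
proof -
  obtain C' where C': "0 < C'" "\<And>N. 1 \<le> N \<Longrightarrow> Lp_power p1 (wave N) \<le> ennreal (C' / N)"
    using Lp_power_wave_upper[OF p1] by blast
  have p10: "0 < p1" "p < p1" using p p1 by linarith+
  show ?thesis
  proof (rule eta_ge)
    show "0 < 1 + C'" using C' by simp
    show "\<forall>\<^sub>F N in at_top. Lp_power p (wave N) \<le> ennreal ((1 + C') * N powr (- (p / p1)))"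
      using eventually_ge_at_top[of 1]
    proof eventually_elim
      case (elim N)
      define l where "l = N powr (- (1 / p1))"
      have l: "0 < l" using elim by (simp add: l_def)
      have lp: "l powr p = N powr (- (p / p1))" by (simp add: l_def powr_powr)
      \<comment> \<open>The level l balances the two terms: l^(p - p1) times the bound C' / N is
        again of order l^p.\<close>
      have lpp: "l powr (p - p1) = N powr (- (p / p1)) * N"
      proof -
        have "l powr (p - p1) = N powr (- (p / p1) + 1)"
          using p10 by (simp add: l_def powr_powr diff_divide_distrib algebra_simps)
        also have "\<dots> = N powr (- (p / p1)) * N" using elim by (subst powr_add) simp
        finally show ?thesis .
      qed
      have "Lp_power p (wave N) = (\<integral>\<^sup>+x. ennreal (norm (wave N x) powr p) * indicator {0..1} x \<partial>lebesgue)"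
        by (simp add: Lp_power_def)
      also have "\<dots> \<le> (\<integral>\<^sup>+x. ennreal (l powr p) * indicator {0..1} x + ennreal (l powr (p - p1)) * (ennreal (norm (wave N x) powr p1) * indicator {0..1} x) \<partial>lebesgue)"
      proof (rule nn_integral_mono)
        fix x
        show "ennreal (norm (wave N x) powr p) * indicator {0..1} x \<le>
          ennreal (l powr p) * indicator {0..1} x + ennreal (l powr (p - p1)) * (ennreal (norm (wave N x) powr p1) * indicator {0..1} x)"
        proof (cases "x \<in> {0..1}")
          case True
          have "norm (wave N x) powr p \<le> l powr p + l powr (p - p1) * norm (wave N x) powr p1"
          proof (cases "norm (wave N x) \<le> l")
            case True
            hence "norm (wave N x) powr p \<le> l powr p" using p by (intro powr_mono2) auto
            thus ?thesis by (simp add: add_increasing2)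
          next
            case False
            have "norm (wave N x) powr p = norm (wave N x) powr (p - p1) * norm (wave N x) powr p1"
              by (simp add: powr_add[symmetric])
            also have "\<dots> \<le> l powr (p - p1) * norm (wave N x) powr p1"
              using False l p10 by (intro mult_right_mono powr_mono2') auto
            finally show ?thesis by (simp add: add_increasing)
          qed
          hence "ennreal (norm (wave N x) powr p) \<le> ennreal (l powr p + l powr (p - p1) * norm (wave N x) powr p1)" by (rule ennreal_leI)
          also have "\<dots> = ennreal (l powr p) + ennreal (l powr (p - p1)) * ennreal (norm (wave N x) powr p1)"
            by (simp add: ennreal_plus ennreal_mult)
          finally show ?thesis using True by simp
        qed simp
      qed
      also have "\<dots> = (\<integral>\<^sup>+x. ennreal (l powr p) * indicator {0..1::real} x \<partial>lebesgue) +
          (\<integral>\<^sup>+x. ennreal (l powr (p - p1)) * (ennreal (norm (wave N x) powr p1) * indicator {0..1} x) \<partial>lebesgue)"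
      proof (rule nn_integral_add)
        show "(\<lambda>x. ennreal (l powr p) * indicator {0..1::real} x) \<in> borel_measurable lebesgue"
          by (rule borel_measurable_lebesgue_of_borel) measurable
        show "(\<lambda>x. ennreal (l powr (p - p1)) * (ennreal (norm (wave N x) powr p1) * indicator {0..1} x)) \<in> borel_measurable lebesgue"
          by (rule borel_measurable_lebesgue_of_borel) (use borel_measurable_wave in measurable)
      qed
      also have "(\<integral>\<^sup>+x. ennreal (l powr p) * indicator {0..1::real} x \<partial>lebesgue) = ennreal (l powr p)"
        by (subst nn_integral_cmult_indicator) auto
      also have "(\<integral>\<^sup>+x. ennreal (l powr (p - p1)) * (ennreal (norm (wave N x) powr p1) * indicator {0..1} x) \<partial>lebesgue) =
          ennreal (l powr (p - p1)) * (\<integral>\<^sup>+x. ennreal (norm (wave N x) powr p1) * indicator {0..1} x \<partial>lebesgue)"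
        by (rule nn_integral_cmult[OF borel_measurable_wave_powr])
      also have "ennreal (l powr p) + \<dots> \<le> ennreal (l powr p) + ennreal (l powr (p - p1)) * ennreal (C' / N)"
        using C'(2)[OF elim] unfolding Lp_power_def by (intro add_left_mono mult_left_mono) auto
      also have "\<dots> = ennreal (l powr p + l powr (p - p1) * (C' / N))"
        using C'(1) elim by (subst ennreal_plus; (subst ennreal_mult)?) auto
      also have "l powr p + l powr (p - p1) * (C' / N) = (1 + C') * N powr (- (p / p1))"
        unfolding lp lpp using elim by (simp add: algebra_simps)
      finally show ?case .
    qed
  qed
qed

text \<open>Let p1 = p / t decrease to 2 / s, that is, let t increase to s p / 2. Taking t > p keeps
  p1 below 1, and s > 2 leaves room for it.\<close>

lemma eta_ge_half:
  assumes p: "0 < p" "p \<le> 2 / s"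
  shows "ereal (s * p / 2) \<le> eta p"
proof (rule ccontr)
  assume "\<not> ?thesis"
  hence "eta p < ereal (s * p / 2)" by simp
  from ereal_dense2[OF this] obtain r where r: "eta p < ereal r" "r < s * p / 2" by auto
  have ps: "p < s * p / 2" using p s_bounds by (simp add: field_simps)
  have "max r p < s * p / 2" using r(2) ps by simp
  then obtain t where "max r p < t" "t < s * p / 2" using dense by blast
  hence t: "r \<le> t" "p < t" "t < s * p / 2" by auto
  have "0 < t" using t p by linarith
  hence pt: "2 / s < p / t" "p / t < 1" using t p s_bounds by (auto simp: field_simps)
  have "ereal (p / (p / t)) \<le> eta p"
    by (rule eta_ge_quotient[OF p pt])
  hence "ereal t \<le> eta p" using p by simp
  also note r(1)
  finally show False using t by simp
qed

lemma eta_small: "0 < p \<Longrightarrow> p \<le> 2 / s \<Longrightarrow> eta p = ereal (s * p / 2)"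
  by (intro antisym eta_upper(2) eta_ge_half)

lemma eta_large:
  assumes "2 / s \<le> p"
  shows "eta p = 1"
proof (cases "p = 2 / s")
  case True
  thus ?thesis using eta_small[of p] s_bounds by (simp add: one_ereal_def)
next
  case False
  have "0 < 2 / s" using s_bounds by simp
  hence "0 < p" using assms by linarith
  thus ?thesis using False assms eta_upper(1)[of p] eta_ge_one[of p] by (intro antisym) auto
qed

text \<open>The infimum is attained at the corner p = 2 / s of \<eta>.\<close>

lemma legendre_transform:
  assumes h: "0 \<le> h" "h \<le> s / 2"
  shows "(INF p\<in>{0<..}. ereal (p * h) - eta p + 1) = ereal (2 * h / s)"
proof (rule antisym)
  have s: "0 < s" using s_bounds by simp
  have "(INF p\<in>{0<..}. ereal (p * h) - eta p + 1) \<le>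
      ereal (2 / s * h) - eta (2 / s) + 1"
    using s by (intro INF_lower) auto
  also have "\<dots> = ereal (2 * h / s)"
    using s by (subst eta_small) (auto simp: one_ereal_def)
  finally show "(INF p\<in>{0<..}. ereal (p * h) - eta p + 1) \<le> ereal (2 * h / s)" .
  show "ereal (2 * h / s) \<le> (INF p\<in>{0<..}. ereal (p * h) - eta p + 1)"
  proof (rule INF_greatest)
    fix p :: real assume "p \<in> {0<..}"
    hence p: "0 < p" by simp
    show "ereal (2 * h / s) \<le> ereal (p * h) - eta p + 1"
    proof (cases "p \<le> 2 / s")
      case True
      \<comment> \<open>This product is the excess over the value at the corner, and it is
        nonnegative because h <= s / 2; to the right of the corner h >= 0 does the same.\<close>
      have "0 \<le> (2 / s - p) * (s / 2 - h)" using True h by (intro mult_nonneg_nonneg) auto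
      also have "\<dots> = p * h - s * p / 2 + 1 - 2 * h / s" using s by (simp add: algebra_simps)
      finally have "2 * h / s \<le> p * h - s * p / 2 + 1" by simp
      thus ?thesis using eta_small[OF p True] by (simp add: one_ereal_def)
    next
      case False
      hence "2 / s * h \<le> p * h" using h by (intro mult_right_mono) auto
      thus ?thesis using eta_large[of p] False by (simp add: one_ereal_def)
    qed
  qed
qed

end

theorem theorem1p5:
  fixes \<delta> s C \<beta> :: real and \<psi> :: "real \<Rightarrow> complex"
  assumes "0 < \<delta>" and "\<delta> < 1" and "s = 2 * (1 + \<delta>)"
    and "integrable lebesgue \<psi>"
    and "\<not> (AE x in lebesgue. \<psi> x = 0)"
    and "(LINT x|lebesgue. \<psi> x) = 0"
    and "C > 0" and "\<beta> > 1 + s"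
    and "\<And>x. x \<noteq> 0 \<Longrightarrow> norm (\<psi> x) \<le> C * \<bar>x\<bar> powr (- \<beta>)"
  shows "(\<forall>p>0. (p \<le> 2 / s \<longrightarrow> scaling_exponent \<psi> (H_fun \<delta>) p = ereal (s * p / 2)) \<and>
                (p \<ge> 2 / s \<longrightarrow> scaling_exponent \<psi> (H_fun \<delta>) p = 1)) \<and>
         (\<forall>h\<in>{0..s / 2}. singularity_spectrum (H_fun \<delta>) h =
            (INF p\<in>{0<..}. ereal (p * h) - scaling_exponent \<psi> (H_fun \<delta>) p + 1))"
proof -
  interpret wavelet \<delta> s \<psi> C \<beta> by unfold_locales (use assms in auto)
  show ?thesis
    using eta_small eta_large singularity_spectrum_H legendre_transform by auto
qed

end
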